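(* Let $\mathcal{Q}=\bigotimes_{n=1}^\infty M_n$ be the universal UHF algebra and let $G$ be any countable discrete almost abelian group. Then there exists a product type action $G\hookrightarrow\prod_{n=1}^\infty U(M_n)\xrightarrow{\mathrm{Ad}}\mathrm{Aut}\,\mathcal{Q}$ of $G$ on $\mathcal{Q}$ (with first map an injective group homomorphism) that has the Rokhlin property.
   Context: Here $M_n=M_n(\mathbb{C})$, and $\mathrm{Ad}:\prod_{n}U(M_n)\to\mathrm{Aut}\,\mathcal{Q}$ is the homomorphism $(u_n)_n\mapsto\bigotimes_n\mathrm{Ad}\,u_n$. A discrete group is almost abelian if it has an abelian subgroup of finite index (such a group is elementary amenable). Write $a\approx_\epsilon b$ for $\|a-b\|<\epsilon$. Let $A$ be a UHF algebra and $\sigma\in\mathrm{Aut}\,A$. For $1\le k<\infty$, $\sigma$ has the order $k$ Rokhlin property if for every $\epsilon>0$ and every finite set $\{a_1,\dots,a_n\}\subset A$ there are mutually orthogonal projections $p_1,\dots,p_k\in A$ with $[p_i,a_j]\approx_\epsilon 0$ for all $1\le i\le k$, $1\le j\le n$; $\sigma(p_i)\approx_\epsilon p_{i+1}$ for $1\le i\le k$, where $p_{k+1}=p_1$; and $p_1+\dots+p_k=1$. $\sigma$ has the Rokhlin property (also called the order $\infty$ Rokhlin property) if for every $n'\in\mathbb{N}$ there is $N'>n'$ such that for every $\epsilon>0$ and every finite set $\{a_1,\dots,a_n\}\subset A$ there are mutually orthogonal projections $p_1,\dots,p_{N'}\in A$ with $[p_i,a_j]\approx_\epsilon 0$ for all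 $1\le i\le N'$, $1\le j\le n$; $\sigma(p_i)\approx_\epsilon p_{i+1}$ for $1\le i\le N'-1$; and $p_1+\dots+p_{N'}=1$. An action $\alpha$ of an elementary amenable group $G$ on $A$ has the Rokhlin property if for every $g\in G$ the automorphism $\alpha_g$ has the order $k(g)$ Rokhlin property, where $k(g)\in\{1,2,\dots\}\cup\{\infty\}$ is the order of $g$ in $G$. *)

theory Defs
  imports
    "Jordan_Normal_Form.Schur_Decomposition"
    "HOL-Algebra.Product_Groups"
    "HOL-Algebra.Multiplicative_Group"
    "HOL-Library.Countable_Set"
    "HOL-Analysis.L2_Norm"
begin

section \<open>Matrices\<close>

definition vec_norm2 :: "complex vec \<Rightarrow> real" where
  "vec_norm2 v = L2_set (\<lambda>i. cmod (v $ i)) {..<dim_vec v}"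

definition mat_norm :: "complex mat \<Rightarrow> real" where
  "mat_norm A = Sup {vec_norm2 (A *\<^sub>v v) | v. v \<in> carrier_vec (dim_col A) \<and> vec_norm2 v \<le> 1}"

text \<open>
  The index \<open>i * dim_row B + k\<close> stands for the pair \<open>(i, k)\<close>: this is $A \otimes B$ under
  the identification of $M_n \otimes M_k$ with $M_{nk}$ by the lexicographically ordered basis.
\<close>

definition kron :: "complex mat \<Rightarrow> complex mat \<Rightarrow> complex mat" where
  "kron A B = mat (dim_row A * dim_row B) (dim_col A * dim_col B)
     (\<lambda>(i, j). A $$ (i div dim_row B, j div dim_col B) * B $$ (i mod dim_row B, j mod dim_col B))"

lemma mat_adjoint_dim [simp]:
  "dim_row (mat_adjoint A) = dim_col A" "dim_col (mat_adjoint A) = dim_row A"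
  by (auto simp: mat_adjoint_def)

lemma mat_adjoint_index [simp]:
  "i < dim_col A \<Longrightarrow> j < dim_row A \<Longrightarrow> mat_adjoint A $$ (i, j) = cnj (A $$ (j, i))"
  for A :: "complex mat"
  by (simp add: mat_adjoint_def mat_of_rows_def)

lemma mat_adjoint_carrier [simp, intro]:
  "A \<in> carrier_mat n m \<Longrightarrow> mat_adjoint A \<in> carrier_mat m n"
  by auto

lemma mat_adjoint_adjoint [simp]: "mat_adjoint (mat_adjoint A) = A" for A :: "complex mat"
  by (rule eq_matI) auto

lemma mat_adjoint_one [simp]: "mat_adjoint (1\<^sub>m n) = (1\<^sub>m n :: complex mat)"
  by (rule eq_matI) auto

lemma mat_adjoint_mult:
  fixes A :: "complex mat"
  assumes "A \<in> carrier_mat n m" "B \<in> carrier_mat m k"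
  shows "mat_adjoint (A * B) = mat_adjoint B * mat_adjoint A"
  using assms by (intro eq_matI) (auto simp: scalar_prod_def mult.commute)

lemma mat_adjoint_add:
  fixes A :: "complex mat"
  assumes "A \<in> carrier_mat n m" "B \<in> carrier_mat n m"
  shows "mat_adjoint (A + B) = mat_adjoint A + mat_adjoint B"
  using assms by (intro eq_matI) auto

lemma mat_adjoint_minus:
  fixes A :: "complex mat"
  assumes "A \<in> carrier_mat n m" "B \<in> carrier_mat n m"
  shows "mat_adjoint (A - B) = mat_adjoint A - mat_adjoint B"
  using assms by (intro eq_matI) auto

lemma mat_adjoint_smult: "mat_adjoint (c \<cdot>\<^sub>m A) = cnj c \<cdot>\<^sub>m mat_adjoint A" for A :: "complex mat"
  by (intro eq_matI) auto

subsection \<open>The operator norm\<close>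

lemma vec_norm2_nonneg [simp]: "0 \<le> vec_norm2 v"
  by (simp add: vec_norm2_def)

lemma vec_norm2_sq: "(vec_norm2 v)\<^sup>2 = (\<Sum>i<dim_vec v. (cmod (v $ i))\<^sup>2)"
  by (simp add: vec_norm2_def L2_set_def sum_nonneg)

lemma vec_norm2_zero [simp]: "vec_norm2 (0\<^sub>v n) = 0"
  by (simp add: vec_norm2_def L2_set_def)

lemma vec_norm2_eq_0: "v \<in> carrier_vec n \<Longrightarrow> vec_norm2 v = 0 \<longleftrightarrow> v = 0\<^sub>v n"
  by (auto simp: vec_norm2_def L2_set_eq_0_iff intro!: eq_vecI)

lemma vec_norm2_triangle:
  assumes "v \<in> carrier_vec n" "w \<in> carrier_vec n"
  shows "vec_norm2 (v + w) \<le> vec_norm2 v + vec_norm2 w"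
proof -
  have "vec_norm2 (v + w) \<le> L2_set (\<lambda>i. cmod (v $ i) + cmod (w $ i)) {..<n}"
    using assms by (auto simp: vec_norm2_def intro!: L2_set_mono norm_triangle_ineq)
  also have "\<dots> \<le> vec_norm2 v + vec_norm2 w"
    using assms by (auto simp: vec_norm2_def intro!: L2_set_triangle_ineq)
  finally show ?thesis .
qed

lemma vec_norm2_smult: "vec_norm2 (c \<cdot>\<^sub>v v) = cmod c * vec_norm2 v"
  by (simp add: vec_norm2_def norm_mult L2_set_right_distrib cong: L2_set_cong_simp)

lemma cmod_scalar_prod_le:
  assumes "v \<in> carrier_vec n" "w \<in> carrier_vec n"
  shows "cmod (v \<bullet> w) \<le> vec_norm2 v * vec_norm2 w"
proof -
  have "cmod (v \<bullet> w) \<le> (\<Sum>i<n. \<bar>cmod (v $ i)\<bar> * \<bar>cmod (w $ i)\<bar>)"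
    using assms unfolding scalar_prod_def
    by (auto simp: norm_mult atLeast0LessThan intro!: order.trans[OF norm_sum])
  also have "\<dots> \<le> vec_norm2 v * vec_norm2 w"
    using assms L2_set_mult_ineq[of "\<lambda>i. cmod (v $ i)" "\<lambda>i. cmod (w $ i)" "{..<n}"]
    by (auto simp: vec_norm2_def)
  finally show ?thesis .
qed

lemma vec_norm2_mult_bounded: "\<exists>C\<ge>0. \<forall>v\<in>carrier_vec (dim_col A). vec_norm2 (A *\<^sub>v v) \<le> C * vec_norm2 v"
proof (intro exI conjI ballI)
  let ?C = "\<Sum>i<dim_row A. vec_norm2 (row A i)"
  show "0 \<le> ?C" by (simp add: sum_nonneg)
  fix v :: "complex vec" assume v: "v \<in> carrier_vec (dim_col A)"
  have "vec_norm2 (A *\<^sub>v v) \<le> (\<Sum>i<dim_row A. cmod (row A i \<bullet> v))"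
    unfolding vec_norm2_def by (rule order.trans[OF L2_set_le_sum]) auto
  also have "\<dots> \<le> (\<Sum>i<dim_row A. vec_norm2 (row A i) * vec_norm2 v)"
    using v by (intro sum_mono cmod_scalar_prod_le[where n = "dim_col A"]) auto
  finally show "vec_norm2 (A *\<^sub>v v) \<le> ?C * vec_norm2 v" by (simp add: sum_distrib_right)
qed

lemma mat_norm_bdd:
  "bdd_above {vec_norm2 (A *\<^sub>v v) | v. v \<in> carrier_vec (dim_col A) \<and> vec_norm2 v \<le> 1}"
proof -
  obtain C where C: "C \<ge> 0" "\<And>v. v \<in> carrier_vec (dim_col A) \<Longrightarrow> vec_norm2 (A *\<^sub>v v) \<le> C * vec_norm2 v"
    using vec_norm2_mult_bounded by blast
  have "vec_norm2 (A *\<^sub>v v) \<le> C" if "v \<in> carrier_vec (dim_col A)" "vec_norm2 v \<le> 1" for v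
    using C(2)[OF that(1)] mult_left_mono[OF that(2) C(1)] by simp
  thus ?thesis by (auto intro!: bdd_aboveI[of _ C])
qed

lemma mat_norm_nonneg [simp]: "0 \<le> mat_norm A"
proof -
  have "vec_norm2 (A *\<^sub>v 0\<^sub>v (dim_col A)) \<le> mat_norm A"
    unfolding mat_norm_def by (rule cSup_upper[OF _ mat_norm_bdd]) (force intro: exI[of _ "0\<^sub>v (dim_col A)"])
  thus ?thesis using vec_norm2_nonneg order.trans by blast
qed

lemma mat_norm_bound:
  assumes "v \<in> carrier_vec (dim_col A)"
  shows "vec_norm2 (A *\<^sub>v v) \<le> mat_norm A * vec_norm2 v"
proof (cases "vec_norm2 v = 0")
  case True
  have "vec_norm2 (A *\<^sub>v v) = 0"
    using vec_norm2_mult_bounded[of A] True assms vec_norm2_nonneg[of "A *\<^sub>v v"]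
    by (metis antisym mult_zero_right)
  thus ?thesis by simp
next
  case False
  define r where "r = vec_norm2 v"
  have r: "r > 0" using False vec_norm2_nonneg[of v] by (simp add: r_def less_le del: vec_norm2_nonneg)
  define w where "w = complex_of_real (1 / r) \<cdot>\<^sub>v v"
  have w: "w \<in> carrier_vec (dim_col A)" using assms by (simp add: w_def)
  have "vec_norm2 w = 1" using r unfolding w_def vec_norm2_smult by (simp add: r_def norm_divide)
  hence "vec_norm2 (A *\<^sub>v w) \<le> mat_norm A"
    unfolding mat_norm_def using w by (intro cSup_upper[OF _ mat_norm_bdd]) force
  also have "A *\<^sub>v w = complex_of_real (1 / r) \<cdot>\<^sub>v (A *\<^sub>v v)"
    unfolding w_def by (rule mult_mat_vec[OF _ assms]) auto
  finally show ?thesis using r unfolding vec_norm2_smult by (simp add: norm_divide r_def field_simps)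
qed

lemma mat_norm_leI:
  assumes "C \<ge> 0" "\<And>v. v \<in> carrier_vec (dim_col A) \<Longrightarrow> vec_norm2 (A *\<^sub>v v) \<le> C * vec_norm2 v"
  shows "mat_norm A \<le> C"
  unfolding mat_norm_def
proof (rule cSup_least, goal_cases)
  case 1
  have "vec_norm2 (A *\<^sub>v 0\<^sub>v (dim_col A)) \<in> {vec_norm2 (A *\<^sub>v v) | v. v \<in> carrier_vec (dim_col A) \<and> vec_norm2 v \<le> 1}"
    by force
  thus ?case by blast
next
  case (2 x)
  then obtain v where v: "v \<in> carrier_vec (dim_col A)" "vec_norm2 v \<le> 1" "x = vec_norm2 (A *\<^sub>v v)" by blast
  have "C * vec_norm2 v \<le> C * 1" using v assms by (intro mult_left_mono) auto
  with assms(2)[OF v(1)] v(3) show ?case by simp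
qed

lemma mat_norm_triangle:
  assumes "A \<in> carrier_mat n m" "B \<in> carrier_mat n m"
  shows "mat_norm (A + B) \<le> mat_norm A + mat_norm B"
proof (rule mat_norm_leI)
  fix v :: "complex vec" assume v: "v \<in> carrier_vec (dim_col (A + B))"
  have "vec_norm2 ((A + B) *\<^sub>v v) = vec_norm2 (A *\<^sub>v v + B *\<^sub>v v)"
    using v assms by (subst add_mult_distrib_mat_vec[of _ n m]) auto
  also have "\<dots> \<le> vec_norm2 (A *\<^sub>v v) + vec_norm2 (B *\<^sub>v v)"
    using assms v by (intro vec_norm2_triangle[of _ n]) auto
  also have "\<dots> \<le> mat_norm A * vec_norm2 v + mat_norm B * vec_norm2 v"
    using v assms by (intro add_mono mat_norm_bound) auto
  finally show "vec_norm2 ((A + B) *\<^sub>v v) \<le> (mat_norm A + mat_norm B) * vec_norm2 v"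
    by (simp add: algebra_simps)
qed auto

lemma mat_norm_mult:
  assumes "A \<in> carrier_mat n m" "B \<in> carrier_mat m k"
  shows "mat_norm (A * B) \<le> mat_norm A * mat_norm B"
proof (rule mat_norm_leI)
  fix v :: "complex vec" assume v: "v \<in> carrier_vec (dim_col (A * B))"
  have "vec_norm2 ((A * B) *\<^sub>v v) = vec_norm2 (A *\<^sub>v (B *\<^sub>v v))"
    using v assms by (subst assoc_mult_mat_vec[of _ n m _ k]) auto
  also have "\<dots> \<le> mat_norm A * vec_norm2 (B *\<^sub>v v)"
    using v assms by (intro mat_norm_bound) auto
  also have "\<dots> \<le> mat_norm A * (mat_norm B * vec_norm2 v)"
    using v assms by (intro mult_left_mono mat_norm_bound) auto
  finally show "vec_norm2 ((A * B) *\<^sub>v v) \<le> mat_norm A * mat_norm B * vec_norm2 v"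
    by (simp add: algebra_simps)
qed auto

lemma mat_norm_smult_le: "mat_norm (c \<cdot>\<^sub>m A) \<le> cmod c * mat_norm A"
proof (rule mat_norm_leI)
  fix v :: "complex vec" assume v: "v \<in> carrier_vec (dim_col (c \<cdot>\<^sub>m A))"
  have "(c \<cdot>\<^sub>m A) *\<^sub>v v = c \<cdot>\<^sub>v (A *\<^sub>v v)"
    using v by (intro eq_vecI) (auto simp: scalar_prod_def sum_distrib_left mult.assoc)
  thus "vec_norm2 ((c \<cdot>\<^sub>m A) *\<^sub>v v) \<le> cmod c * mat_norm A * vec_norm2 v"
    using mat_norm_bound[of v A] v by (simp add: vec_norm2_smult mult.assoc mult_left_mono)
qed auto

lemma mat_norm_zero [simp]: "mat_norm (0\<^sub>m n m) = 0"
proof -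
  have "mat_norm (0\<^sub>m n m) \<le> 0"
    by (rule mat_norm_leI) (auto simp: vec_norm2_def L2_set_def)
  thus ?thesis using mat_norm_nonneg[of "0\<^sub>m n m"] by linarith
qed

lemma mat_norm_smult: "mat_norm (c \<cdot>\<^sub>m A) = cmod c * mat_norm A"
proof (cases "c = 0")
  case True
  have "0 \<cdot>\<^sub>m A = 0\<^sub>m (dim_row A) (dim_col A)" by (intro eq_matI) auto
  thus ?thesis using True by simp
next
  case False
  have "A = inverse c \<cdot>\<^sub>m (c \<cdot>\<^sub>m A)" using False by (intro eq_matI) auto
  hence "mat_norm A \<le> inverse (cmod c) * mat_norm (c \<cdot>\<^sub>m A)"
    using mat_norm_smult_le[of "inverse c" "c \<cdot>\<^sub>m A"] by (simp add: norm_inverse)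
  hence "cmod c * mat_norm A \<le> mat_norm (c \<cdot>\<^sub>m A)" using False by (simp add: field_simps)
  thus ?thesis using mat_norm_smult_le[of c A] by simp
qed

lemma mat_norm_one: "n > 0 \<Longrightarrow> mat_norm (1\<^sub>m n) = 1"
proof (rule antisym)
  show "mat_norm (1\<^sub>m n) \<le> 1" by (rule mat_norm_leI) auto
  assume n: "n > 0"
  have "(\<Sum>i<n. (cmod (unit_vec n 0 $ i))\<^sup>2) = (\<Sum>i<n. if i = 0 then 1 else 0)"
    by (rule sum.cong) (auto simp: unit_vec_def)
  hence "vec_norm2 (unit_vec n 0) = 1"
    using n by (simp add: vec_norm2_def L2_set_def del: index_unit_vec(1))
  thus "1 \<le> mat_norm (1\<^sub>m n)"
    using mat_norm_bound[of "unit_vec n 0" "1\<^sub>m n"] by simp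
qed

lemma vec_norm2_sq_cscalar: "v \<bullet> conjugate v = complex_of_real ((vec_norm2 v)\<^sup>2)"
  by (simp add: scalar_prod_def vec_norm2_sq atLeast0LessThan complex_norm_square del: of_real_power)

lemma vec_norm2_conjugate [simp]: "vec_norm2 (conjugate v) = vec_norm2 v"
  by (simp add: vec_norm2_def L2_set_def)

lemma mat_adjoint_cscalar:
  fixes A :: "complex mat"
  assumes A: "A \<in> carrier_mat n m" and v: "v \<in> carrier_vec m" and w: "w \<in> carrier_vec n"
  shows "(A *\<^sub>v v) \<bullet> conjugate w = v \<bullet> conjugate (mat_adjoint A *\<^sub>v w)"
proof -
  have "(A *\<^sub>v v) \<bullet> conjugate w = (\<Sum>i<n. \<Sum>j<m. A $$ (i,j) * v $ j * cnj (w $ i))"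
    using assms by (simp add: scalar_prod_def atLeast0LessThan sum_distrib_right)
  also have "\<dots> = (\<Sum>j<m. \<Sum>i<n. A $$ (i,j) * v $ j * cnj (w $ i))" by (rule sum.swap)
  also have "\<dots> = v \<bullet> conjugate (mat_adjoint A *\<^sub>v w)"
    using assms by (simp add: scalar_prod_def atLeast0LessThan sum_distrib_left mult_ac)
  finally show ?thesis .
qed

lemma mat_norm_sq_le: "(mat_norm A)\<^sup>2 \<le> mat_norm (mat_adjoint A * A)"
proof -
  let ?B = "mat_adjoint A * A"
  have "mat_norm A \<le> sqrt (mat_norm ?B)"
  proof (rule mat_norm_leI)
    fix v :: "complex vec" assume v: "v \<in> carrier_vec (dim_col A)"
    have "complex_of_real ((vec_norm2 (A *\<^sub>v v))\<^sup>2) = v \<bullet> conjugate (mat_adjoint A *\<^sub>v (A *\<^sub>v v))"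
      unfolding vec_norm2_sq_cscalar[symmetric]
      using v by (intro mat_adjoint_cscalar[of _ "dim_row A" "dim_col A"]) (auto intro: mult_mat_vec_carrier)
    also have "mat_adjoint A *\<^sub>v (A *\<^sub>v v) = ?B *\<^sub>v v"
      using v by (subst assoc_mult_mat_vec[of _ "dim_col A" "dim_row A" _ "dim_col A"]) auto
    finally have "(vec_norm2 (A *\<^sub>v v))\<^sup>2 = cmod (v \<bullet> conjugate (?B *\<^sub>v v))"
      by (metis abs_of_nonneg norm_of_real zero_le_power2)
    also have "\<dots> \<le> vec_norm2 v * vec_norm2 (?B *\<^sub>v v)"
    proof -
      have "?B *\<^sub>v v \<in> carrier_vec (dim_col A)" by (rule carrier_vecI) simp
      hence "conjugate (?B *\<^sub>v v) \<in> carrier_vec (dim_col A)" by simp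
      from cmod_scalar_prod_le[OF v this] show ?thesis unfolding vec_norm2_conjugate .
    qed
    also have "\<dots> \<le> vec_norm2 v * (mat_norm ?B * vec_norm2 v)"
      using v by (intro mult_left_mono mat_norm_bound) auto
    also have "\<dots> = (sqrt (mat_norm ?B) * vec_norm2 v)\<^sup>2"
      by (simp add: power_mult_distrib power2_eq_square)
    finally show "vec_norm2 (A *\<^sub>v v) \<le> sqrt (mat_norm ?B) * vec_norm2 v"
      by (rule power2_le_imp_le) simp
  qed simp
  hence "(mat_norm A)\<^sup>2 \<le> (sqrt (mat_norm ?B))\<^sup>2" by (intro power_mono) auto
  thus ?thesis by simp
qed

lemma mat_norm_adjoint_mult: "mat_norm (mat_adjoint A * A) \<le> mat_norm (mat_adjoint A) * mat_norm A"
  by (rule mat_norm_mult[of _ "dim_col A" "dim_row A" _ "dim_col A"]) (auto intro: carrier_matI)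

lemma mat_norm_adjoint [simp]: "mat_norm (mat_adjoint A) = mat_norm A"
proof -
  have *: "mat_norm A \<le> mat_norm (mat_adjoint A)" for A
  proof (cases "mat_norm A = 0")
    case True
    thus ?thesis by (metis mat_norm_nonneg)
  next
    case False
    hence "mat_norm A > 0" using mat_norm_nonneg[of A] by (metis less_le)
    moreover have "mat_norm A * mat_norm A \<le> mat_norm (mat_adjoint A) * mat_norm A"
      using order.trans[OF mat_norm_sq_le[of A] mat_norm_adjoint_mult] unfolding power2_eq_square .
    ultimately show ?thesis by (rule mult_right_le_imp_le[rotated])
  qed
  show ?thesis using *[of A] *[of "mat_adjoint A"] unfolding mat_adjoint_adjoint by (rule antisym[rotated])
qed

lemma mat_norm_cstar: "mat_norm (mat_adjoint A * A) = (mat_norm A)\<^sup>2"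
  using mat_norm_sq_le[of A] mat_norm_adjoint_mult[of A]
  unfolding mat_norm_adjoint power2_eq_square by (rule antisym[rotated])

subsection \<open>The Kronecker product\<close>

lemma kron_dim [simp]: "dim_row (kron A B) = dim_row A * dim_row B" "dim_col (kron A B) = dim_col A * dim_col B"
  by (auto simp: kron_def)

lemma kron_carrier [intro]:
  "A \<in> carrier_mat n m \<Longrightarrow> B \<in> carrier_mat k l \<Longrightarrow> kron A B \<in> carrier_mat (n * k) (m * l)"
  by auto

lemma kron_index:
  "i < dim_row A * dim_row B \<Longrightarrow> j < dim_col A * dim_col B \<Longrightarrow>
   kron A B $$ (i, j) = A $$ (i div dim_row B, j div dim_col B) * B $$ (i mod dim_row B, j mod dim_col B)"
  by (auto simp: kron_def)

lemma div_mod_less: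
  fixes i :: nat
  assumes "i < n * k"
  shows "i div k < n" "i mod k < k"
  using assms by (auto simp: less_mult_imp_div_less intro!: mod_less_divisor gr0I)

lemma sum_div_mod:
  fixes f :: "nat \<Rightarrow> nat \<Rightarrow> 'a :: comm_monoid_add"
  shows "(\<Sum>i<n * k. f (i div k) (i mod k)) = (\<Sum>a<n. \<Sum>b<k. f a b)"
proof -
  have "(\<Sum>i<n * k. f (i div k) (i mod k)) = (\<Sum>a<n. \<Sum>i = a * k..<a * k + k. f (i div k) (i mod k))"
    by (simp add: sum.nat_group)
  also have "\<dots> = (\<Sum>a<n. \<Sum>b<k. f a b)"
  proof (rule sum.cong[OF refl])
    fix a
    have "(\<Sum>i = a * k..<a * k + k. f (i div k) (i mod k)) = (\<Sum>b<k. f ((a * k + b) div k) ((a * k + b) mod k))"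
      using sum.shift_bounds_nat_ivl[of "\<lambda>i. f (i div k) (i mod k)" 0 "a * k" k]
      by (simp add: atLeast0LessThan add.commute)
    thus "(\<Sum>i = a * k..<a * k + k. f (i div k) (i mod k)) = (\<Sum>b<k. f a b)" by simp
  qed
  finally show ?thesis .
qed

lemma kron_mult:
  assumes "A \<in> carrier_mat n n" "B \<in> carrier_mat k k" "C \<in> carrier_mat n n" "D \<in> carrier_mat k k"
  shows "kron A B * kron C D = kron (A * C) (B * D)"
proof (rule eq_matI)
  fix i j assume ij: "i < dim_row (kron (A * C) (B * D))" "j < dim_col (kron (A * C) (B * D))"
  hence ij: "i < n * k" "j < n * k" using assms by auto
  note dm = div_mod_less[OF ij(1)] div_mod_less[OF ij(2)]
  have "(kron A B * kron C D) $$ (i, j) =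
     (\<Sum>l<n * k. (A $$ (i div k, l div k) * B $$ (i mod k, l mod k)) * (C $$ (l div k, j div k) * D $$ (l mod k, j mod k)))"
    using assms ij by (simp add: scalar_prod_def kron_index atLeast0LessThan)
  also have "\<dots> = (\<Sum>a<n. \<Sum>b<k. (A $$ (i div k, a) * B $$ (i mod k, b)) * (C $$ (a, j div k) * D $$ (b, j mod k)))"
    by (rule sum_div_mod)
  also have "\<dots> = (\<Sum>a<n. A $$ (i div k, a) * C $$ (a, j div k)) * (\<Sum>b<k. B $$ (i mod k, b) * D $$ (b, j mod k))"
    by (simp add: sum_product mult_ac)
  also have "\<dots> = kron (A * C) (B * D) $$ (i, j)"
    using assms ij dm by (simp add: kron_index scalar_prod_def atLeast0LessThan)
  finally show "(kron A B * kron C D) $$ (i, j) = kron (A * C) (B * D) $$ (i, j)" .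
qed (use assms in auto)

lemma kron_assoc: "kron (kron A B) C = kron A (kron B C)"
proof (rule eq_matI)
  fix i j assume ij: "i < dim_row (kron A (kron B C))" "j < dim_col (kron A (kron B C))"
  hence ij: "i < dim_row A * dim_row B * dim_row C" "j < dim_col A * dim_col B * dim_col C" by (auto simp: mult.assoc)
  note dm = div_mod_less[OF ij(1)] div_mod_less[OF ij(2)]
  have ij': "i < dim_row A * (dim_row B * dim_row C)" "j < dim_col A * (dim_col B * dim_col C)"
    using ij by (auto simp: mult.assoc)
  note dm' = div_mod_less[OF ij'(1)] div_mod_less[OF ij'(2)]
  have 1: "(i div r) div q = i div (q * r)" "(i div r) mod q = (i mod (q * r)) div r" "i mod (q * r) mod r = i mod r" for i q r :: nat
  proof -
    show "(i div r) div q = i div (q * r)" by (metis div_mult2_eq mult.commute)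
    show "i mod (q * r) mod r = i mod r" by (simp add: mod_mod_cancel)
    have e: "i mod (r * q) = r * (i div r mod q) + i mod r" by (rule mod_mult2_eq)
    show "(i div r) mod q = (i mod (q * r)) div r"
    proof (cases "r = 0")
      case False
      thus ?thesis using e by (simp add: mult.commute)
    qed simp
  qed
  show "kron (kron A B) C $$ (i, j) = kron A (kron B C) $$ (i, j)"
    using ij ij' dm dm' by (simp add: kron_index 1 mult.assoc)
qed auto

lemma kron_one_one: "kron (1\<^sub>m n) (1\<^sub>m k) = 1\<^sub>m (n * k)"
proof (rule eq_matI)
  fix i j assume ij: "i < dim_row (1\<^sub>m (n * k) :: complex mat)" "j < dim_col (1\<^sub>m (n * k) :: complex mat)"
  hence ij: "i < n * k" "j < n * k" by auto
  note dm = div_mod_less[OF ij(1)] div_mod_less[OF ij(2)]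
  have "i = j" if "i div k = j div k" "i mod k = j mod k" using that by (metis div_mult_mod_eq)
  thus "kron (1\<^sub>m n) (1\<^sub>m k) $$ (i, j) = 1\<^sub>m (n * k) $$ (i, j)"
    using ij dm by (auto simp: kron_index)
qed auto

lemma kron_one_1 [simp]: "kron A (1\<^sub>m 1) = A"
  by (rule eq_matI) (auto simp: kron_index)

lemma kron_adjoint: "mat_adjoint (kron A B) = kron (mat_adjoint A) (mat_adjoint B)"
proof (rule eq_matI)
  fix i j assume "i < dim_row (kron (mat_adjoint A) (mat_adjoint B))" "j < dim_col (kron (mat_adjoint A) (mat_adjoint B))"
  hence ij: "i < dim_col A * dim_col B" "j < dim_row A * dim_row B" by auto
  note dm = div_mod_less[OF ij(1)] div_mod_less[OF ij(2)]
  show "mat_adjoint (kron A B) $$ (i, j) = kron (mat_adjoint A) (mat_adjoint B) $$ (i, j)"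
    using ij dm by (simp add: kron_index)
qed auto

lemma kron_add_left:
  assumes "A \<in> carrier_mat n m" "A' \<in> carrier_mat n m"
  shows "kron (A + A') B = kron A B + kron A' B"
proof (rule eq_matI)
  fix i j assume "i < dim_row (kron A B + kron A' B)" "j < dim_col (kron A B + kron A' B)"
  hence ij: "i < n * dim_row B" "j < m * dim_col B" using assms by auto
  note dm = div_mod_less[OF ij(1)] div_mod_less[OF ij(2)]
  show "kron (A + A') B $$ (i, j) = (kron A B + kron A' B) $$ (i, j)"
    using ij dm assms by (simp add: kron_index distrib_right)
qed (use assms in auto)

lemma kron_smult_left: "kron (c \<cdot>\<^sub>m A) B = c \<cdot>\<^sub>m kron A B"
proof (rule eq_matI)
  fix i j assume "i < dim_row (c \<cdot>\<^sub>m kron A B)" "j < dim_col (c \<cdot>\<^sub>m kron A B)"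
  hence ij: "i < dim_row A * dim_row B" "j < dim_col A * dim_col B" by auto
  note dm = div_mod_less[OF ij(1)] div_mod_less[OF ij(2)]
  show "kron (c \<cdot>\<^sub>m A) B $$ (i, j) = (c \<cdot>\<^sub>m kron A B) $$ (i, j)"
    using ij dm by (simp add: kron_index)
qed auto

lemma kron_minus_left:
  assumes "A \<in> carrier_mat n m" "A' \<in> carrier_mat n m"
  shows "kron (A - A') B = kron A B - kron A' B"
proof (rule eq_matI)
  fix i j assume "i < dim_row (kron A B - kron A' B)" "j < dim_col (kron A B - kron A' B)"
  hence ij: "i < n * dim_row B" "j < m * dim_col B" using assms by auto
  note dm = div_mod_less[OF ij(1)] div_mod_less[OF ij(2)]
  show "kron (A - A') B $$ (i, j) = (kron A B - kron A' B) $$ (i, j)"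
    using ij dm assms by (simp add: kron_index left_diff_distrib)
qed (use assms in auto)

lemma kron_zero_left: "kron (0\<^sub>m n m) B = 0\<^sub>m (n * dim_row B) (m * dim_col B)"
proof (rule eq_matI)
  fix i j assume "i < dim_row (0\<^sub>m (n * dim_row B) (m * dim_col B) :: complex mat)" "j < dim_col (0\<^sub>m (n * dim_row B) (m * dim_col B) :: complex mat)"
  hence ij: "i < n * dim_row B" "j < m * dim_col B" by auto
  note dm = div_mod_less[OF ij(1)] div_mod_less[OF ij(2)]
  show "kron (0\<^sub>m n m) B $$ (i, j) = 0\<^sub>m (n * dim_row B) (m * dim_col B) $$ (i, j)"
    using ij dm by (simp add: kron_index)
qed auto

lemma vec_norm2_kron:
  assumes A: "A \<in> carrier_mat n m" and v: "v \<in> carrier_vec (m * k)"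
  shows "(vec_norm2 (kron A (1\<^sub>m k) *\<^sub>v v))\<^sup>2 = (\<Sum>b<k. (vec_norm2 (A *\<^sub>v vec m (\<lambda>a. v $ (a * k + b))))\<^sup>2)"
proof -
  have "(vec_norm2 (kron A (1\<^sub>m k) *\<^sub>v v))\<^sup>2 = (\<Sum>i<n * k. (cmod (\<Sum>a<m. A $$ (i div k, a) * v $ (a * k + i mod k)))\<^sup>2)"
    unfolding vec_norm2_sq
  proof (rule sum.cong)
    fix i assume "i \<in> {..<n * k}"
    hence i: "i < n * k" by simp
    note dm = div_mod_less[OF i]
    have "(kron A (1\<^sub>m k) *\<^sub>v v) $ i = (\<Sum>l<m * k. A $$ (i div k, l div k) * 1\<^sub>m k $$ (i mod k, l mod k) * v $ l)"
      using A v i by (simp add: scalar_prod_def kron_index atLeast0LessThan)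
    also have "\<dots> = (\<Sum>l<m * k. A $$ (i div k, l div k) * 1\<^sub>m k $$ (i mod k, l mod k) * v $ (l div k * k + l mod k))"
      by simp
    also have "\<dots> = (\<Sum>a<m. \<Sum>b<k. A $$ (i div k, a) * 1\<^sub>m k $$ (i mod k, b) * v $ (a * k + b))"
      by (rule sum_div_mod)
    also have "\<dots> = (\<Sum>a<m. \<Sum>b<k. if b = i mod k then A $$ (i div k, a) * v $ (a * k + i mod k) else 0)"
      using dm by (intro sum.cong refl) auto
    also have "\<dots> = (\<Sum>a<m. A $$ (i div k, a) * v $ (a * k + i mod k))"
      using dm by simp
    finally show "(cmod ((kron A (1\<^sub>m k) *\<^sub>v v) $ i))\<^sup>2 = (cmod (\<Sum>a<m. A $$ (i div k, a) * v $ (a * k + i mod k)))\<^sup>2"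
      by simp
  qed (use A in auto)
  also have "\<dots> = (\<Sum>i<n. \<Sum>b<k. (cmod (\<Sum>a<m. A $$ (i, a) * v $ (a * k + b)))\<^sup>2)"
    by (rule sum_div_mod)
  also have "\<dots> = (\<Sum>b<k. \<Sum>i<n. (cmod (\<Sum>a<m. A $$ (i, a) * v $ (a * k + b)))\<^sup>2)"
    by (rule sum.swap)
  also have "\<dots> = (\<Sum>b<k. (vec_norm2 (A *\<^sub>v vec m (\<lambda>a. v $ (a * k + b))))\<^sup>2)"
    using A by (simp add: vec_norm2_sq scalar_prod_def atLeast0LessThan)
  finally show ?thesis .
qed

lemma vec_norm2_split:
  assumes v: "v \<in> carrier_vec (m * k)"
  shows "(vec_norm2 v)\<^sup>2 = (\<Sum>b<k. (vec_norm2 (vec m (\<lambda>a. v $ (a * k + b))))\<^sup>2)"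
proof -
  have 1: "kron (1\<^sub>m m) (1\<^sub>m k) *\<^sub>v v = v" unfolding kron_one_one using v by simp
  have 2: "1\<^sub>m m *\<^sub>v vec m f = vec m f" for f :: "nat \<Rightarrow> complex" by simp
  show ?thesis using vec_norm2_kron[OF one_carrier_mat v] unfolding 1 2 .
qed

lemma mat_norm_kron_one:
  assumes A: "A \<in> carrier_mat n m" and k: "k > 0"
  shows "mat_norm (kron A (1\<^sub>m k)) = mat_norm A"
proof (rule antisym)
  show "mat_norm (kron A (1\<^sub>m k)) \<le> mat_norm A"
  proof (rule mat_norm_leI)
    fix v :: "complex vec" assume "v \<in> carrier_vec (dim_col (kron A (1\<^sub>m k)))"
    hence v: "v \<in> carrier_vec (m * k)" using A by simp
    have "(vec_norm2 (kron A (1\<^sub>m k) *\<^sub>v v))\<^sup>2 \<le> (\<Sum>b<k. (mat_norm A * vec_norm2 (vec m (\<lambda>a. v $ (a * k + b))))\<^sup>2)"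
      unfolding vec_norm2_kron[OF A v] using A by (intro sum_mono power_mono mat_norm_bound) auto
    also have "\<dots> = (mat_norm A * vec_norm2 v)\<^sup>2"
      by (simp add: power_mult_distrib vec_norm2_split[OF v] sum_distrib_left)
    finally show "vec_norm2 (kron A (1\<^sub>m k) *\<^sub>v v) \<le> mat_norm A * vec_norm2 v"
      by (rule power2_le_imp_le) simp
  qed simp
next
  show "mat_norm A \<le> mat_norm (kron A (1\<^sub>m k))"
  proof (rule mat_norm_leI)
    fix w :: "complex vec" assume "w \<in> carrier_vec (dim_col A)"
    hence w: "w \<in> carrier_vec m" using A by simp
    define v where "v = vec (m * k) (\<lambda>i. if i mod k = 0 then w $ (i div k) else 0)"
    have v: "v \<in> carrier_vec (m * k)" by (simp add: v_def)
    have lt: "a * k + b < m * k" if "a < m" "b < k" for a b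
    proof -
      have "a * k + b < Suc a * k" using that by simp
      also have "\<dots> \<le> m * k" using that by (intro mult_le_mono1) auto
      finally show ?thesis .
    qed
    have vb: "vec m (\<lambda>a. v $ (a * k + b)) = (if b = 0 then w else 0\<^sub>v m)" if "b < k" for b
      using w that lt k by (intro eq_vecI) (auto simp: v_def)
    have A0: "A *\<^sub>v 0\<^sub>v m = 0\<^sub>v n" using A by (intro eq_vecI) (auto simp: scalar_prod_def)
    have "(vec_norm2 v)\<^sup>2 = (\<Sum>b<k. if b = 0 then (vec_norm2 w)\<^sup>2 else 0)"
      unfolding vec_norm2_split[OF v] by (rule sum.cong) (auto simp: vb)
    hence nv: "(vec_norm2 v)\<^sup>2 = (vec_norm2 w)\<^sup>2" using k by simp
    have "(vec_norm2 (kron A (1\<^sub>m k) *\<^sub>v v))\<^sup>2 = (\<Sum>b<k. if b = 0 then (vec_norm2 (A *\<^sub>v w))\<^sup>2 else 0)"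
      unfolding vec_norm2_kron[OF A v] by (rule sum.cong) (auto simp: vb A0)
    hence nAv: "(vec_norm2 (kron A (1\<^sub>m k) *\<^sub>v v))\<^sup>2 = (vec_norm2 (A *\<^sub>v w))\<^sup>2" using k by simp
    show "vec_norm2 (A *\<^sub>v w) \<le> mat_norm (kron A (1\<^sub>m k)) * vec_norm2 w"
      using mat_norm_bound[of v "kron A (1\<^sub>m k)"] v A nv nAv by (simp add: power2_eq_iff_nonneg)
  qed simp
qed

section \<open>The universal UHF algebra\<close>

subsection \<open>The inductive system\<close>

lemma minus_mat_carrier: "B \<in> carrier_mat n m \<Longrightarrow> A - B \<in> carrier_mat n m"
  by auto

lemma smult_smult_mat: "c \<cdot>\<^sub>m (d \<cdot>\<^sub>m A) = (c * d) \<cdot>\<^sub>m A" for A :: "complex mat"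
  by (rule eq_matI) auto

lemma mat_norm_minus_commute:
  assumes "A \<in> carrier_mat n m" "B \<in> carrier_mat n m"
  shows "mat_norm (A - B) = mat_norm (B - A)"
proof -
  have "A - B = (-1) \<cdot>\<^sub>m (B - A)" using assms by (intro eq_matI) auto
  hence "mat_norm (A - B) = cmod (-1) * mat_norm (B - A)" by (metis mat_norm_smult)
  thus ?thesis by simp
qed

lemma mat_norm_minus_triangle:
  assumes "A \<in> carrier_mat n m" "B \<in> carrier_mat n m" "C \<in> carrier_mat n m"
  shows "mat_norm (A - C) \<le> mat_norm (A - B) + mat_norm (B - C)"
proof -
  have "A - C = (A - B) + (B - C)" using assms by (intro eq_matI) auto
  thus ?thesis using mat_norm_triangle[of "A - B" n m "B - C"] assms by (metis minus_mat_carrier)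
qed

lemma mat_norm_minus_zero:
  assumes "A \<in> carrier_mat n m"
  shows "mat_norm (A - 0\<^sub>m n m) = mat_norm A"
proof -
  have "A - 0\<^sub>m n m = A" using assms by (intro eq_matI) auto
  thus ?thesis by simp
qed

lemma mat_minus_self: "A \<in> carrier_mat n m \<Longrightarrow> A - A = (0\<^sub>m n m :: complex mat)"
  by (intro eq_matI) auto

lemma mat_norm_diff_le:
  assumes "A \<in> carrier_mat n m" "B \<in> carrier_mat n m"
  shows "\<bar>mat_norm A - mat_norm B\<bar> \<le> mat_norm (A - B)"
  using mat_norm_minus_triangle[OF assms zero_carrier_mat] mat_norm_minus_triangle[OF assms(2,1) zero_carrier_mat]
    mat_norm_minus_zero[OF assms(1)] mat_norm_minus_zero[OF assms(2)] mat_norm_minus_commute[OF assms]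
  by linarith

lemma mat_norm_add_diff:
  assumes "A \<in> carrier_mat n m" "A' \<in> carrier_mat n m" "B \<in> carrier_mat n m" "B' \<in> carrier_mat n m"
  shows "mat_norm ((A + B) - (A' + B')) \<le> mat_norm (A - A') + mat_norm (B - B')"
proof -
  have "(A + B) - (A' + B') = (A - A') + (B - B')" using assms by (intro eq_matI) auto
  thus ?thesis using mat_norm_triangle[of "A - A'" n m "B - B'"] assms by (metis minus_mat_carrier)
qed

lemma mat_norm_mult_diff:
  assumes "A \<in> carrier_mat n n" "A' \<in> carrier_mat n n" "B \<in> carrier_mat n n" "B' \<in> carrier_mat n n"
  shows "mat_norm (A * B - A' * B') \<le> mat_norm (A - A') * mat_norm B + mat_norm A' * mat_norm (B - B')"
proof -
  have "mat_norm (A * B - A' * B') \<le> mat_norm (A * B - A' * B) + mat_norm (A' * B - A' * B')"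
    by (rule mat_norm_minus_triangle[of _ n n]) (use assms in \<open>auto intro: mult_carrier_mat\<close>)
  also have "A * B - A' * B = (A - A') * B" by (rule minus_mult_distrib_mat[symmetric]) fact+
  also have "A' * B - A' * B' = A' * (B - B')" by (rule mult_minus_distrib_mat[symmetric]) fact+
  finally show ?thesis
    using mat_norm_mult[OF minus_mat_carrier[OF assms(2)] assms(3), of A] mat_norm_mult[OF assms(2) minus_mat_carrier[OF assms(4)], of B]
    by linarith
qed

abbreviation M_fact :: "nat \<Rightarrow> complex mat set" where
  "M_fact N \<equiv> carrier_mat (fact N) (fact N)"

text \<open>
  $M_1 \otimes \cdots \otimes M_N$ is identified with $M_{N!}$ by iterating \<^const>\<open>kron\<close>; the
  connecting map to stage $M \ge N$ is $A \mapsto A \otimes 1_{N+1} \otimes \cdots \otimes 1_M$.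
\<close>

definition amp :: "nat \<Rightarrow> nat \<Rightarrow> complex mat \<Rightarrow> complex mat" where
  "amp N M A = kron A (1\<^sub>m (fact M div fact N))"

lemma fact_mult_div: "N \<le> M \<Longrightarrow> fact N * (fact M div fact N) = (fact M :: nat)"
  by (simp add: fact_dvd)

lemma fact_div_pos: "N \<le> M \<Longrightarrow> 0 < (fact M div fact N :: nat)"
  by (simp add: div_greater_zero_iff fact_mono)

context
  fixes N M :: nat
  assumes NM: "N \<le> M"
begin

lemma amp_carrier [intro]: "A \<in> M_fact N \<Longrightarrow> amp N M A \<in> M_fact M"
  unfolding amp_def using kron_carrier[OF _ one_carrier_mat, of A "fact N" "fact N" "fact M div fact N"]
  by (simp add: fact_mult_div[OF NM])

lemma amp_mult: "A \<in> M_fact N \<Longrightarrow> B \<in> M_fact N \<Longrightarrow> amp N M (A * B) = amp N M A * amp N M B"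
  unfolding amp_def by (subst kron_mult) auto

lemma amp_add: "A \<in> M_fact N \<Longrightarrow> B \<in> M_fact N \<Longrightarrow> amp N M (A + B) = amp N M A + amp N M B"
  unfolding amp_def by (rule kron_add_left)

lemma amp_minus: "A \<in> M_fact N \<Longrightarrow> B \<in> M_fact N \<Longrightarrow> amp N M (A - B) = amp N M A - amp N M B"
  unfolding amp_def by (rule kron_minus_left)

lemma amp_smult: "amp N M (c \<cdot>\<^sub>m A) = c \<cdot>\<^sub>m amp N M A"
  unfolding amp_def by (rule kron_smult_left)

lemma amp_adjoint: "amp N M (mat_adjoint A) = mat_adjoint (amp N M A)"
  unfolding amp_def kron_adjoint mat_adjoint_one ..

lemma amp_one: "amp N M (1\<^sub>m (fact N)) = 1\<^sub>m (fact M)"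
  unfolding amp_def kron_one_one fact_mult_div[OF NM] ..

lemma amp_zero: "amp N M (0\<^sub>m (fact N) (fact N)) = 0\<^sub>m (fact M) (fact M)"
  unfolding amp_def kron_zero_left by (simp add: fact_mult_div[OF NM])

lemma mat_norm_amp: "A \<in> M_fact N \<Longrightarrow> mat_norm (amp N M A) = mat_norm A"
  unfolding amp_def by (rule mat_norm_kron_one) (use fact_div_pos[OF NM] in auto)

end

lemma amp_amp: "N \<le> M \<Longrightarrow> M \<le> K \<Longrightarrow> amp M K (amp N M A) = amp N K A"
proof -
  assume *: "N \<le> M" "M \<le> K"
  have "fact N * ((fact M div fact N) * (fact K div fact M)) = (fact K :: nat)"
    using * by (simp add: mult.assoc[symmetric] fact_mult_div)
  hence "(fact M div fact N) * (fact K div fact M) = (fact K div fact N :: nat)"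
    by (metis fact_nonzero nonzero_mult_div_cancel_left)
  thus ?thesis unfolding amp_def kron_assoc kron_one_one by simp
qed

lemma amp_Suc: "amp N (Suc N) A = kron A (1\<^sub>m (Suc N))"
  unfolding amp_def by simp

lemma amp_self: "amp N N A = A"
  unfolding amp_def using kron_one_1[of A] by simp

text \<open>
  The C*-inductive limit of the $M_{N!}$ is constructed in the usual way, as the closure of the
  union of the images of the $M_{N!}$ in $\prod_N M_{N!} / \bigoplus_N M_{N!}$. A sequence represents an
  element of that closure iff it is coherent in the following sense, and two sequences represent the same
  element iff their difference tends to 0 in norm.
\<close>

definition coherent :: "(nat \<Rightarrow> complex mat) \<Rightarrow> bool" where
  "coherent a \<longleftrightarrow> (\<forall>N. a N \<in> M_fact N) \<and>
     (\<forall>\<epsilon>>0. \<exists>N\<^sub>0. \<forall>N\<ge>N\<^sub>0. \<forall>M\<ge>N. mat_norm (a M - amp N M (a N)) < \<epsilon>)"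

definition uhf_rel :: "(nat \<Rightarrow> complex mat) \<Rightarrow> (nat \<Rightarrow> complex mat) \<Rightarrow> bool" where
  "uhf_rel a b \<longleftrightarrow> coherent a \<and> coherent b \<and> (\<lambda>N. mat_norm (a N - b N)) \<longlonglongrightarrow> 0"

lemma coherent_carrier: "coherent a \<Longrightarrow> a N \<in> M_fact N"
  by (simp add: coherent_def)

lemma coherentD:
  assumes "coherent a" "\<epsilon> > 0"
  obtains N0 where "\<And>N M. N0 \<le> N \<Longrightarrow> N \<le> M \<Longrightarrow> mat_norm (a M - amp N M (a N)) < \<epsilon>"
  using assms unfolding coherent_def by blast

lemma coherentI:
  assumes "\<And>N. a N \<in> M_fact N"
    and "\<And>\<epsilon>. \<epsilon> > 0 \<Longrightarrow> \<exists>N0. \<forall>N\<ge>N0. \<forall>M\<ge>N. mat_norm (a M - amp N M (a N)) < \<epsilon>"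
  shows "coherent a"
  using assms unfolding coherent_def by blast

lemma coherent_convergent:
  assumes "coherent a"
  shows "convergent (\<lambda>N. mat_norm (a N))"
proof -
  have "Cauchy (\<lambda>N. mat_norm (a N))"
  proof (rule CauchyI')
    fix \<epsilon> :: real assume "\<epsilon> > 0"
    then obtain N0 where N0: "\<And>N M. N0 \<le> N \<Longrightarrow> N \<le> M \<Longrightarrow> mat_norm (a M - amp N M (a N)) < \<epsilon>"
      using coherentD[OF assms] by blast
    have "dist (mat_norm (a N)) (mat_norm (a M)) < \<epsilon>" if "N0 \<le> N" "N < M" for N M
    proof -
      have c: "a N \<in> M_fact N" "a M \<in> M_fact M" using assms by (auto dest: coherent_carrier)
      have "\<bar>mat_norm (a M) - mat_norm (amp N M (a N))\<bar> \<le> mat_norm (a M - amp N M (a N))"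
        using c that by (intro mat_norm_diff_le[of _ "fact M" "fact M"] amp_carrier) auto
      also have "\<dots> < \<epsilon>" using N0[OF that(1)] that(2) by simp
      finally show ?thesis using c(1) that by (simp add: mat_norm_amp abs_minus_commute dist_real_def)
    qed
    thus "\<exists>M. \<forall>m\<ge>M. \<forall>n>m. dist (mat_norm (a m)) (mat_norm (a n)) < \<epsilon>" by blast
  qed
  thus ?thesis by (rule Cauchy_convergent)
qed

lemma coherent_bounded:
  assumes "coherent a"
  obtains B where "B > 0" "\<And>N. mat_norm (a N) \<le> B"
proof -
  have "Bseq (\<lambda>N. mat_norm (a N))" using coherent_convergent[OF assms] by (rule convergent_imp_Bseq)
  then obtain B where "B > 0" "\<And>N. norm (mat_norm (a N)) \<le> B" by (auto simp: Bseq_def)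
  thus ?thesis using that by auto
qed

lemma coherent_add:
  assumes a: "coherent a" and b: "coherent b"
  shows "coherent (\<lambda>N. a N + b N)"
proof (rule coherentI)
  show "a N + b N \<in> M_fact N" for N by (intro add_carrier_mat coherent_carrier b)
  fix \<epsilon> :: real assume "\<epsilon> > 0"
  hence e: "\<epsilon> / 2 > 0" by simp
  obtain N1 where N1: "\<And>N M. N1 \<le> N \<Longrightarrow> N \<le> M \<Longrightarrow> mat_norm (a M - amp N M (a N)) < \<epsilon> / 2" using coherentD[OF a e] by blast
  obtain N2 where N2: "\<And>N M. N2 \<le> N \<Longrightarrow> N \<le> M \<Longrightarrow> mat_norm (b M - amp N M (b N)) < \<epsilon> / 2" using coherentD[OF b e] by blast
  have "mat_norm (a M + b M - amp N M (a N + b N)) < \<epsilon>" if "max N1 N2 \<le> N" "N \<le> M" for N M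
  proof -
    note c = coherent_carrier[OF a] coherent_carrier[OF b]
    have "mat_norm (a M + b M - amp N M (a N + b N)) \<le> mat_norm (a M - amp N M (a N)) + mat_norm (b M - amp N M (b N))"
      unfolding amp_add[OF that(2) c]
      by (rule mat_norm_add_diff) (rule c amp_carrier[OF that(2)])+
    thus ?thesis using N1[of N M] N2[of N M] that by simp
  qed
  thus "\<exists>N0. \<forall>N\<ge>N0. \<forall>M\<ge>N. mat_norm (a M + b M - amp N M (a N + b N)) < \<epsilon>" by blast
qed

lemma coherent_mult:
  assumes a: "coherent a" and b: "coherent b"
  shows "coherent (\<lambda>N. a N * b N)"
proof (rule coherentI)
  note c = coherent_carrier[OF a] coherent_carrier[OF b]
  show "a N * b N \<in> M_fact N" for N using c by (rule mult_carrier_mat)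
  fix \<epsilon> :: real assume e: "\<epsilon> > 0"
  obtain A where A: "A > 0" "\<And>N. mat_norm (a N) \<le> A" using coherent_bounded[OF a] by blast
  obtain B where B: "B > 0" "\<And>N. mat_norm (b N) \<le> B" using coherent_bounded[OF b] by blast
  have e1: "\<epsilon> / (2 * B) > 0" "\<epsilon> / (2 * A) > 0" using e A B by auto
  obtain N1 where N1: "\<And>N M. N1 \<le> N \<Longrightarrow> N \<le> M \<Longrightarrow> mat_norm (a M - amp N M (a N)) < \<epsilon> / (2 * B)" using coherentD[OF a e1(1)] by blast
  obtain N2 where N2: "\<And>N M. N2 \<le> N \<Longrightarrow> N \<le> M \<Longrightarrow> mat_norm (b M - amp N M (b N)) < \<epsilon> / (2 * A)" using coherentD[OF b e1(2)] by blast
  have "mat_norm (a M * b M - amp N M (a N * b N)) < \<epsilon>" if "max N1 N2 \<le> N" "N \<le> M" for N M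
  proof -
    have "mat_norm (a M * b M - amp N M (a N * b N)) \<le>
        mat_norm (a M - amp N M (a N)) * mat_norm (b M) + mat_norm (amp N M (a N)) * mat_norm (b M - amp N M (b N))"
      unfolding amp_mult[OF that(2) c]
      by (rule mat_norm_mult_diff) (rule c amp_carrier[OF that(2)])+
    also have "mat_norm (amp N M (a N)) = mat_norm (a N)" by (rule mat_norm_amp[OF that(2) c(1)])
    also have "mat_norm (a M - amp N M (a N)) * mat_norm (b M) \<le> mat_norm (a M - amp N M (a N)) * B"
      by (intro mult_left_mono B) auto
    also have "\<dots> < \<epsilon> / (2 * B) * B" using N1[of N M] that B by (intro mult_strict_right_mono) auto
    also have "mat_norm (a N) * mat_norm (b M - amp N M (b N)) \<le> A * (\<epsilon> / (2 * A))"
      using N2[of N M] that A by (intro mult_mono) auto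
    also have "\<epsilon> / (2 * B) * B + A * (\<epsilon> / (2 * A)) = \<epsilon>" using A B by (simp add: field_simps)
    finally show ?thesis by simp
  qed
  thus "\<exists>N0. \<forall>N\<ge>N0. \<forall>M\<ge>N. mat_norm (a M * b M - amp N M (a N * b N)) < \<epsilon>" by blast
qed

lemma coherent_smult:
  assumes a: "coherent a"
  shows "coherent (\<lambda>N. c \<cdot>\<^sub>m a N)"
proof (rule coherentI)
  note ca = coherent_carrier[OF a]
  show "c \<cdot>\<^sub>m a N \<in> M_fact N" for N using ca by (rule smult_carrier_mat)
  fix \<epsilon> :: real assume "\<epsilon> > 0"
  moreover have pos: "cmod c + 1 > 0" by (simp add: add_nonneg_pos)
  ultimately have e: "\<epsilon> / (cmod c + 1) > 0" by simp
  obtain N1 where N1: "\<And>N M. N1 \<le> N \<Longrightarrow> N \<le> M \<Longrightarrow> mat_norm (a M - amp N M (a N)) < \<epsilon> / (cmod c + 1)"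
    using coherentD[OF a e] by blast
  have "mat_norm (c \<cdot>\<^sub>m a M - amp N M (c \<cdot>\<^sub>m a N)) < \<epsilon>" if "N1 \<le> N" "N \<le> M" for N M
  proof -
    have "c \<cdot>\<^sub>m a M - c \<cdot>\<^sub>m amp N M (a N) = c \<cdot>\<^sub>m (a M - amp N M (a N))"
      using ca[of M] amp_carrier[OF that(2) ca] by (intro eq_matI) (auto simp: right_diff_distrib)
    hence "mat_norm (c \<cdot>\<^sub>m a M - amp N M (c \<cdot>\<^sub>m a N)) = cmod c * mat_norm (a M - amp N M (a N))"
      unfolding amp_smult[OF that(2)] by (simp only: mat_norm_smult)
    also have "\<dots> \<le> (cmod c + 1) * mat_norm (a M - amp N M (a N))" by (intro mult_right_mono) auto
    also have "\<dots> < (cmod c + 1) * (\<epsilon> / (cmod c + 1))" using N1[OF that] pos by (rule mult_strict_left_mono)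
    finally show ?thesis using pos by simp
  qed
  thus "\<exists>N0. \<forall>N\<ge>N0. \<forall>M\<ge>N. mat_norm (c \<cdot>\<^sub>m a M - amp N M (c \<cdot>\<^sub>m a N)) < \<epsilon>" by blast
qed

lemma coherent_minus:
  assumes a: "coherent a" and b: "coherent b"
  shows "coherent (\<lambda>N. a N - b N)"
proof -
  have "a N - b N = a N + (-1) \<cdot>\<^sub>m b N" for N
    using coherent_carrier[OF a, of N] coherent_carrier[OF b, of N] by (intro eq_matI) auto
  thus ?thesis using coherent_add[OF a coherent_smult[OF b]] by simp
qed

lemma coherent_adjoint:
  assumes a: "coherent a"
  shows "coherent (\<lambda>N. mat_adjoint (a N))"
proof (rule coherentI)
  note ca = coherent_carrier[OF a]
  show "mat_adjoint (a N) \<in> M_fact N" for N using ca by (rule mat_adjoint_carrier)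
  fix \<epsilon> :: real assume "\<epsilon> > 0"
  then obtain N1 where N1: "\<And>N M. N1 \<le> N \<Longrightarrow> N \<le> M \<Longrightarrow> mat_norm (a M - amp N M (a N)) < \<epsilon>"
    using coherentD[OF a] by blast
  have "mat_norm (mat_adjoint (a M) - amp N M (mat_adjoint (a N))) < \<epsilon>" if "N1 \<le> N" "N \<le> M" for N M
    unfolding amp_adjoint[OF that(2)] mat_adjoint_minus[OF ca amp_carrier[OF that(2) ca], symmetric] mat_norm_adjoint
    by (rule N1[OF that])
  thus "\<exists>N0. \<forall>N\<ge>N0. \<forall>M\<ge>N. mat_norm (mat_adjoint (a M) - amp N M (mat_adjoint (a N))) < \<epsilon>" by blast
qed

lemma coherent_one: "coherent (\<lambda>N. 1\<^sub>m (fact N))"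
  by (rule coherentI) (auto simp: amp_one mat_minus_self[OF one_carrier_mat])

lemma coherent_zero: "coherent (\<lambda>N. 0\<^sub>m (fact N) (fact N))"
  by (rule coherentI) (auto simp: amp_zero mat_minus_self[OF zero_carrier_mat])

lemma uhf_rel_refl: "uhf_rel a a \<longleftrightarrow> coherent a"
  by (auto simp: uhf_rel_def mat_minus_self[OF coherent_carrier])

lemma uhf_rel_sym: "uhf_rel a b \<Longrightarrow> uhf_rel b a"
  by (auto simp: uhf_rel_def mat_norm_minus_commute[OF coherent_carrier coherent_carrier, of b a])

lemma uhf_rel_trans:
  assumes "uhf_rel a b" "uhf_rel b c"
  shows "uhf_rel a c"
proof -
  have co: "coherent a" "coherent b" "coherent c" using assms by (auto simp: uhf_rel_def)
  have lim: "(\<lambda>N. mat_norm (a N - b N) + mat_norm (b N - c N)) \<longlonglongrightarrow> 0"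
    using assms tendsto_add[of _ "0::real" _ _ "0::real"] by (auto simp: uhf_rel_def)
  have "(\<lambda>N. mat_norm (a N - c N)) \<longlonglongrightarrow> 0"
    by (rule tendsto_sandwich[OF _ _ tendsto_const lim])
      (auto intro!: always_eventually mat_norm_minus_triangle[OF coherent_carrier coherent_carrier coherent_carrier] co)
  thus ?thesis using co by (simp add: uhf_rel_def)
qed

quotient_type univ_uhf = "nat \<Rightarrow> complex mat" / partial: uhf_rel
proof (rule part_equivpI)
  show "\<exists>x. uhf_rel x x" using coherent_one uhf_rel_refl by blast
  show "symp uhf_rel" using uhf_rel_sym by (auto intro: sympI)
  show "transp uhf_rel" using uhf_rel_trans by (auto intro: transpI)
qed

lemma uhf_relI:
  assumes "coherent a" "coherent b" "\<And>N. mat_norm (a N - b N) \<le> f N" "f \<longlonglongrightarrow> 0"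
  shows "uhf_rel a b"
  using assms unfolding uhf_rel_def
  by (auto intro!: tendsto_sandwich[OF _ _ tendsto_const assms(4)] always_eventually)

lemma uhf_relD: "uhf_rel a b \<Longrightarrow> (\<lambda>N. mat_norm (a N - b N)) \<longlonglongrightarrow> 0"
  "uhf_rel a b \<Longrightarrow> coherent a" "uhf_rel a b \<Longrightarrow> coherent b"
  by (auto simp: uhf_rel_def)

subsection \<open>C*-algebras\<close>

class scaleC = fixes scaleC :: "complex \<Rightarrow> 'a \<Rightarrow> 'a" (infixr "*\<^sub>C" 75)

class star = fixes star :: "'a \<Rightarrow> 'a"

class cstar_algebra = real_normed_algebra_1 + banach + scaleC + star +
  assumes scaleC_add_right: "c *\<^sub>C (x + y) = c *\<^sub>C x + c *\<^sub>C y"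
    and scaleC_add_left: "(c + d) *\<^sub>C x = c *\<^sub>C x + d *\<^sub>C x"
    and scaleC_scaleC: "c *\<^sub>C (d *\<^sub>C x) = (c * d) *\<^sub>C x"
    and scaleR_scaleC: "r *\<^sub>R x = complex_of_real r *\<^sub>C x"
    and mult_scaleC_left: "(c *\<^sub>C x) * y = c *\<^sub>C (x * y)"
    and mult_scaleC_right: "x * (c *\<^sub>C y) = c *\<^sub>C (x * y)"
    and norm_scaleC: "norm (c *\<^sub>C x) = cmod c * norm x"
    and star_add: "star (x + y) = star x + star y"
    and star_scaleC: "star (c *\<^sub>C x) = cnj c *\<^sub>C star x"
    and star_mult: "star (x * y) = star y * star x"
    and star_star: "star (star x) = x"
    and norm_star_mult: "norm (star x * x) = (norm x)\<^sup>2"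

subsection \<open>The C*-algebra structure on the limit\<close>

instantiation univ_uhf :: "{scaleC, star}"
begin

lift_definition scaleC_univ_uhf :: "complex \<Rightarrow> univ_uhf \<Rightarrow> univ_uhf" is "\<lambda>c a N. c \<cdot>\<^sub>m a N"
proof -
  fix c and a a' :: "nat \<Rightarrow> complex mat" assume "uhf_rel a a'"
  note r = uhf_relD[OF this]
  show "uhf_rel (\<lambda>N. c \<cdot>\<^sub>m a N) (\<lambda>N. c \<cdot>\<^sub>m a' N)"
  proof (rule uhf_relI)
    fix N
    have "c \<cdot>\<^sub>m a N - c \<cdot>\<^sub>m a' N = c \<cdot>\<^sub>m (a N - a' N)"
      using r(2,3)[THEN coherent_carrier, of N] by (intro eq_matI) (auto simp: right_diff_distrib)
    thus "mat_norm (c \<cdot>\<^sub>m a N - c \<cdot>\<^sub>m a' N) \<le> cmod c * mat_norm (a N - a' N)"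
      by (simp only: mat_norm_smult order.refl)
  next
    show "(\<lambda>N. cmod c * mat_norm (a N - a' N)) \<longlonglongrightarrow> 0"
      using tendsto_mult_left[OF r(1), of "cmod c"] by simp
  qed (rule coherent_smult; rule r)+
qed

lift_definition star_univ_uhf :: "univ_uhf \<Rightarrow> univ_uhf" is "\<lambda>a N. mat_adjoint (a N)"
proof -
  fix a a' :: "nat \<Rightarrow> complex mat" assume "uhf_rel a a'"
  note r = uhf_relD[OF this]
  show "uhf_rel (\<lambda>N. mat_adjoint (a N)) (\<lambda>N. mat_adjoint (a' N))"
  proof (rule uhf_relI)
    fix N
    show "mat_norm (mat_adjoint (a N) - mat_adjoint (a' N)) \<le> mat_norm (a N - a' N)"
      by (simp add: mat_adjoint_minus[OF r(2,3)[THEN coherent_carrier], symmetric])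
  qed (rule coherent_adjoint r; (rule r)?)+
qed

instance ..

end

instantiation univ_uhf :: real_normed_algebra_1
begin

lift_definition zero_univ_uhf :: univ_uhf is "\<lambda>N. 0\<^sub>m (fact N) (fact N)"
  using coherent_zero uhf_rel_refl by blast

lift_definition one_univ_uhf :: univ_uhf is "\<lambda>N. 1\<^sub>m (fact N)"
  using coherent_one uhf_rel_refl by blast

lift_definition plus_univ_uhf :: "univ_uhf \<Rightarrow> univ_uhf \<Rightarrow> univ_uhf" is "\<lambda>a b N. a N + b N"
proof -
  fix a a' b b' assume "uhf_rel a a'" "uhf_rel b b'"
  note r = uhf_relD[OF this(1)] uhf_relD[OF this(2)]
  show "uhf_rel (\<lambda>N. a N + b N) (\<lambda>N. a' N + b' N)"
  proof (rule uhf_relI)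
    show "mat_norm ((a N + b N) - (a' N + b' N)) \<le> mat_norm (a N - a' N) + mat_norm (b N - b' N)" for N
      by (rule mat_norm_add_diff) (rule coherent_carrier, rule r)+
    show "(\<lambda>N. mat_norm (a N - a' N) + mat_norm (b N - b' N)) \<longlonglongrightarrow> 0"
      using tendsto_add[OF r(1) r(4)] by simp
  qed (rule coherent_add; rule r)+
qed

lift_definition minus_univ_uhf :: "univ_uhf \<Rightarrow> univ_uhf \<Rightarrow> univ_uhf" is "\<lambda>a b N. a N - b N"
proof -
  fix a a' b b' assume "uhf_rel a a'" "uhf_rel b b'"
  note r = uhf_relD[OF this(1)] uhf_relD[OF this(2)]
  show "uhf_rel (\<lambda>N. a N - b N) (\<lambda>N. a' N - b' N)"
  proof (rule uhf_relI)
    fix N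
    note c = r(2,3,5,6)[THEN coherent_carrier, of N]
    have "(a N - b N) - (a' N - b' N) = (a N + b' N) - (a' N + b N)" using c by (intro eq_matI) auto
    also have "mat_norm \<dots> \<le> mat_norm (a N - a' N) + mat_norm (b' N - b N)"
      by (rule mat_norm_add_diff) (rule c)+
    also have "mat_norm (b' N - b N) = mat_norm (b N - b' N)" by (rule mat_norm_minus_commute) (rule c)+
    finally show "mat_norm ((a N - b N) - (a' N - b' N)) \<le> mat_norm (a N - a' N) + mat_norm (b N - b' N)" .
  next
    show "(\<lambda>N. mat_norm (a N - a' N) + mat_norm (b N - b' N)) \<longlonglongrightarrow> 0"
      using tendsto_add[OF r(1) r(4)] by simp
  qed (rule coherent_minus; rule r)+
qed

lift_definition times_univ_uhf :: "univ_uhf \<Rightarrow> univ_uhf \<Rightarrow> univ_uhf" is "\<lambda>a b N. a N * b N"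
proof -
  fix a a' b b' assume "uhf_rel a a'" "uhf_rel b b'"
  note r = uhf_relD[OF this(1)] uhf_relD[OF this(2)]
  obtain A where A: "A > 0" "\<And>N. mat_norm (a' N) \<le> A" using coherent_bounded[OF r(3)] by blast
  obtain B where B: "B > 0" "\<And>N. mat_norm (b N) \<le> B" using coherent_bounded[OF r(5)] by blast
  show "uhf_rel (\<lambda>N. a N * b N) (\<lambda>N. a' N * b' N)"
  proof (rule uhf_relI)
    fix N
    note c = r(2,3,5,6)[THEN coherent_carrier, of N]
    have "mat_norm (a N * b N - a' N * b' N) \<le> mat_norm (a N - a' N) * mat_norm (b N) + mat_norm (a' N) * mat_norm (b N - b' N)"
      by (rule mat_norm_mult_diff) (rule c)+
    also have "\<dots> \<le> mat_norm (a N - a' N) * B + A * mat_norm (b N - b' N)"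
      by (intro add_mono mult_left_mono mult_right_mono A B) auto
    finally show "mat_norm (a N * b N - a' N * b' N) \<le> mat_norm (a N - a' N) * B + A * mat_norm (b N - b' N)" .
  next
    show "(\<lambda>N. mat_norm (a N - a' N) * B + A * mat_norm (b N - b' N)) \<longlonglongrightarrow> 0"
      using tendsto_add[OF tendsto_mult_right[OF r(1), of B] tendsto_mult_left[OF r(4), of A]] by simp
  qed (rule coherent_mult; rule r)+
qed

lift_definition norm_univ_uhf :: "univ_uhf \<Rightarrow> real" is "\<lambda>a. lim (\<lambda>N. mat_norm (a N))"
proof -
  fix a b assume "uhf_rel a b"
  note r = uhf_relD[OF this]
  have "(\<lambda>N. mat_norm (a N) - mat_norm (b N)) \<longlonglongrightarrow> 0"
    by (rule tendsto_0_le[OF r(1), of _ 1])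
      (auto intro!: always_eventually mat_norm_diff_le coherent_carrier r)
  moreover have "(\<lambda>N. mat_norm (b N)) \<longlonglongrightarrow> lim (\<lambda>N. mat_norm (b N))"
    using coherent_convergent[OF r(3)] convergent_LIMSEQ_iff by blast
  ultimately have "(\<lambda>N. (mat_norm (a N) - mat_norm (b N)) + mat_norm (b N)) \<longlonglongrightarrow> 0 + lim (\<lambda>N. mat_norm (b N))"
    by (rule tendsto_add)
  thus "lim (\<lambda>N. mat_norm (a N)) = lim (\<lambda>N. mat_norm (b N))" by (simp add: limI)
qed

definition uminus_univ_uhf :: "univ_uhf \<Rightarrow> univ_uhf" where "- x = 0 - x" for x :: univ_uhf

definition scaleR_univ_uhf :: "real \<Rightarrow> univ_uhf \<Rightarrow> univ_uhf" where
  "r *\<^sub>R x = complex_of_real r *\<^sub>C x" for x :: univ_uhf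

definition sgn_univ_uhf :: "univ_uhf \<Rightarrow> univ_uhf" where
  "sgn x = inverse (norm x) *\<^sub>R x" for x :: univ_uhf

definition dist_univ_uhf :: "univ_uhf \<Rightarrow> univ_uhf \<Rightarrow> real" where
  "dist x y = norm (x - y)" for x y :: univ_uhf

definition uniformity_univ_uhf :: "(univ_uhf \<times> univ_uhf) filter" where
  "uniformity_univ_uhf = (INF e\<in>{0<..}. principal {(x, y). dist x y < e})"

definition open_univ_uhf :: "univ_uhf set \<Rightarrow> bool" where
  "open_univ_uhf U \<longleftrightarrow> (\<forall>x\<in>U. eventually (\<lambda>(x', y). x' = x \<longrightarrow> y \<in> U) uniformity)"

lemma univ_uhf_cases:
  obtains a where "x = abs_univ_uhf a" "coherent a"
  using Quotient_univ_uhf uhf_rel_refl by (metis Quotient_abs_rep Quotient_rep_reflp)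

lemma rep_univ_uhf:
  assumes "coherent a"
  shows "uhf_rel (rep_univ_uhf (abs_univ_uhf a)) a"
  using assms Quotient_univ_uhf uhf_rel_refl by (metis Quotient_rep_abs)

lemma abs_univ_uhf_eqI:
  assumes "uhf_rel a b"
  shows "abs_univ_uhf a = abs_univ_uhf b"
  using assms Quotient_univ_uhf by (metis Quotient_rel_abs)

lemmas abs_univ_uhf_simps =
  plus_univ_uhf.abs_eq[unfolded uhf_rel_refl] minus_univ_uhf.abs_eq[unfolded uhf_rel_refl]
  times_univ_uhf.abs_eq[unfolded uhf_rel_refl] scaleC_univ_uhf.abs_eq[unfolded uhf_rel_refl]
  star_univ_uhf.abs_eq[unfolded uhf_rel_refl] zero_univ_uhf.abs_eq one_univ_uhf.abs_eq
  norm_univ_uhf.abs_eq[unfolded uhf_rel_refl]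

lemmas coherent_intros = coherent_add coherent_minus coherent_mult coherent_smult coherent_adjoint
  coherent_zero coherent_one

lemma norm_abs_univ_uhf:
  assumes "coherent a"
  shows "(\<lambda>N. mat_norm (a N)) \<longlonglongrightarrow> norm (abs_univ_uhf a)"
  unfolding abs_univ_uhf_simps(8)[OF assms] using coherent_convergent[OF assms] convergent_LIMSEQ_iff by blast

lemma abs_univ_uhf_cong: "(\<And>N. a N = b N) \<Longrightarrow> abs_univ_uhf a = abs_univ_uhf b"
  by (metis ext)

instance
proof
  fix x y z :: univ_uhf and r s :: real
  obtain a where x: "x = abs_univ_uhf a" and a: "coherent a" by (rule univ_uhf_cases)
  obtain b where y: "y = abs_univ_uhf b" and b: "coherent b" by (rule univ_uhf_cases)
  obtain c where z: "z = abs_univ_uhf c" and c: "coherent c" by (rule univ_uhf_cases)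
  note A = coherent_carrier[OF a] and B = coherent_carrier[OF b] and C = coherent_carrier[OF c]
  note simps = x y z abs_univ_uhf_simps coherent_intros a b c scaleR_univ_uhf_def uminus_univ_uhf_def
  show "x + y + z = x + (y + z)"
    using assoc_add_mat[OF A B C] by (simp add: simps)
  show "x + y = y + x"
    using comm_add_mat[OF A B] by (simp add: simps)
  show "0 + x = x"
    using left_add_zero_mat[OF A] by (simp add: simps)
  show "- x + x = 0"
  proof -
    have "(0\<^sub>m (fact N) (fact N) - a N) + a N = 0\<^sub>m (fact N) (fact N)" for N
      using A[of N] by (intro eq_matI) auto
    thus ?thesis by (simp add: simps)
  qed
  show "x - y = x + - y"
  proof -
    have "a N - b N = a N + (0\<^sub>m (fact N) (fact N) - b N)" for N
      using A[of N] B[of N] by (intro eq_matI) auto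
    thus ?thesis by (simp add: simps)
  qed
  have smult: "r *\<^sub>R abs_univ_uhf a' = abs_univ_uhf (\<lambda>N. complex_of_real r \<cdot>\<^sub>m a' N)" if "coherent a'" for r a'
    unfolding scaleR_univ_uhf_def by (rule abs_univ_uhf_simps(4)[OF that])
  show "r *\<^sub>R (x + y) = r *\<^sub>R x + r *\<^sub>R y"
    using add_smult_distrib_left_mat[OF A B] by (simp add: x y smult a b abs_univ_uhf_simps coherent_intros)
  show "(r + s) *\<^sub>R x = r *\<^sub>R x + s *\<^sub>R x"
    using add_smult_distrib_right_mat[OF A] by (simp add: x smult a abs_univ_uhf_simps coherent_intros)
  show "r *\<^sub>R s *\<^sub>R x = (r * s) *\<^sub>R x"
    by (simp add: x smult a coherent_intros smult_smult_mat)
  show "1 *\<^sub>R x = x"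
  proof -
    have "1 \<cdot>\<^sub>m a N = a N" for N by (intro eq_matI) auto
    thus ?thesis by (simp add: x smult a)
  qed
  show "x * y * z = x * (y * z)"
    using assoc_mult_mat[OF A B C] by (simp add: simps)
  show "(x + y) * z = x * z + y * z"
    using add_mult_distrib_mat[OF A B C] by (simp add: simps)
  show "x * (y + z) = x * y + x * z"
    using mult_add_distrib_mat[OF A B C] by (simp add: simps)
  show "r *\<^sub>R x * y = r *\<^sub>R (x * y)"
    using mult_smult_assoc_mat[OF A B] by (simp add: simps)
  show "x * r *\<^sub>R y = r *\<^sub>R (x * y)"
    using mult_smult_distrib[OF A B] by (simp add: simps)
  show "1 * x = x"
    using left_mult_one_mat[OF A] by (simp add: simps)
  show "x * 1 = x"
    using right_mult_one_mat[OF A] by (simp add: simps)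
  show n1: "norm (1 :: univ_uhf) = 1"
    by (simp add: simps mat_norm_one)
  have n0: "norm (0 :: univ_uhf) = 0"
    by (simp add: simps)
  show "(0 :: univ_uhf) \<noteq> 1"
    using n0 n1 by auto
  have "x = 0" if "norm x = 0"
  proof -
    have "(\<lambda>N. mat_norm (a N)) \<longlonglongrightarrow> 0"
      using norm_abs_univ_uhf[OF a] that x by simp
    hence "uhf_rel a (\<lambda>N. 0\<^sub>m (fact N) (fact N))"
      unfolding uhf_rel_def mat_norm_minus_zero[OF A] using a coherent_zero by blast
    thus ?thesis unfolding x zero_univ_uhf.abs_eq by (rule abs_univ_uhf_eqI)
  qed
  thus "norm x = 0 \<longleftrightarrow> x = 0" using n0 by auto
  show "norm (x + y) \<le> norm x + norm y"
  proof (rule LIMSEQ_le)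
    show "(\<lambda>N. mat_norm (a N + b N)) \<longlonglongrightarrow> norm (x + y)"
      unfolding simps(1,2) abs_univ_uhf_simps(1)[OF a b] by (rule norm_abs_univ_uhf[OF coherent_add[OF a b]])
    show "(\<lambda>N. mat_norm (a N) + mat_norm (b N)) \<longlonglongrightarrow> norm x + norm y"
      unfolding x y by (intro tendsto_add norm_abs_univ_uhf a b)
    show "\<exists>N. \<forall>n\<ge>N. mat_norm (a n + b n) \<le> mat_norm (a n) + mat_norm (b n)"
      using mat_norm_triangle[OF A B] by blast
  qed
  show "norm (x * y) \<le> norm x * norm y"
  proof (rule LIMSEQ_le)
    show "(\<lambda>N. mat_norm (a N * b N)) \<longlonglongrightarrow> norm (x * y)"
      unfolding simps(1,2) abs_univ_uhf_simps(3)[OF a b] by (rule norm_abs_univ_uhf[OF coherent_mult[OF a b]])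
    show "(\<lambda>N. mat_norm (a N) * mat_norm (b N)) \<longlonglongrightarrow> norm x * norm y"
      unfolding x y by (intro tendsto_mult norm_abs_univ_uhf a b)
    show "\<exists>N. \<forall>n\<ge>N. mat_norm (a n * b n) \<le> mat_norm (a n) * mat_norm (b n)"
      using mat_norm_mult[OF A B] by blast
  qed
  show "norm (r *\<^sub>R x) = \<bar>r\<bar> * norm x"
  proof (rule LIMSEQ_unique)
    show "(\<lambda>N. mat_norm (complex_of_real r \<cdot>\<^sub>m a N)) \<longlonglongrightarrow> norm (r *\<^sub>R x)"
      unfolding x scaleR_univ_uhf_def abs_univ_uhf_simps(4)[OF a] by (rule norm_abs_univ_uhf[OF coherent_smult[OF a]])
    show "(\<lambda>N. mat_norm (complex_of_real r \<cdot>\<^sub>m a N)) \<longlonglongrightarrow> \<bar>r\<bar> * norm x"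
      unfolding x mat_norm_smult norm_of_real by (intro tendsto_mult_left norm_abs_univ_uhf a)
  qed
qed (simp_all only: sgn_univ_uhf_def dist_univ_uhf_def uniformity_univ_uhf_def open_univ_uhf_def)

end

lemma norm_diff_abs_univ_uhf:
  assumes "coherent a" "coherent b"
  shows "(\<lambda>N. mat_norm (a N - b N)) \<longlonglongrightarrow> norm (abs_univ_uhf a - abs_univ_uhf b)"
  unfolding abs_univ_uhf_simps(2)[OF assms] by (rule norm_abs_univ_uhf[OF coherent_minus[OF assms]])

lemma univ_uhf_norm_at_stage:
  assumes a: "coherent a" and b: "coherent b" and m: "n \<le> m"
    and na: "\<And>M. n \<le> m \<Longrightarrow> m \<le> M \<Longrightarrow> mat_norm (a M - amp m M (a m)) < \<delta>"
    and nb: "\<And>M. n \<le> m \<Longrightarrow> m \<le> M \<Longrightarrow> mat_norm (b M - amp m M (b m)) < \<epsilon>"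
  shows "mat_norm (a m - b m) \<le> norm (abs_univ_uhf a - abs_univ_uhf b) + (\<delta> + \<epsilon>)"
proof -
  have "(\<lambda>M. mat_norm (a M - b M) + (\<delta> + \<epsilon>)) \<longlonglongrightarrow> norm (abs_univ_uhf a - abs_univ_uhf b) + (\<delta> + \<epsilon>)"
    by (intro tendsto_add tendsto_const norm_diff_abs_univ_uhf a b)
  moreover have "mat_norm (a m - b m) \<le> mat_norm (a M - b M) + (\<delta> + \<epsilon>)" if "m \<le> M" for M
  proof -
    note c = coherent_carrier[OF a] coherent_carrier[OF b]
    note c' = c[of M] amp_carrier[OF that c(1)] amp_carrier[OF that c(2)]
    have "mat_norm (a m - b m) = mat_norm (amp m M (a m) - amp m M (b m))"
      using mat_norm_amp[OF that minus_mat_carrier[OF c(2)]] amp_minus[OF that c] by metis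
    also have "\<dots> \<le> mat_norm (amp m M (a m) - a M) + mat_norm (a M - amp m M (b m))"
      by (rule mat_norm_minus_triangle) (rule c')+
    also have "mat_norm (a M - amp m M (b m)) \<le> mat_norm (a M - b M) + mat_norm (b M - amp m M (b m))"
      by (rule mat_norm_minus_triangle) (rule c')+
    also have "mat_norm (amp m M (a m) - a M) = mat_norm (a M - amp m M (a m))"
      by (rule mat_norm_minus_commute) (rule c')+
    finally show ?thesis using na[OF m that] nb[OF m that] by linarith
  qed
  ultimately show ?thesis by (intro LIMSEQ_le_const) blast+
qed

instance univ_uhf :: banach
proof
  fix X :: "nat \<Rightarrow> univ_uhf" assume X: "Cauchy X"
  have "\<exists>a. X k = abs_univ_uhf a \<and> coherent a" for k using univ_uhf_cases[of "X k"] by metis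
  then obtain a where a: "\<And>k. X k = abs_univ_uhf (a k)" "\<And>k. coherent (a k)" by metis
  define d :: "nat \<Rightarrow> real" where "d = (\<lambda>k. 1 / real (Suc k))"
  have d: "d k > 0" for k by (simp add: d_def)
  have "\<exists>n. \<forall>N\<ge>n. \<forall>M\<ge>N. mat_norm (a k M - amp N M (a k N)) < d k" for k
    using coherentD[OF a(2) d] by meson
  then obtain n where n: "\<And>k N M. n k \<le> N \<Longrightarrow> N \<le> M \<Longrightarrow> mat_norm (a k M - amp N M (a k N)) < d k"
    by metis
  define S where "S = (\<lambda>M. {k. k \<le> M \<and> n k \<le> M})"
  define K where "K = (\<lambda>M. Max (S M))"
  define b where "b = (\<lambda>M. a (K M) M)"
  have fin: "finite (S M)" for M unfolding S_def by (rule finite_subset[of _ "{..M}"]) auto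
  have nK: "n (K M) \<le> M" if "n 0 \<le> M" for M
  proof -
    have "0 \<in> S M" using that by (simp add: S_def)
    hence "K M \<in> S M" unfolding K_def using fin by (intro Max_in) auto
    thus ?thesis by (simp add: S_def)
  qed
  have Kge: "k \<le> K M" if "k \<le> M" "n k \<le> M" for k M
    unfolding K_def using that fin by (intro Max_ge) (auto simp: S_def)
  have stage: "mat_norm (a k M - a l M) \<le> norm (X k - X l) + (d k + d l)" if "n k \<le> M" "n l \<le> M" for k l M
    unfolding a(1) using that
    by (intro univ_uhf_norm_at_stage[of _ _ M M] a(2) n) auto
  have small: "\<exists>k0. (\<forall>k\<ge>k0. d k < \<epsilon>) \<and> (\<forall>k\<ge>k0. \<forall>l\<ge>k0. norm (X k - X l) < \<epsilon>)" if e: "\<epsilon> > 0" for \<epsilon>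
  proof -
    obtain k1 where k1: "\<And>k l. k1 \<le> k \<Longrightarrow> k1 \<le> l \<Longrightarrow> norm (X k - X l) < \<epsilon>" using CauchyD[OF X e] by blast
    obtain k2 where k2: "d k2 < \<epsilon>" using reals_Archimedean[OF e] by (auto simp: d_def inverse_eq_divide)
    have "d k < \<epsilon>" if "k \<ge> k2" for k
    proof -
      have "d k \<le> d k2" unfolding d_def using that by (intro divide_left_mono) auto
      thus ?thesis using k2 by simp
    qed
    thus ?thesis using k1 by (intro exI[of _ "max k1 k2"]) auto
  qed
  have b: "coherent b"
  proof (rule coherentI)
    show "b N \<in> M_fact N" for N unfolding b_def by (rule coherent_carrier[OF a(2)])
    fix \<epsilon> :: real assume "\<epsilon> > 0"
    hence "\<epsilon> / 4 > 0" by simp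
    from small[OF this] obtain k0 where k0: "\<And>k. k0 \<le> k \<Longrightarrow> d k < \<epsilon> / 4"
      "\<And>k l. k0 \<le> k \<Longrightarrow> k0 \<le> l \<Longrightarrow> norm (X k - X l) < \<epsilon> / 4" by blast
    have "mat_norm (b M - amp N M (b N)) < \<epsilon>" if N: "Max {n 0, n k0, k0} \<le> N" and M: "N \<le> M" for N M
    proof -
      have KN: "k0 \<le> K N" "n (K N) \<le> N" "k0 \<le> K M" "n (K M) \<le> M" using N M by (auto intro: nK Kge)
      have "mat_norm (b M - amp N M (b N)) \<le> mat_norm (b M - a (K N) M) + mat_norm (a (K N) M - amp N M (b N))"
        unfolding b_def by (rule mat_norm_minus_triangle) (rule amp_carrier[OF M] coherent_carrier a(2))+
      also have "mat_norm (b M - a (K N) M) \<le> norm (X (K M) - X (K N)) + (d (K M) + d (K N))"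
        unfolding b_def by (rule stage) (use KN M in auto)
      also have "mat_norm (a (K N) M - amp N M (b N)) < d (K N)" unfolding b_def by (rule n[OF KN(2) M])
      finally show ?thesis using k0(1)[OF KN(1)] k0(1)[OF KN(3)] k0(2)[OF KN(3,1)] by linarith
    qed
    thus "\<exists>N0. \<forall>N\<ge>N0. \<forall>M\<ge>N. mat_norm (b M - amp N M (b N)) < \<epsilon>" by blast
  qed
  have "X \<longlonglongrightarrow> abs_univ_uhf b"
  proof (rule LIMSEQ_I)
    fix \<epsilon> :: real assume e: "\<epsilon> > 0"
    hence "\<epsilon> / 4 > 0" by simp
    from small[OF this] obtain k0 where k0: "\<And>k. k0 \<le> k \<Longrightarrow> d k < \<epsilon> / 4"
      "\<And>k l. k0 \<le> k \<Longrightarrow> k0 \<le> l \<Longrightarrow> norm (X k - X l) < \<epsilon> / 4" by blast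
    have "norm (X k - abs_univ_uhf b) < \<epsilon>" if k: "k0 \<le> k" for k
    proof -
      have "mat_norm (a k M - b M) \<le> \<epsilon> * (3 / 4)" if M: "Max {n 0, n k0, k0, n k} \<le> M" for M
      proof -
        have KM: "k0 \<le> K M" "n (K M) \<le> M" using M by (auto intro: nK Kge)
        have "mat_norm (a k M - b M) \<le> norm (X k - X (K M)) + (d k + d (K M))"
          unfolding b_def by (rule stage) (use KM M in auto)
        thus ?thesis using k0(1)[OF KM(1)] k0(1)[OF k] k0(2)[OF k KM(1)] by linarith
      qed
      hence "norm (X k - abs_univ_uhf b) \<le> \<epsilon> * (3 / 4)"
        unfolding a(1) by (intro LIMSEQ_le_const2[OF norm_diff_abs_univ_uhf[OF a(2) b]]) blast
      thus ?thesis using e by simp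
    qed
    thus "\<exists>no. \<forall>k\<ge>no. norm (X k - abs_univ_uhf b) < \<epsilon>" by blast
  qed
  thus "convergent X" by (rule convergentI)
qed

instance univ_uhf :: cstar_algebra
proof
  fix x y :: univ_uhf and c d :: complex and r :: real
  obtain a where x: "x = abs_univ_uhf a" and a: "coherent a" by (rule univ_uhf_cases)
  obtain b where y: "y = abs_univ_uhf b" and b: "coherent b" by (rule univ_uhf_cases)
  note A = coherent_carrier[OF a] and B = coherent_carrier[OF b]
  note simps = x y abs_univ_uhf_simps coherent_intros a b
  show "c *\<^sub>C (x + y) = c *\<^sub>C x + c *\<^sub>C y"
    using add_smult_distrib_left_mat[OF A B] by (simp add: simps)
  show "(c + d) *\<^sub>C x = c *\<^sub>C x + d *\<^sub>C x"
    using add_smult_distrib_right_mat[OF A] by (simp add: simps)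
  show "c *\<^sub>C d *\<^sub>C x = (c * d) *\<^sub>C x"
    by (simp add: simps smult_smult_mat)
  show "r *\<^sub>R x = complex_of_real r *\<^sub>C x"
    by (rule scaleR_univ_uhf_def)
  show "(c *\<^sub>C x) * y = c *\<^sub>C (x * y)"
    using mult_smult_assoc_mat[OF A B] by (simp add: simps)
  show "x * (c *\<^sub>C y) = c *\<^sub>C (x * y)"
    using mult_smult_distrib[OF A B] by (simp add: simps)
  show "star (x + y) = star x + star y"
    using mat_adjoint_add[OF A B] by (simp add: simps)
  show "star (c *\<^sub>C x) = cnj c *\<^sub>C star x"
    using mat_adjoint_smult by (simp add: simps)
  show "star (x * y) = star y * star x"
    using mat_adjoint_mult[OF A B] by (simp add: simps)
  show "star (star x) = x"
    by (simp add: simps)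
  show "norm (c *\<^sub>C x) = cmod c * norm x"
  proof (rule LIMSEQ_unique)
    show "(\<lambda>N. mat_norm (c \<cdot>\<^sub>m a N)) \<longlonglongrightarrow> norm (c *\<^sub>C x)"
      unfolding x abs_univ_uhf_simps(4)[OF a] by (rule norm_abs_univ_uhf[OF coherent_smult[OF a]])
    show "(\<lambda>N. mat_norm (c \<cdot>\<^sub>m a N)) \<longlonglongrightarrow> cmod c * norm x"
      unfolding x mat_norm_smult by (intro tendsto_mult_left norm_abs_univ_uhf a)
  qed
  show "norm (star x * x) = (norm x)\<^sup>2"
  proof (rule LIMSEQ_unique)
    show "(\<lambda>N. mat_norm (mat_adjoint (a N) * a N)) \<longlonglongrightarrow> norm (star x * x)"
      unfolding x abs_univ_uhf_simps(5)[OF a] abs_univ_uhf_simps(3)[OF coherent_adjoint[OF a] a]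
      by (rule norm_abs_univ_uhf[OF coherent_mult[OF coherent_adjoint[OF a] a]])
    show "(\<lambda>N. mat_norm (mat_adjoint (a N) * a N)) \<longlonglongrightarrow> (norm x)\<^sup>2"
      unfolding x mat_norm_cstar by (intro tendsto_power norm_abs_univ_uhf a)
  qed
qed

text \<open>The canonical embedding of $M_1 \otimes \cdots \otimes M_N$.\<close>

definition uhf_embed :: "nat \<Rightarrow> complex mat \<Rightarrow> univ_uhf" where
  "uhf_embed N A = abs_univ_uhf (\<lambda>M. if N \<le> M then amp N M A else 0\<^sub>m (fact M) (fact M))"

lemma coherent_embed:
  assumes A: "A \<in> M_fact N"
  shows "coherent (\<lambda>M. if N \<le> M then amp N M A else 0\<^sub>m (fact M) (fact M))"
proof (rule coherentI)
  fix \<epsilon> :: real assume e: "\<epsilon> > 0"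
  have "amp N K A - amp M K (amp N M A) = 0\<^sub>m (fact K) (fact K)" if "N \<le> M" "M \<le> K" for M K
    unfolding amp_amp[OF that] using that by (intro mat_minus_self amp_carrier A) simp
  thus "\<exists>N0. \<forall>M\<ge>N0. \<forall>K\<ge>M. mat_norm ((if N \<le> K then amp N K A else 0\<^sub>m (fact K) (fact K)) -
      amp M K (if N \<le> M then amp N M A else 0\<^sub>m (fact M) (fact M))) < \<epsilon>"
    using e by (intro exI[of _ N]) simp
qed (use A amp_carrier in auto)

lemma uhf_embed_dense:
  assumes e: "\<epsilon> > 0"
  shows "\<exists>N. \<exists>A\<in>M_fact N. norm (x - uhf_embed N A) < \<epsilon>"
proof -
  obtain a where x: "x = abs_univ_uhf a" and a: "coherent a" by (rule univ_uhf_cases)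
  have "\<epsilon> / 2 > 0" using e by simp
  then obtain N where N: "\<And>M. N \<le> M \<Longrightarrow> mat_norm (a M - amp N M (a N)) < \<epsilon> / 2"
    using coherentD[OF a] by (metis order.refl)
  note c = coherent_carrier[OF a, of N]
  have "norm (x - uhf_embed N (a N)) \<le> \<epsilon> / 2"
    unfolding x uhf_embed_def
  proof (rule LIMSEQ_le_const2[OF norm_diff_abs_univ_uhf[OF a coherent_embed[OF c]]], intro exI allI impI)
    fix M assume "N \<le> M"
    thus "mat_norm (a M - (if N \<le> M then amp N M (a N) else 0\<^sub>m (fact M) (fact M))) \<le> \<epsilon> / 2"
      using N[of M] by simp
  qed
  thus ?thesis using e c by (intro exI[of _ N] bexI[of _ "a N"]) auto
qed

section \<open>Product type automorphisms\<close>

definition cstar_aut_group :: "('a :: cstar_algebra \<Rightarrow> 'a) monoid" where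
  "cstar_aut_group = \<lparr>carrier = {\<sigma>. bij \<sigma> \<and> (\<forall>x y. \<sigma> (x + y) = \<sigma> x + \<sigma> y) \<and> (\<forall>c x. \<sigma> (c *\<^sub>C x) = c *\<^sub>C \<sigma> x) \<and>
       (\<forall>x y. \<sigma> (x * y) = \<sigma> x * \<sigma> y) \<and> (\<forall>x. \<sigma> (star x) = star (\<sigma> x))},
     monoid.mult = (\<circ>), one = id\<rparr>"

definition unitary_group :: "nat \<Rightarrow> complex mat monoid" where
  "unitary_group n = \<lparr>carrier = {u \<in> carrier_mat n n. mat_adjoint u * u = 1\<^sub>m n \<and> u * mat_adjoint u = 1\<^sub>m n},
     monoid.mult = (*), one = 1\<^sub>m n\<rparr>"

fun tensor_upto :: "(nat \<Rightarrow> complex mat) \<Rightarrow> nat \<Rightarrow> complex mat" where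
  "tensor_upto u 0 = 1\<^sub>m 1"
| "tensor_upto u (Suc N) = kron (tensor_upto u N) (u (Suc N))"

text \<open>
  \<^term>\<open>tensor_Ad u\<close> is $\bigotimes_n \mathrm{Ad}\, u_n$: at stage $N$ it is conjugation by
  $u_1 \otimes \cdots \otimes u_N$. That this does not depend on the representative, and gives a
  homomorphism into the automorphism group, is shown in \<open>tensor_Ad_abs\<close> and \<open>tensor_Ad_hom\<close> below.
\<close>

definition tensor_Ad :: "(nat \<Rightarrow> complex mat) \<Rightarrow> univ_uhf \<Rightarrow> univ_uhf" where
  "tensor_Ad u x = abs_univ_uhf (\<lambda>N. tensor_upto u N * rep_univ_uhf x N * mat_adjoint (tensor_upto u N))"

definition U_prod :: "(nat \<Rightarrow> complex mat) monoid" where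
  "U_prod = product_group {1..} unitary_group"

lemma group_unitary_group: "group (unitary_group n)"
proof (rule groupI)
  fix u assume "u \<in> carrier (unitary_group n)"
  thus "\<exists>v\<in>carrier (unitary_group n). v \<otimes>\<^bsub>unitary_group n\<^esub> u = \<one>\<^bsub>unitary_group n\<^esub>"
    by (intro bexI[of _ "mat_adjoint u"]) (auto simp: unitary_group_def)
next
  fix u v assume uv: "u \<in> carrier (unitary_group n)" "v \<in> carrier (unitary_group n)"
  hence c: "u \<in> carrier_mat n n" "v \<in> carrier_mat n n" "mat_adjoint u \<in> carrier_mat n n" "mat_adjoint v \<in> carrier_mat n n"
    and e: "mat_adjoint u * u = 1\<^sub>m n" "u * mat_adjoint u = 1\<^sub>m n" "mat_adjoint v * v = 1\<^sub>m n" "v * mat_adjoint v = 1\<^sub>m n"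
    by (auto simp: unitary_group_def)
  have "mat_adjoint v * mat_adjoint u * (u * v) = mat_adjoint v * ((mat_adjoint u * u) * v)"
    using c by (simp add: assoc_mult_mat[of _ n n _ n _ n] mult_carrier_mat[of _ n n _ n])
  moreover have "u * v * (mat_adjoint v * mat_adjoint u) = u * ((v * mat_adjoint v) * mat_adjoint u)"
    using c by (simp add: assoc_mult_mat[of _ n n _ n _ n] mult_carrier_mat[of _ n n _ n])
  ultimately show "u \<otimes>\<^bsub>unitary_group n\<^esub> v \<in> carrier (unitary_group n)"
    using c e by (simp add: unitary_group_def mat_adjoint_mult[of _ n n _ n] mult_carrier_mat[of _ n n _ n])
qed (auto simp: unitary_group_def)

lemma group_U_prod: "group U_prod"
  unfolding U_prod_def by (intro product_group group_unitary_group)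

lemma tensor_upto_carrier:
  assumes "\<And>n. n \<ge> 1 \<Longrightarrow> u n \<in> carrier_mat n n"
  shows "tensor_upto u N \<in> M_fact N"
proof (induction N)
  case (Suc N)
  from kron_carrier[OF Suc assms[of "Suc N"]] show ?case by (simp add: mult.commute)
qed simp

lemma tensor_upto_unitary:
  assumes "u \<in> carrier U_prod"
  shows "tensor_upto u N \<in> carrier (unitary_group (fact N))"
proof -
  have u: "u n \<in> carrier_mat n n" "mat_adjoint (u n) * u n = 1\<^sub>m n" "u n * mat_adjoint (u n) = 1\<^sub>m n" if "n \<ge> 1" for n
    using assms that by (auto simp: U_prod_def unitary_group_def)
  have "mat_adjoint (tensor_upto u N) * tensor_upto u N = 1\<^sub>m (fact N) \<and>
        tensor_upto u N * mat_adjoint (tensor_upto u N) = 1\<^sub>m (fact N)"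
  proof (induction N)
    case (Suc N)
    note c = tensor_upto_carrier[OF u(1), of N] u(1)[of "Suc N"]
    note c' = c[THEN mat_adjoint_carrier]
    have f: "fact N * Suc N = (fact (Suc N) :: nat)" by (simp add: mult.commute)
    show ?case
      unfolding tensor_upto.simps kron_adjoint
      using kron_mult[OF c'(1) c'(2) c(1) c(2)] kron_mult[OF c(1) c(2) c'(1) c'(2)] Suc u(2,3)[of "Suc N"]
      by (simp only: kron_one_one f)
  qed simp
  thus ?thesis using tensor_upto_carrier[OF u(1)] by (auto simp: unitary_group_def)
qed

context
  fixes u assumes u: "u \<in> carrier U_prod"
begin

private abbreviation T where "T \<equiv> tensor_upto u"

private lemma T: "T N \<in> M_fact N" "mat_adjoint (T N) \<in> M_fact N"
  "mat_adjoint (T N) * T N = 1\<^sub>m (fact N)" "T N * mat_adjoint (T N) = 1\<^sub>m (fact N)"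
  using tensor_upto_unitary[OF u, of N] by (auto simp: unitary_group_def)

private lemma norm_T: "mat_norm (T N) = 1"
proof -
  have "(mat_norm (T N))\<^sup>2 = 1"
    using mat_norm_cstar[of "T N"] by (simp add: T mat_norm_one)
  thus ?thesis using mat_norm_nonneg[of "T N"] by (simp add: power2_eq_1_iff)
qed

private lemma conj_carrier: "A \<in> M_fact N \<Longrightarrow> T N * A * mat_adjoint (T N) \<in> M_fact N"
  using T(1,2) by (intro mult_carrier_mat)

private lemma conj_minus:
  assumes "A \<in> M_fact N" "B \<in> M_fact N"
  shows "T N * A * mat_adjoint (T N) - T N * B * mat_adjoint (T N) = T N * (A - B) * mat_adjoint (T N)"
  unfolding mult_minus_distrib_mat[OF T(1) assms]
    minus_mult_distrib_mat[OF mult_carrier_mat[OF T(1) assms(1)] mult_carrier_mat[OF T(1) assms(2)] T(2)] ..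

private lemma norm_conj_le:
  assumes "A \<in> M_fact N"
  shows "mat_norm (T N * A * mat_adjoint (T N)) \<le> mat_norm A"
proof -
  have "mat_norm (T N * A * mat_adjoint (T N)) \<le> mat_norm (T N * A) * mat_norm (mat_adjoint (T N))"
    by (rule mat_norm_mult[OF mult_carrier_mat[OF T(1) assms] T(2)])
  also have "\<dots> \<le> mat_norm (T N) * mat_norm A * mat_norm (mat_adjoint (T N))"
    by (intro mult_right_mono mat_norm_mult[OF T(1) assms]) simp
  finally show ?thesis by (simp add: norm_T)
qed

private lemma conj_amp:
  assumes A: "A \<in> M_fact N" and NM: "N \<le> M"
  shows "T M * amp N M A * mat_adjoint (T M) = amp N M (T N * A * mat_adjoint (T N))"
  using NM
proof (induction M rule: dec_induct)
  case base
  show ?case by (simp add: amp_self)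
next
  case (step M)
  define X where "X = amp N M A"
  have X: "X \<in> M_fact M" unfolding X_def by (rule amp_carrier[OF step(1) A])
  have v: "u (Suc M) \<in> carrier_mat (Suc M) (Suc M)" "u (Suc M) * mat_adjoint (u (Suc M)) = 1\<^sub>m (Suc M)"
    using u by (auto simp: U_prod_def unitary_group_def)
  note v' = mat_adjoint_carrier[OF v(1)]
  have S: "amp N (Suc M) B = kron (amp N M B) (1\<^sub>m (Suc M))" for B
    using amp_amp[OF step(1), of "Suc M" B] unfolding amp_Suc by simp
  have "T (Suc M) * amp N (Suc M) A * mat_adjoint (T (Suc M))
      = kron (T M) (u (Suc M)) * kron X (1\<^sub>m (Suc M)) * kron (mat_adjoint (T M)) (mat_adjoint (u (Suc M)))"
    unfolding S X_def by (simp only: tensor_upto.simps kron_adjoint)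
  also have "\<dots> = kron (T M * X) (u (Suc M)) * kron (mat_adjoint (T M)) (mat_adjoint (u (Suc M)))"
    unfolding kron_mult[OF T(1) v(1) X one_carrier_mat] right_mult_one_mat[OF v(1)] ..
  also have "\<dots> = kron (T M * X * mat_adjoint (T M)) (1\<^sub>m (Suc M))"
    unfolding kron_mult[OF mult_carrier_mat[OF T(1) X] v(1) T(2) v'] v(2) ..
  also have "\<dots> = amp N (Suc M) (T N * A * mat_adjoint (T N))"
    unfolding S step(3)[symmetric] X_def ..
  finally show ?case .
qed

lemma coherent_conj:
  assumes a: "coherent a"
  shows "coherent (\<lambda>N. tensor_upto u N * a N * mat_adjoint (tensor_upto u N))"
proof (rule coherentI)
  note ca = coherent_carrier[OF a]
  show "T N * a N * mat_adjoint (T N) \<in> M_fact N" for N by (rule conj_carrier[OF ca])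
  fix \<epsilon> :: real assume "\<epsilon> > 0"
  then obtain N1 where N1: "\<And>N M. N1 \<le> N \<Longrightarrow> N \<le> M \<Longrightarrow> mat_norm (a M - amp N M (a N)) < \<epsilon>"
    using coherentD[OF a] by blast
  have "mat_norm (T M * a M * mat_adjoint (T M) - amp N M (T N * a N * mat_adjoint (T N))) < \<epsilon>"
    if "N1 \<le> N" "N \<le> M" for N M
    unfolding conj_amp[OF ca that(2), symmetric] conj_minus[OF ca amp_carrier[OF that(2) ca]]
    using norm_conj_le[OF minus_mat_carrier[OF amp_carrier[OF that(2) ca]]] N1[OF that] by (rule le_less_trans)
  thus "\<exists>N0. \<forall>N\<ge>N0. \<forall>M\<ge>N. mat_norm (T M * a M * mat_adjoint (T M) - amp N M (T N * a N * mat_adjoint (T N))) < \<epsilon>"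
    by blast
qed

lemma tensor_Ad_abs:
  assumes a: "coherent a"
  shows "tensor_Ad u (abs_univ_uhf a) = abs_univ_uhf (\<lambda>N. tensor_upto u N * a N * mat_adjoint (tensor_upto u N))"
  unfolding tensor_Ad_def
proof (rule abs_univ_uhf_eqI, rule uhf_relI)
  let ?r = "rep_univ_uhf (abs_univ_uhf a)"
  note r = uhf_relD[OF rep_univ_uhf[OF a]]
  show "coherent (\<lambda>N. T N * ?r N * mat_adjoint (T N))" by (rule coherent_conj[OF r(2)])
  show "coherent (\<lambda>N. T N * a N * mat_adjoint (T N))" by (rule coherent_conj[OF a])
  show "mat_norm (T N * ?r N * mat_adjoint (T N) - T N * a N * mat_adjoint (T N)) \<le> mat_norm (?r N - a N)" for N
    unfolding conj_minus[OF r(2,3)[THEN coherent_carrier]]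
    by (rule norm_conj_le[OF minus_mat_carrier[OF coherent_carrier[OF a]]])
  show "(\<lambda>N. mat_norm (?r N - a N)) \<longlonglongrightarrow> 0" by (rule r(1))
qed

lemma tensor_Ad_alg_hom:
  "tensor_Ad u (x + y) = tensor_Ad u x + tensor_Ad u y"
  "tensor_Ad u (c *\<^sub>C x) = c *\<^sub>C tensor_Ad u x"
  "tensor_Ad u (x * y) = tensor_Ad u x * tensor_Ad u y"
  "tensor_Ad u (star x) = star (tensor_Ad u x)"
proof -
  obtain a where x: "x = abs_univ_uhf a" and a: "coherent a" by (rule univ_uhf_cases)
  obtain b where y: "y = abs_univ_uhf b" and b: "coherent b" by (rule univ_uhf_cases)
  note A = coherent_carrier[OF a] and B = coherent_carrier[OF b]
  note simps = x y abs_univ_uhf_simps coherent_intros coherent_conj tensor_Ad_abs a b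
  note TA = mult_carrier_mat[OF T(1) A] and TB = mult_carrier_mat[OF T(1) B]
  have "T N * (a N + b N) * mat_adjoint (T N) = T N * a N * mat_adjoint (T N) + T N * b N * mat_adjoint (T N)" for N
    unfolding mult_add_distrib_mat[OF T(1) A B] add_mult_distrib_mat[OF TA TB T(2)] ..
  thus "tensor_Ad u (x + y) = tensor_Ad u x + tensor_Ad u y" by (simp add: simps)
  have "T N * (c \<cdot>\<^sub>m a N) * mat_adjoint (T N) = c \<cdot>\<^sub>m (T N * a N * mat_adjoint (T N))" for N
    unfolding mult_smult_distrib[OF T(1) A] mult_smult_assoc_mat[OF TA T(2)] ..
  thus "tensor_Ad u (c *\<^sub>C x) = c *\<^sub>C tensor_Ad u x" by (simp add: simps)
  have "T N * (a N * b N) * mat_adjoint (T N) = (T N * a N * mat_adjoint (T N)) * (T N * b N * mat_adjoint (T N))" for N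
  proof -
    have "(T N * a N * mat_adjoint (T N)) * (T N * b N * mat_adjoint (T N)) = T N * a N * (mat_adjoint (T N) * (T N * b N * mat_adjoint (T N)))"
      by (rule assoc_mult_mat[OF TA T(2) mult_carrier_mat[OF TB T(2)]])
    also have "mat_adjoint (T N) * (T N * b N * mat_adjoint (T N)) = mat_adjoint (T N) * (T N * b N) * mat_adjoint (T N)"
      by (rule assoc_mult_mat[OF T(2) TB T(2), symmetric])
    also have "mat_adjoint (T N) * (T N * b N) = b N"
      unfolding assoc_mult_mat[OF T(2) T(1) B, symmetric] T(3) by (rule left_mult_one_mat[OF B])
    also have "T N * a N * (b N * mat_adjoint (T N)) = T N * a N * b N * mat_adjoint (T N)"
      by (rule assoc_mult_mat[OF TA B T(2), symmetric])
    also have "T N * a N * b N = T N * (a N * b N)" by (rule assoc_mult_mat[OF T(1) A B])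
    finally show ?thesis ..
  qed
  thus "tensor_Ad u (x * y) = tensor_Ad u x * tensor_Ad u y" by (simp add: simps)
  have "T N * mat_adjoint (a N) * mat_adjoint (T N) = mat_adjoint (T N * a N * mat_adjoint (T N))" for N
    unfolding mat_adjoint_mult[OF TA T(2)] mat_adjoint_mult[OF T(1) A] mat_adjoint_adjoint
    by (rule assoc_mult_mat[OF T(1) mat_adjoint_carrier[OF A] T(2)])
  thus "tensor_Ad u (star x) = star (tensor_Ad u x)" by (simp add: simps)
qed

end

lemma tensor_upto_mult:
  assumes u: "u \<in> carrier U_prod" and v: "v \<in> carrier U_prod"
  shows "tensor_upto (u \<otimes>\<^bsub>U_prod\<^esub> v) N = tensor_upto u N * tensor_upto v N"
proof (induction N)
  case (Suc N)
  have "u n \<in> carrier_mat n n" "v n \<in> carrier_mat n n" if "n \<ge> 1" for n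
    using u v that by (auto simp: U_prod_def unitary_group_def)
  note c = this
  have "(u \<otimes>\<^bsub>U_prod\<^esub> v) (Suc N) = u (Suc N) * v (Suc N)"
    by (simp add: U_prod_def unitary_group_def)
  thus ?case
    using kron_mult[OF tensor_upto_carrier[of u N] c(1)[of "Suc N"] tensor_upto_carrier[of v N] c(2)[of "Suc N"]] c Suc
    by simp
qed simp

lemma tensor_Ad_mult:
  assumes u: "u \<in> carrier U_prod" and v: "v \<in> carrier U_prod"
  shows "tensor_Ad (u \<otimes>\<^bsub>U_prod\<^esub> v) = tensor_Ad u \<circ> tensor_Ad v"
proof
  fix x
  obtain a where x: "x = abs_univ_uhf a" and a: "coherent a" by (rule univ_uhf_cases)
  have uv: "u \<otimes>\<^bsub>U_prod\<^esub> v \<in> carrier U_prod"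
    using u v group_U_prod by (simp add: group.is_monoid monoid.m_closed)
  have "tensor_upto u N * tensor_upto v N * a N * mat_adjoint (tensor_upto u N * tensor_upto v N)
      = tensor_upto u N * (tensor_upto v N * a N * mat_adjoint (tensor_upto v N)) * mat_adjoint (tensor_upto u N)" for N
  proof -
    define U V where "U = tensor_upto u N" and "V = tensor_upto v N"
    have c: "U \<in> M_fact N" "V \<in> M_fact N" "a N \<in> M_fact N" "mat_adjoint U \<in> M_fact N" "mat_adjoint V \<in> M_fact N"
      using tensor_upto_unitary[OF u, of N] tensor_upto_unitary[OF v, of N] coherent_carrier[OF a]
      by (auto simp: U_def V_def unitary_group_def)
    show ?thesis unfolding U_def[symmetric] V_def[symmetric] mat_adjoint_mult[OF c(1,2)]
      using c by (simp add: assoc_mult_mat[of _ "fact N" "fact N" _ "fact N" _ "fact N"] mult_carrier_mat[of _ "fact N" "fact N" _ "fact N"])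
  qed
  thus "tensor_Ad (u \<otimes>\<^bsub>U_prod\<^esub> v) x = (tensor_Ad u \<circ> tensor_Ad v) x"
    by (simp add: x tensor_Ad_abs a coherent_conj u v uv tensor_upto_mult)
qed

lemma tensor_Ad_one: "tensor_Ad \<one>\<^bsub>U_prod\<^esub> = id"
proof
  fix x
  obtain a where x: "x = abs_univ_uhf a" and a: "coherent a" by (rule univ_uhf_cases)
  have o: "\<one>\<^bsub>U_prod\<^esub> \<in> carrier U_prod" using group_U_prod by (simp add: group.is_monoid)
  have "tensor_upto \<one>\<^bsub>U_prod\<^esub> N = 1\<^sub>m (fact N)" for N
  proof (induction N)
    case (Suc N)
    have "\<one>\<^bsub>U_prod\<^esub> (Suc N) = 1\<^sub>m (Suc N)" by (simp add: U_prod_def unitary_group_def)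
    hence "tensor_upto \<one>\<^bsub>U_prod\<^esub> (Suc N) = kron (1\<^sub>m (fact N)) (1\<^sub>m (Suc N))" using Suc by simp
    thus ?case unfolding kron_one_one by (simp add: mult.commute)
  qed simp
  thus "tensor_Ad \<one>\<^bsub>U_prod\<^esub> x = id x"
    using left_mult_one_mat[OF coherent_carrier[OF a]] right_mult_one_mat[OF coherent_carrier[OF a]]
    by (simp add: x tensor_Ad_abs[OF o a])
qed

lemma tensor_Ad_hom: "tensor_Ad \<in> hom U_prod cstar_aut_group"
proof (rule homI)
  fix u assume u: "u \<in> carrier U_prod"
  interpret group U_prod by (rule group_U_prod)
  have "bij (tensor_Ad u)"
  proof (rule o_bij)
    show "tensor_Ad (inv\<^bsub>U_prod\<^esub> u) \<circ> tensor_Ad u = id"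
      using tensor_Ad_mult[of "inv\<^bsub>U_prod\<^esub> u" u] u by (simp add: tensor_Ad_one)
    show "tensor_Ad u \<circ> tensor_Ad (inv\<^bsub>U_prod\<^esub> u) = id"
      using tensor_Ad_mult[of u "inv\<^bsub>U_prod\<^esub> u"] u by (simp add: tensor_Ad_one)
  qed
  thus "tensor_Ad u \<in> carrier cstar_aut_group"
    by (simp add: cstar_aut_group_def tensor_Ad_alg_hom[OF u])
qed (simp add: tensor_Ad_mult cstar_aut_group_def)

section \<open>The Rokhlin property\<close>

definition is_projection :: "'a :: cstar_algebra \<Rightarrow> bool" where
  "is_projection p \<longleftrightarrow> star p = p \<and> p * p = p"

definition orthogonal_projections :: "nat \<Rightarrow> (nat \<Rightarrow> 'a :: cstar_algebra) \<Rightarrow> bool" where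
  "orthogonal_projections k p \<longleftrightarrow>
     (\<forall>i\<in>{1..k}. is_projection (p i)) \<and> (\<forall>i\<in>{1..k}. \<forall>j\<in>{1..k}. i \<noteq> j \<longrightarrow> p i * p j = 0)"

definition order_rokhlin :: "nat \<Rightarrow> ('a :: cstar_algebra \<Rightarrow> 'a) \<Rightarrow> bool" where
  "order_rokhlin k \<sigma> \<longleftrightarrow>
     (\<forall>\<epsilon>>0. \<forall>F. finite F \<longrightarrow>
       (\<exists>p. orthogonal_projections k p \<and>
         (\<forall>i\<in>{1..k}. \<forall>a\<in>F. norm (p i * a - a * p i) < \<epsilon>) \<and>
         (\<forall>i\<in>{1..k}. norm (\<sigma> (p i) - p (if i = k then 1 else i + 1)) < \<epsilon>) \<and>
         (\<Sum>i\<in>{1..k}. p i) = 1))"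

definition rokhlin :: "('a :: cstar_algebra \<Rightarrow> 'a) \<Rightarrow> bool" where
  "rokhlin \<sigma> \<longleftrightarrow>
     (\<forall>n. \<exists>N>n. \<forall>\<epsilon>>0. \<forall>F. finite F \<longrightarrow>
       (\<exists>p. orthogonal_projections N p \<and>
         (\<forall>i\<in>{1..N}. \<forall>a\<in>F. norm (p i * a - a * p i) < \<epsilon>) \<and>
         (\<forall>i\<in>{1..<N}. norm (\<sigma> (p i) - p (i + 1)) < \<epsilon>) \<and>
         (\<Sum>i\<in>{1..N}. p i) = 1))"

text \<open>\<^const>\<open>group.ord\<close> is 0 for elements of infinite order.\<close>

definition rokhlin_action :: "('g, 'm) monoid_scheme \<Rightarrow> ('g \<Rightarrow> 'a :: cstar_algebra \<Rightarrow> 'a) \<Rightarrow> bool" where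
  "rokhlin_action G \<alpha> \<longleftrightarrow>
     (\<forall>g\<in>carrier G. if group.ord G g = 0 then rokhlin (\<alpha> g) else order_rokhlin (group.ord G g) (\<alpha> g))"

definition almost_abelian :: "('g, 'm) monoid_scheme \<Rightarrow> bool" where
  "almost_abelian G \<longleftrightarrow>
     (\<exists>H. subgroup H G \<and> comm_group (G\<lparr>carrier := H\<rparr>) \<and> finite (rcosets\<^bsub>G\<^esub> H))"

end

theory Submission
  imports Defs
begin

text \<open>
  Since \<open>\<Q>\<close> has approximately central copies of $M_m$ for arbitrarily large \<open>m\<close>, it suffices to find, for
  each \<open>g\<close> and each \<open>N\<close> compatible with the order of \<open>g\<close>, one finite-dimensional unitary representation in
  which \<open>g\<close> cyclically permutes an exact partition of unity into \<open>N\<close> projections; multiples of these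
  representations are then distributed over the factors, each infinitely often.

  For \<open>G\<close> abelian one takes $\bigoplus_{a<N} \chi^a$, where \<open>\<chi>\<close> is a character with
  $\chi(g) = \omega = e^{2\pi i/N}$ (the circle is divisible, so characters extend): conjugation by \<open>g\<close> multiplies the
  cyclic shift of the summands by \<open>\<omega>\<close>, hence permutes its spectral projections. In general one
  induces $\bigotimes_y \bigoplus_{a<N} \chi_y^a$ from the abelian subgroup \<open>H\<close>, where \<open>y\<close> runs through the
  cosets of \<open>H\<close>, and over each orbit of \<open>g\<close> on the cosets uses the tensor factor of one point of that orbit.
\<close>

section \<open>Characters of abelian groups\<close>

text \<open>The graph of a homomorphism from a subgroup into the circle. For relations, extension is
  inclusion and a chain is bounded by its union. The last clause makes it single-valued: two values
  at one point differ by a value at the identity.\<close>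

definition partial_character :: "('g, 'm) monoid_scheme \<Rightarrow> ('g \<times> complex) set \<Rightarrow> bool" where
  "partial_character G R \<longleftrightarrow> (\<one>\<^bsub>G\<^esub>, 1) \<in> R \<and>
     (\<forall>(a, z)\<in>R. a \<in> carrier G \<and> cmod z = 1 \<and> (inv\<^bsub>G\<^esub> a, inverse z) \<in> R) \<and>
     (\<forall>(a, z)\<in>R. \<forall>(b, w)\<in>R. (a \<otimes>\<^bsub>G\<^esub> b, z * w) \<in> R) \<and>
     (\<forall>z. (\<one>\<^bsub>G\<^esub>, z) \<in> R \<longrightarrow> z = 1)"

definition character :: "('g, 'm) monoid_scheme \<Rightarrow> ('g \<Rightarrow> complex) \<Rightarrow> bool" where
  "character G \<chi> \<longleftrightarrow> (\<forall>a\<in>carrier G. cmod (\<chi> a) = 1) \<and>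
     (\<forall>a\<in>carrier G. \<forall>b\<in>carrier G. \<chi> (a \<otimes>\<^bsub>G\<^esub> b) = \<chi> a * \<chi> b)"

lemma partial_characterD:
  assumes "partial_character G R"
  shows "(\<one>\<^bsub>G\<^esub>, 1) \<in> R"
    and "(a, z) \<in> R \<Longrightarrow> a \<in> carrier G" "(a, z) \<in> R \<Longrightarrow> cmod z = 1"
    and "(a, z) \<in> R \<Longrightarrow> (inv\<^bsub>G\<^esub> a, inverse z) \<in> R"
    and "(a, z) \<in> R \<Longrightarrow> (b, w) \<in> R \<Longrightarrow> (a \<otimes>\<^bsub>G\<^esub> b, z * w) \<in> R"
    and "(\<one>\<^bsub>G\<^esub>, z) \<in> R \<Longrightarrow> z = 1"
  using assms unfolding partial_character_def by blast+

lemma (in group) partial_character_int_pow: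
  assumes R: "partial_character G R" and az: "(a, z) \<in> R"
  shows "(a [^] (i :: int), z powi i) \<in> R"
proof -
  note a = partial_characterD(2)[OF R az]
  have nat: "(a [^] n, z ^ n) \<in> R" for n :: nat
  proof (induction n)
    case (Suc n)
    show ?case using partial_characterD(5)[OF R Suc az] by (simp add: mult.commute)
  qed (simp add: partial_characterD(1)[OF R])
  show ?thesis
  proof (cases "0 \<le> i")
    case True
    thus ?thesis using nat[of "nat i"] int_pow_int[of G a "nat i"] by (simp add: power_int_def)
  next
    case False
    hence "i < 0" by simp
    have "a [^] i = inv (a [^] nat (- i))" using \<open>i < 0\<close> by (simp only: int_pow_def2 if_True)
    moreover have "z powi i = inverse (z ^ nat (- i))"
      using \<open>i < 0\<close> unfolding power_int_def power_inverse by simp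
    ultimately show ?thesis using partial_characterD(4)[OF R nat[of "nat (- i)"]] by simp
  qed
qed

lemma (in group) partial_character_unique:
  assumes R: "partial_character G R" and "(a, z) \<in> R" "(a, w) \<in> R"
  shows "z = w"
proof -
  have "a \<in> carrier G" using partial_characterD(2)[OF R assms(2)] .
  hence "(\<one>, z * inverse w) \<in> R"
    using partial_characterD(5)[OF R assms(2) partial_characterD(4)[OF R assms(3)]] by simp
  hence "z * inverse w = 1" by (rule partial_characterD(6)[OF R])
  thus ?thesis using partial_characterD(3)[OF R assms(3)] by (auto simp: field_simps split: if_splits)
qed

text \<open>The products \<open>r \<otimes> a [^] i\<close> form the subgroup generated by the
  domain and \<open>a\<close>, and commutativity makes the prescribed values multiplicative. They
  are consistent because \<open>compat\<close> settles the only overlaps, the powers of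
  \<open>a\<close> already in the domain.\<close>

lemma (in comm_group) partial_character_adjoin:
  assumes R: "partial_character G R" and a: "a \<in> carrier G" and \<xi>: "cmod \<xi> = 1"
    and compat: "\<And>(i :: int) z. (a [^] i, z) \<in> R \<Longrightarrow> \<xi> powi i = z"
  defines "R' \<equiv> {(r \<otimes> a [^] i, z * \<xi> powi i) | r z (i :: int). (r, z) \<in> R}"
  shows "partial_character G R'" "R \<subseteq> R'" "(a, \<xi>) \<in> R'"
proof -
  note D = partial_characterD[OF R]
  have \<xi>0: "\<xi> \<noteq> 0" using \<xi> by auto
  have mem: "(r \<otimes> a [^] i, z * \<xi> powi i) \<in> R'" if "(r, z) \<in> R" for r z and i :: int
    using that unfolding R'_def by blast
  show RR': "R \<subseteq> R'"
  proof clarify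
    fix r z assume rz: "(r, z) \<in> R"
    show "(r, z) \<in> R'" using mem[OF rz, of 0] D(2)[OF rz] by simp
  qed
  show "(a, \<xi>) \<in> R'" using mem[OF D(1), of 1] a by (simp add: int_pow_1)
  show "partial_character G R'"
    unfolding partial_character_def
  proof (intro conjI allI impI ballI; (clarify)?)
    show "(\<one>, 1) \<in> R'" using D(1) RR' by blast
  next
    fix b w assume "(b, w) \<in> R'"
    then obtain r z and i :: int where b: "b = r \<otimes> a [^] i" "w = z * \<xi> powi i" and rz: "(r, z) \<in> R"
      unfolding R'_def by blast
    note r = D(2)[OF rz]
    have "inv b = inv r \<otimes> a [^] (- i)" unfolding b using r a by (simp add: inv_mult int_pow_neg)
    moreover have "inverse w = inverse z * \<xi> powi (- i)" unfolding b by (simp add: power_int_minus)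
    ultimately have "(inv b, inverse w) \<in> R'" using mem[OF D(4)[OF rz]] by simp
    thus "b \<in> carrier G \<and> cmod w = 1 \<and> (inv b, inverse w) \<in> R'"
      using b r a D(3)[OF rz] \<xi> by (simp add: norm_mult norm_power_int)
  next
    fix b w b' w' assume "(b, w) \<in> R'" "(b', w') \<in> R'"
    then obtain r z r' z' and i i' :: int where b: "b = r \<otimes> a [^] i" "w = z * \<xi> powi i" and rz: "(r, z) \<in> R"
      and b': "b' = r' \<otimes> a [^] i'" "w' = z' * \<xi> powi i'" and rz': "(r', z') \<in> R"
      unfolding R'_def by blast
    note r = D(2)[OF rz] and r' = D(2)[OF rz']
    have "b \<otimes> b' = (r \<otimes> r') \<otimes> a [^] (i + i')"
      unfolding b b' using r r' a by (simp add: int_pow_mult m_ac)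
    moreover have "w * w' = (z * z') * \<xi> powi (i + i')"
      unfolding b b' using \<xi>0 by (simp add: power_int_add)
    ultimately show "(b \<otimes> b', w * w') \<in> R'" using mem[OF D(5)[OF rz rz']] by simp
  next
    fix w assume "(\<one>, w) \<in> R'"
    then obtain r z and i :: int where e: "\<one> = r \<otimes> a [^] i" and w: "w = z * \<xi> powi i" and rz: "(r, z) \<in> R"
      unfolding R'_def by blast
    \<comment> \<open>A product equal to the identity makes \<open>r\<close> a power of
      \<open>a\<close>, whose value is known from \<open>compat\<close>.\<close>
    have "r = a [^] (- i)"
      using e D(2)[OF rz] a by (metis inv_equality int_pow_closed int_pow_neg inv_inv inv_closed)
    hence "\<xi> powi (- i) = z" using rz by (intro compat) simp
    hence "inverse (\<xi> powi i) = z" by (simp add: power_int_minus)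
    thus "w = 1" using \<xi>0 unfolding w by auto
  qed
qed

lemma complex_unit_root:
  assumes "cmod z = 1" "n > 0"
  shows "\<exists>\<xi>. cmod \<xi> = 1 \<and> \<xi> ^ n = z"
proof (intro exI conjI)
  have "z \<noteq> 0" using assms by auto
  hence "cis (Arg z) = z" using assms by (simp add: cis_Arg sgn_div_norm)
  thus "cis (Arg z / n) ^ n = z" using assms by (simp add: DeMoivre)
qed simp

text \<open>Divisibility of the circle: \<open>\<xi>\<close> is an \<open>n\<close>-th root of the value at \<open>a [^] n\<close>, where \<open>n\<close> is least
  such that \<open>a [^] n\<close> is in the domain.\<close>

lemma (in group) partial_character_compatible_value:
  assumes R: "partial_character G R" and a: "a \<in> carrier G"
  shows "\<exists>\<xi>. cmod \<xi> = 1 \<and> (\<forall>(i :: int) z. (a [^] i, z) \<in> R \<longrightarrow> \<xi> powi i = z)"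
proof -
  note D = partial_characterD[OF R]
  define P where "P = (\<lambda>n :: nat. 0 < n \<and> (\<exists>z. (a [^] n, z) \<in> R))"
  have pos: "P (nat i)" if "(a [^] i, z) \<in> R" "0 < i" for i :: int and z
    using that int_pow_int[of G a "nat i"] unfolding P_def by auto
  show ?thesis
  proof (cases "\<exists>n. P n")
    case False
    \<comment> \<open>No positive power of \<open>a\<close> is in the domain, and passing to
      inverses excludes the negative exponents too. Only the exponent 0 remains, so
      \<open>\<xi> = 1\<close> will do.\<close>
    have "z = 1 \<and> i = 0" if az: "(a [^] i, z) \<in> R" for i :: int and z
    proof -
      have "\<not> 0 < i" using pos[OF az] False by blast
      moreover have "(a [^] (- i), inverse z) \<in> R" using D(4)[OF az] a by (simp add: int_pow_neg)
      hence "\<not> 0 < - i" using pos False by blast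
      ultimately have "i = 0" by simp
      thus ?thesis using az D(6) by simp
    qed
    thus ?thesis by (intro exI[of _ 1]) auto
  next
    case True
    define n where "n = (LEAST n. P n)"
    have Pn: "P n" unfolding n_def using True by (metis LeastI)
    have least: "n \<le> k" if "P k" for k unfolding n_def using that by (rule Least_le)
    have n: "0 < n" using Pn by (simp add: P_def)
    obtain z0 where z0: "(a [^] n, z0) \<in> R" using Pn by (auto simp: P_def)
    obtain \<xi> where \<xi>: "cmod \<xi> = 1" "\<xi> ^ n = z0" using complex_unit_root[OF D(3)[OF z0] n] by blast
    have "\<xi> powi i = z" if az: "(a [^] i, z) \<in> R" for i :: int and z
    proof -
      \<comment> \<open>Division with remainder: \<open>a [^] r\<close> is again in the domain, so
        minimality of \<open>n\<close> forces \<open>r = 0\<close>.\<close>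
      define q r where "q = i div int n" and "r = i mod int n"
      have i: "i = int n * q + r" by (simp add: q_def r_def)
      have r: "0 \<le> r" "r < int n" using n by (auto simp: r_def)
      have e: "(a [^] n) [^] q = a [^] (int n * q)"
        unfolding int_pow_int[symmetric, of G a n] by (rule int_pow_pow[OF a])
      have *: "(a [^] (int n * q), z0 powi q) \<in> R"
        using partial_character_int_pow[OF R z0, of q] unfolding e .
      have "(a [^] i \<otimes> inv (a [^] (int n * q)), z * inverse (z0 powi q)) \<in> R"
        by (rule D(5)[OF az D(4)[OF *]])
      moreover have "a [^] i \<otimes> inv (a [^] (int n * q)) = a [^] r"
        unfolding int_pow_neg[OF a, symmetric] int_pow_mult[OF a, symmetric] by (simp add: i)
      ultimately have "(a [^] r, z * inverse (z0 powi q)) \<in> R" by simp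
      hence "r = 0" using pos[of r] least[of "nat r"] r by force
      hence "i = int n * q" using i by simp
      moreover have "(a [^] i, z0 powi q) \<in> R" using * calculation by simp
      hence "z = z0 powi q" using partial_character_unique[OF R az] by blast
      ultimately show ?thesis by (simp add: power_int_mult \<xi>(2))
    qed
    thus ?thesis using \<xi>(1) by blast
  qed
qed

text \<open>Zorn's lemma: a maximal extension is defined everywhere, since any element can be
  adjoined at a value compatible with it.\<close>

lemma (in comm_group) partial_character_extension:
  assumes R: "partial_character G R"
  shows "\<exists>\<chi>. character G \<chi> \<and> (\<forall>(a, z)\<in>R. \<chi> a = z)"
proof -
  define \<A> where "\<A> = {S. partial_character G S \<and> R \<subseteq> S}"
  have "\<exists>M\<in>\<A>. \<forall>X\<in>\<A>. M \<subseteq> X \<longrightarrow> X = M"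
  proof (rule subset_Zorn_nonempty)
    show "\<A> \<noteq> {}" using R by (auto simp: \<A>_def)
    fix \<C> assume ne: "\<C> \<noteq> {}" and ch: "subset.chain \<A> \<C>"
    have C: "partial_character G S" "R \<subseteq> S" if "S \<in> \<C>" for S
      using ch that by (auto simp: subset.chain_def \<A>_def)
    have lin: "S \<subseteq> T \<or> T \<subseteq> S" if "S \<in> \<C>" "T \<in> \<C>" for S T
      using ch that unfolding subset.chain_def by blast
    have "partial_character G (\<Union>\<C>)"
      unfolding partial_character_def
    proof (intro conjI ballI allI impI; clarify?)
      obtain S where "S \<in> \<C>" using ne by blast
      thus "(\<one>, 1) \<in> \<Union>\<C>" using partial_characterD(1)[OF C(1)] by blast
    next
      fix a z S assume S: "S \<in> \<C>" "(a, z) \<in> S"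
      show "a \<in> carrier G \<and> cmod z = 1 \<and> (inv a, inverse z) \<in> \<Union>\<C>"
        using partial_characterD[OF C(1)[OF S(1)]] S by blast
    next
      fix a z S b w T assume S: "S \<in> \<C>" "(a, z) \<in> S" and T: "T \<in> \<C>" "(b, w) \<in> T"
      show "(a \<otimes> b, z * w) \<in> \<Union>\<C>"
        using lin[OF S(1) T(1)] S T partial_characterD(5)[OF C(1)] by blast
    next
      fix z S assume "S \<in> \<C>" "(\<one>, z) \<in> S"
      thus "z = 1" using partial_characterD(6)[OF C(1)] by blast
    qed
    thus "\<Union>\<C> \<in> \<A>" using C(2) ne unfolding \<A>_def by blast
  qed
  then obtain M where "M \<in> \<A>" and "\<forall>X\<in>\<A>. M \<subseteq> X \<longrightarrow> X = M" by (elim bexE)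
  hence M: "partial_character G M" "R \<subseteq> M"
    and max: "\<And>X. partial_character G X \<Longrightarrow> M \<subseteq> X \<Longrightarrow> X = M"
    unfolding \<A>_def by auto
  note D = partial_characterD[OF M(1)]
  have total: "\<exists>z. (a, z) \<in> M" if a: "a \<in> carrier G" for a
  proof -
    obtain \<xi> where \<xi>: "cmod \<xi> = 1" "\<And>(i :: int) z. (a [^] i, z) \<in> M \<Longrightarrow> \<xi> powi i = z"
      using partial_character_compatible_value[OF M(1) a] by blast
    obtain X where "partial_character G X" "M \<subseteq> X" "(a, \<xi>) \<in> X"
      using partial_character_adjoin[OF M(1) a \<xi>] by meson
    thus ?thesis using max by metis
  qed
  define \<chi> where "\<chi> = (\<lambda>a. SOME z. (a, z) \<in> M)"
  have \<chi>: "(a, \<chi> a) \<in> M" if "a \<in> carrier G" for a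
    unfolding \<chi>_def using total[OF that] by (rule someI_ex)
  have eq: "\<chi> a = z" if "(a, z) \<in> M" for a z
    using partial_character_unique[OF M(1) \<chi> that] D(2)[OF that] by blast
  have "character G \<chi>" unfolding character_def
    using D(3)[OF \<chi>] eq[OF D(5)[OF \<chi> \<chi>]] by simp
  moreover have "\<chi> a = z" if "(a, z) \<in> R" for a z using eq M(2) that by (simp add: subset_iff)
  ultimately show ?thesis by (intro exI[of _ \<chi>]) auto
qed

section \<open>The embedded matrix factors\<close>

text \<open>Finitely many stages do not matter. Needed because \<open>uhf_embed N\<close> has the
  default value 0 below stage \<open>N\<close>, so identities between embedded matrices are checked
  only from that stage on.\<close>

lemma abs_univ_uhf_eventually_eq:
  assumes "coherent a" "coherent b" "\<And>M. K \<le> M \<Longrightarrow> a M = b M"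
  shows "abs_univ_uhf a = abs_univ_uhf b"
proof -
  have "mat_norm (a M - b M) = 0" if "K \<le> M" for M
    using assms(3)[OF that] mat_minus_self[OF coherent_carrier[OF assms(2)], of M] by simp
  hence "(\<lambda>M. mat_norm (a M - b M)) \<longlonglongrightarrow> 0"
    by (intro tendsto_eventually eventually_sequentiallyI[of K]) simp
  thus ?thesis using assms(1,2) by (intro abs_univ_uhf_eqI) (simp add: uhf_rel_def)
qed

lemma uhf_embed_amp:
  assumes "A \<in> M_fact N" "N \<le> M"
  shows "uhf_embed M (amp N M A) = uhf_embed N A"
  unfolding uhf_embed_def
  by (rule abs_univ_uhf_eventually_eq[of _ _ M])
    (use assms in \<open>auto intro!: coherent_embed amp_carrier simp: amp_amp\<close>)

lemma uhf_embed_mult: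
  assumes "A \<in> M_fact N" "B \<in> M_fact N"
  shows "uhf_embed N (A * B) = uhf_embed N A * uhf_embed N B"
  unfolding uhf_embed_def abs_univ_uhf_simps(3)[OF coherent_embed[OF assms(1)] coherent_embed[OF assms(2)]]
  by (rule abs_univ_uhf_eventually_eq[of _ _ N])
    (use assms in \<open>auto intro!: coherent_embed coherent_mult amp_mult\<close>)

lemma uhf_embed_add:
  assumes "A \<in> M_fact N" "B \<in> M_fact N"
  shows "uhf_embed N (A + B) = uhf_embed N A + uhf_embed N B"
  unfolding uhf_embed_def abs_univ_uhf_simps(1)[OF coherent_embed[OF assms(1)] coherent_embed[OF assms(2)]]
  by (rule abs_univ_uhf_eventually_eq[of _ _ N])
    (use assms in \<open>auto intro!: coherent_embed coherent_add amp_add\<close>)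

lemma uhf_embed_adjoint:
  assumes "A \<in> M_fact N"
  shows "uhf_embed N (mat_adjoint A) = star (uhf_embed N A)"
  unfolding uhf_embed_def abs_univ_uhf_simps(5)[OF coherent_embed[OF assms]]
  by (rule abs_univ_uhf_eventually_eq[of _ _ N])
    (use assms in \<open>auto intro!: coherent_embed coherent_adjoint simp: amp_adjoint\<close>)

lemma uhf_embed_one: "uhf_embed N (1\<^sub>m (fact N)) = 1"
  unfolding uhf_embed_def abs_univ_uhf_simps
  by (rule abs_univ_uhf_eventually_eq[of _ _ N]) (auto intro!: coherent_embed coherent_one simp: amp_one)

lemma uhf_embed_zero: "uhf_embed N (0\<^sub>m (fact N) (fact N)) = 0"
  unfolding uhf_embed_def abs_univ_uhf_simps
  by (rule abs_univ_uhf_cong) (auto simp: amp_zero)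

lemma U_prodD:
  assumes "u \<in> carrier U_prod" "1 \<le> n"
  shows "u n \<in> carrier_mat n n" "mat_adjoint (u n) * u n = 1\<^sub>m n" "u n * mat_adjoint (u n) = 1\<^sub>m n"
  using assms by (auto simp: U_prod_def unitary_group_def)

lemma tensor_upto_conj_kron:
  assumes u: "u \<in> carrier U_prod" and A: "A \<in> M_fact N" and X: "X \<in> carrier_mat (Suc N) (Suc N)"
  shows "tensor_upto u (Suc N) * kron A X * mat_adjoint (tensor_upto u (Suc N))
    = kron (tensor_upto u N * A * mat_adjoint (tensor_upto u N)) (u (Suc N) * X * mat_adjoint (u (Suc N)))"
proof -
  have T: "tensor_upto u N \<in> M_fact N"
    using tensor_upto_unitary[OF u, of N] by (simp add: unitary_group_def)
  have v: "u (Suc N) \<in> carrier_mat (Suc N) (Suc N)" using U_prodD(1)[OF u] by simp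
  note T' = mat_adjoint_carrier[OF T] and v' = mat_adjoint_carrier[OF v]
  show ?thesis
    unfolding tensor_upto.simps kron_adjoint kron_mult[OF T v A X]
      kron_mult[OF mult_carrier_mat[OF T A] mult_carrier_mat[OF v X] T' v'] ..
qed

text \<open>Each further unitary merely conjugates an identity matrix, so it contributes the factor
  1.\<close>

lemma tensor_upto_conj_amp:
  assumes u: "u \<in> carrier U_prod" and A: "A \<in> M_fact N" and NM: "N \<le> M"
  shows "tensor_upto u M * amp N M A * mat_adjoint (tensor_upto u M)
    = amp N M (tensor_upto u N * A * mat_adjoint (tensor_upto u N))"
  using NM
proof (induction M rule: dec_induct)
  case base
  show ?case by (simp add: amp_self)
next
  case (step M)
  have S: "amp N (Suc M) B = kron (amp N M B) (1\<^sub>m (Suc M))" for B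
    using amp_amp[OF step(1), of "Suc M" B] unfolding amp_Suc by simp
  have v: "u (Suc M) * 1\<^sub>m (Suc M) * mat_adjoint (u (Suc M)) = 1\<^sub>m (Suc M)"
    using U_prodD[OF u, of "Suc M"] by simp
  show ?case
    unfolding S tensor_upto_conj_kron[OF u amp_carrier[OF step(1) A] one_carrier_mat] step(3) v ..
qed

lemma tensor_Ad_embed:
  assumes u: "u \<in> carrier U_prod" and A: "A \<in> M_fact N"
  shows "tensor_Ad u (uhf_embed N A)
    = uhf_embed N (tensor_upto u N * A * mat_adjoint (tensor_upto u N))"
  unfolding uhf_embed_def tensor_Ad_abs[OF u coherent_embed[OF A]]
proof (rule abs_univ_uhf_eventually_eq[of _ _ N])
  have "tensor_upto u N \<in> M_fact N"
    using tensor_upto_unitary[OF u, of N] by (simp add: unitary_group_def)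
  thus "coherent (\<lambda>M. if N \<le> M then amp N M (tensor_upto u N * A * mat_adjoint (tensor_upto u N))
        else 0\<^sub>m (fact M) (fact M))"
    using A by (intro coherent_embed mult_carrier_mat mat_adjoint_carrier)
qed (use coherent_conj[OF u coherent_embed[OF A]] tensor_upto_conj_amp[OF u A] in auto)

text \<open>The factor $M_{N+1}$ of $\mathcal{Q}$, which commutes with $M_1 \otimes \cdots \otimes M_N$.\<close>

definition factor_embed :: "nat \<Rightarrow> complex mat \<Rightarrow> univ_uhf" where
  "factor_embed N X = uhf_embed (Suc N) (kron (1\<^sub>m (fact N)) X)"

lemma kron_one_left_carrier:
  assumes "X \<in> carrier_mat (Suc N) (Suc N)"
  shows "kron (1\<^sub>m (fact N)) X \<in> M_fact (Suc N)"
  using kron_carrier[OF one_carrier_mat assms, of "fact N"] by (simp add: mult.commute)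

context
  fixes N :: nat and X Y :: "complex mat"
  assumes X: "X \<in> carrier_mat (Suc N) (Suc N)" and Y: "Y \<in> carrier_mat (Suc N) (Suc N)"
begin

lemma factor_embed_mult: "factor_embed N (X * Y) = factor_embed N X * factor_embed N Y"
  unfolding factor_embed_def uhf_embed_mult[OF X[THEN kron_one_left_carrier] Y[THEN kron_one_left_carrier], symmetric]
  by (subst kron_mult[OF one_carrier_mat X one_carrier_mat Y]) simp

lemma factor_embed_add: "factor_embed N (X + Y) = factor_embed N X + factor_embed N Y"
proof -
  have "kron (1\<^sub>m (fact N)) (X + Y) = kron (1\<^sub>m (fact N)) X + kron (1\<^sub>m (fact N)) Y"
  proof (rule eq_matI)
    fix i j assume "i < dim_row (kron (1\<^sub>m (fact N)) X + kron (1\<^sub>m (fact N)) Y)"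
      "j < dim_col (kron (1\<^sub>m (fact N)) X + kron (1\<^sub>m (fact N)) Y)"
    hence ij: "i < fact N * Suc N" "j < fact N * Suc N" using Y by auto
    note dm = div_mod_less[OF ij(1)] div_mod_less[OF ij(2)]
    show "kron (1\<^sub>m (fact N)) (X + Y) $$ (i, j) = (kron (1\<^sub>m (fact N)) X + kron (1\<^sub>m (fact N)) Y) $$ (i, j)"
      using ij dm X Y by (simp add: kron_index)
  qed (use X Y in auto)
  thus ?thesis
    unfolding factor_embed_def uhf_embed_add[OF X[THEN kron_one_left_carrier] Y[THEN kron_one_left_carrier], symmetric]
    by simp
qed

end

lemma factor_embed_adjoint:
  assumes "X \<in> carrier_mat (Suc N) (Suc N)"
  shows "factor_embed N (mat_adjoint X) = star (factor_embed N X)"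
  unfolding factor_embed_def uhf_embed_adjoint[OF kron_one_left_carrier[OF assms], symmetric]
  by (simp add: kron_adjoint)

lemma factor_embed_one: "factor_embed N (1\<^sub>m (Suc N)) = 1"
  using uhf_embed_one[of "Suc N"] by (simp add: factor_embed_def kron_one_one mult.commute)

lemma factor_embed_zero: "factor_embed N (0\<^sub>m (Suc N) (Suc N)) = 0"
proof -
  have "kron (1\<^sub>m (fact N)) (0\<^sub>m (Suc N) (Suc N)) = (0\<^sub>m (fact (Suc N)) (fact (Suc N)) :: complex mat)"
  proof (rule eq_matI)
    fix i j assume "i < dim_row (0\<^sub>m (fact (Suc N)) (fact (Suc N)) :: complex mat)"
      "j < dim_col (0\<^sub>m (fact (Suc N)) (fact (Suc N)) :: complex mat)"
    hence ij: "i < fact N * Suc N" "j < fact N * Suc N" by (auto simp: mult.commute)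
    note dm = div_mod_less[OF ij(1)] div_mod_less[OF ij(2)]
    show "kron (1\<^sub>m (fact N)) (0\<^sub>m (Suc N) (Suc N)) $$ (i, j) = (0\<^sub>m (fact (Suc N)) (fact (Suc N)) :: complex mat) $$ (i, j)"
      using ij dm by (simp add: kron_index algebra_simps)
  qed (auto simp: mult.commute)
  thus ?thesis using uhf_embed_zero[of "Suc N"] by (simp only: factor_embed_def)
qed

lemma factor_embed_sum:
  assumes "finite I" "\<And>i. i \<in> I \<Longrightarrow> X i \<in> carrier_mat (Suc N) (Suc N)"
  shows "(\<Sum>i\<in>I. factor_embed N (X i)) = factor_embed N (mat (Suc N) (Suc N) (\<lambda>ab. \<Sum>i\<in>I. X i $$ ab))"
  using assms
proof (induction I rule: finite_induct)
  case empty
  have "mat (Suc N) (Suc N) (\<lambda>ab. \<Sum>i\<in>{}. X i $$ ab) = 0\<^sub>m (Suc N) (Suc N)"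
    by (intro eq_matI) auto
  thus ?case by (simp add: factor_embed_zero)
next
  case (insert j I)
  have "mat (Suc N) (Suc N) (\<lambda>ab. \<Sum>i\<in>insert j I. X i $$ ab)
      = X j + mat (Suc N) (Suc N) (\<lambda>ab. \<Sum>i\<in>I. X i $$ ab)"
    using insert by (intro eq_matI) auto
  thus ?case using insert by (simp add: factor_embed_add)
qed

text \<open>At stage \<open>Suc N\<close> the two elements become \<open>kron 1 X\<close> and
  \<open>kron B 1\<close>, which act on different tensor factors.\<close>

lemma factor_embed_commute:
  assumes A: "A \<in> M_fact K" and K: "K \<le> N" and X: "X \<in> carrier_mat (Suc N) (Suc N)"
  shows "factor_embed N X * uhf_embed K A = uhf_embed K A * factor_embed N X"
proof -
  define B where "B = amp K N A"
  have B: "B \<in> M_fact N" unfolding B_def by (rule amp_carrier[OF K A])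
  have B': "kron B (1\<^sub>m (Suc N)) \<in> M_fact (Suc N)"
    using kron_carrier[OF B one_carrier_mat, of "Suc N"] by (simp add: mult.commute)
  have "uhf_embed K A = uhf_embed N B" unfolding B_def by (rule uhf_embed_amp[OF A K, symmetric])
  also have "\<dots> = uhf_embed (Suc N) (kron B (1\<^sub>m (Suc N)))"
    using uhf_embed_amp[OF B, of "Suc N"] by (simp only: amp_Suc lessI less_imp_le)
  finally have e: "uhf_embed K A = uhf_embed (Suc N) (kron B (1\<^sub>m (Suc N)))" .
  show ?thesis
    unfolding e factor_embed_def uhf_embed_mult[OF kron_one_left_carrier[OF X] B', symmetric]
      uhf_embed_mult[OF B' kron_one_left_carrier[OF X], symmetric]
      kron_mult[OF one_carrier_mat X B one_carrier_mat] kron_mult[OF B one_carrier_mat one_carrier_mat X]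
    using B X by simp
qed

lemma tensor_Ad_factor_embed:
  assumes u: "u \<in> carrier U_prod" and X: "X \<in> carrier_mat (Suc N) (Suc N)"
  shows "tensor_Ad u (factor_embed N X) = factor_embed N (u (Suc N) * X * mat_adjoint (u (Suc N)))"
proof -
  have "tensor_upto u N * 1\<^sub>m (fact N) * mat_adjoint (tensor_upto u N) = 1\<^sub>m (fact N)"
    using tensor_upto_unitary[OF u, of N] by (auto simp: unitary_group_def)
  thus ?thesis
    unfolding factor_embed_def tensor_Ad_embed[OF u kron_one_left_carrier[OF X]]
      tensor_upto_conj_kron[OF u one_carrier_mat X] by simp
qed

section \<open>Rokhlin projections from a single tensor factor\<close>

lemma is_projection_norm_le:
  assumes "is_projection p"
  shows "norm p \<le> 1"
proof -
  \<comment> \<open>The C*-identity, with \<open>star p * p = p\<close>.\<close>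
  have "norm p = (norm p)\<^sup>2" using norm_star_mult[of p] assms by (simp add: is_projection_def)
  hence "norm p * (norm p - 1) = 0" by (simp add: power2_eq_square algebra_simps)
  thus ?thesis by auto
qed

text \<open>The last condition says that the projections add up to \<open>1\<^sub>m m\<close>; matrices of a fixed size do not
  form a type, so the sum is taken entrywise.\<close>

definition cyclic_tower :: "nat \<Rightarrow> nat \<Rightarrow> complex mat \<Rightarrow> (nat \<Rightarrow> complex mat) \<Rightarrow> bool" where
  "cyclic_tower k m v p \<longleftrightarrow>
     (\<forall>i\<in>{1..k}. p i \<in> carrier_mat m m \<and> mat_adjoint (p i) = p i \<and> p i * p i = p i) \<and>
     (\<forall>i\<in>{1..k}. \<forall>j\<in>{1..k}. i \<noteq> j \<longrightarrow> p i * p j = 0\<^sub>m m m) \<and>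
     (\<forall>i\<in>{1..k}. v * p i * mat_adjoint v = p (if i = k then 1 else i + 1)) \<and>
     (\<forall>a<m. \<forall>b<m. (\<Sum>i\<in>{1..k}. p i $$ (a, b)) = (if a = b then 1 else 0))"

lemma cyclic_tower_factor:
  assumes u: "u \<in> carrier U_prod" and p: "cyclic_tower k (Suc N) (u (Suc N)) p"
  defines "q \<equiv> \<lambda>i. factor_embed N (p i)"
  shows "orthogonal_projections k q" "(\<Sum>i\<in>{1..k}. q i) = 1"
    and "\<And>i. i \<in> {1..k} \<Longrightarrow> tensor_Ad u (q i) = q (if i = k then 1 else i + 1)"
    and "\<And>i K A. i \<in> {1..k} \<Longrightarrow> A \<in> M_fact K \<Longrightarrow> K \<le> N \<Longrightarrow> q i * uhf_embed K A = uhf_embed K A * q i"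
proof -
  have c: "p i \<in> carrier_mat (Suc N) (Suc N)" "mat_adjoint (p i) = p i" "p i * p i = p i" if "i \<in> {1..k}" for i
    using p that by (auto simp: cyclic_tower_def)
  have o: "p i * p j = 0\<^sub>m (Suc N) (Suc N)" if "i \<in> {1..k}" "j \<in> {1..k}" "i \<noteq> j" for i j
    using p that unfolding cyclic_tower_def by blast
  show "orthogonal_projections k q"
    unfolding orthogonal_projections_def is_projection_def q_def
    using c o by (simp add: factor_embed_mult[symmetric] factor_embed_adjoint[symmetric] factor_embed_zero)
  have "mat (Suc N) (Suc N) (\<lambda>ab. \<Sum>i\<in>{1..k}. p i $$ ab) = 1\<^sub>m (Suc N)"
    using p unfolding cyclic_tower_def by (intro eq_matI) auto
  thus "(\<Sum>i\<in>{1..k}. q i) = 1"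
    unfolding q_def using factor_embed_sum[of "{1..k}" p N] c by (simp add: factor_embed_one)
  show "tensor_Ad u (q i) = q (if i = k then 1 else i + 1)" if i: "i \<in> {1..k}" for i
    unfolding q_def tensor_Ad_factor_embed[OF u c(1)[OF i]]
    using p i unfolding cyclic_tower_def by metis
  show "q i * uhf_embed K A = uhf_embed K A * q i" if "i \<in> {1..k}" "A \<in> M_fact K" "K \<le> N" for i K A
    unfolding q_def using that by (intro factor_embed_commute c)
qed

text \<open>Each \<open>x\<close> in \<open>F\<close> is approximated by some \<open>y\<close> from
  a finite stage. A tower in a later factor commutes with \<open>y\<close> exactly, so the
  commutator with \<open>x\<close> sees only the error \<open>x - y\<close>, twice; hence the bound
  \<open>\<epsilon> / 2\<close>. Arbitrarily late towers are required because the stage depends on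
  \<open>\<epsilon>\<close> and \<open>F\<close>.\<close>

lemma cyclic_tower_rokhlin:
  assumes u: "u \<in> carrier U_prod"
    and towers: "\<And>M. \<exists>N\<ge>M. \<exists>p. cyclic_tower k (Suc N) (u (Suc N)) p"
    and e: "\<epsilon> > 0" and F: "finite F"
  shows "\<exists>p. orthogonal_projections k p \<and>
         (\<forall>i\<in>{1..k}. \<forall>a\<in>F. norm (p i * a - a * p i) < \<epsilon>) \<and>
         (\<forall>i\<in>{1..k}. tensor_Ad u (p i) = p (if i = k then 1 else i + 1)) \<and>
         (\<Sum>i\<in>{1..k}. p i) = 1"
proof -
  have "\<forall>x. \<exists>K. \<exists>A\<in>M_fact K. norm (x - uhf_embed K A) < \<epsilon> / 2"
    using e by (intro allI uhf_embed_dense) simp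
  then obtain K A where KA: "\<And>x. A x \<in> M_fact (K x)" "\<And>x. norm (x - uhf_embed (K x) (A x)) < \<epsilon> / 2"
    by metis
  obtain M where M: "\<And>x. x \<in> F \<Longrightarrow> K x \<le> M"
    using F by (metis finite_imageI finite_nat_set_iff_bounded_le imageI)
  obtain N p where N: "M \<le> N" and p: "cyclic_tower k (Suc N) (u (Suc N)) p" using towers by blast
  define q where "q i = factor_embed N (p i)" for i
  note q = cyclic_tower_factor[OF u p, folded q_def]
  have "norm (q i * x - x * q i) < \<epsilon>" if i: "i \<in> {1..k}" and x: "x \<in> F" for i x
  proof -
    define y where "y = uhf_embed (K x) (A x)"
    have qy: "q i * y = y * q i" unfolding y_def by (rule q(4)[OF i KA(1)]) (use M[OF x] N in simp)
    have "norm (q i) \<le> 1"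
      using q(1) i by (intro is_projection_norm_le) (simp add: orthogonal_projections_def)
    hence b: "norm (q i * (x - y)) \<le> norm (x - y)" "norm ((x - y) * q i) \<le> norm (x - y)"
      using norm_mult_ineq[of "q i" "x - y"] norm_mult_ineq[of "x - y" "q i"]
        mult_left_le[of "norm (q i)" "norm (x - y)"] by (auto simp: mult.commute)
    have "q i * x - x * q i = q i * (x - y) - (x - y) * q i" using qy by (simp add: algebra_simps)
    hence "norm (q i * x - x * q i) \<le> norm (q i * (x - y)) + norm ((x - y) * q i)"
      by (metis norm_triangle_ineq4)
    thus ?thesis using b KA(2)[of x] unfolding y_def by linarith
  qed
  thus ?thesis using q by blast
qed

section \<open>Monomial representations\<close>

text \<open>An operator given by its kernel on a finite basis set, with \<open>e\<close> numbering
  the basis. Matrix identities turn into identities of sums over that set.\<close>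

definition kernel_mat :: "(nat \<Rightarrow> 'b) \<Rightarrow> nat \<Rightarrow> ('b \<Rightarrow> 'b \<Rightarrow> complex) \<Rightarrow> complex mat" where
  "kernel_mat e m f = mat m m (\<lambda>(i, j). f (e i) (e j))"

lemma kernel_mat_carrier [simp]: "kernel_mat e m f \<in> carrier_mat m m"
  by (simp add: kernel_mat_def)

context
  fixes e :: "nat \<Rightarrow> 'b" and m :: nat and B :: "'b set"
  assumes e: "bij_betw e {..<m} B"
begin

lemma kernel_mat_cong:
  assumes "\<And>x y. x \<in> B \<Longrightarrow> y \<in> B \<Longrightarrow> f x y = f' x y"
  shows "kernel_mat e m f = kernel_mat e m f'"
  unfolding kernel_mat_def using assms bij_betwE[OF e] by (intro eq_matI) auto

lemma kernel_mat_mult: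
  "kernel_mat e m f * kernel_mat e m f' = kernel_mat e m (\<lambda>x z. \<Sum>y\<in>B. f x y * f' y z)"
proof (rule eq_matI)
  fix i j assume ij: "i < dim_row (kernel_mat e m (\<lambda>x z. \<Sum>y\<in>B. f x y * f' y z))"
    "j < dim_col (kernel_mat e m (\<lambda>x z. \<Sum>y\<in>B. f x y * f' y z))"
  have "(\<Sum>k<m. f (e i) (e k) * f' (e k) (e j)) = (\<Sum>y\<in>B. f (e i) y * f' y (e j))"
    by (rule sum.reindex_bij_betw[OF e])
  thus "(kernel_mat e m f * kernel_mat e m f') $$ (i, j) = kernel_mat e m (\<lambda>x z. \<Sum>y\<in>B. f x y * f' y z) $$ (i, j)"
    using ij by (simp add: kernel_mat_def scalar_prod_def atLeast0LessThan)
qed (auto simp: kernel_mat_def)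

lemma kernel_mat_adjoint: "mat_adjoint (kernel_mat e m f) = kernel_mat e m (\<lambda>x y. cnj (f y x))"
  by (intro eq_matI) (auto simp: kernel_mat_def)

lemma kernel_mat_one:
  assumes "\<And>x y. x \<in> B \<Longrightarrow> y \<in> B \<Longrightarrow> f x y = (if x = y then 1 else 0)"
  shows "kernel_mat e m f = 1\<^sub>m m"
  using assms bij_betwE[OF e] inj_on_eq_iff[OF bij_betw_imp_inj_on[OF e]]
  by (intro eq_matI) (auto simp: kernel_mat_def)

text \<open>The basis vector \<open>x\<close> goes to \<open>l g x\<close> times the basis vector
  \<open>f g x\<close>. Such operators multiply correctly because \<open>f\<close> is an action and
  \<open>l_mult\<close> is the cocycle identity over it.\<close>

lemma kernel_mat_monomial_hom:
  assumes G: "group G"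
    and f: "\<And>g x. g \<in> carrier G \<Longrightarrow> x \<in> B \<Longrightarrow> f g x \<in> B"
    and f_one: "\<And>x. x \<in> B \<Longrightarrow> f \<one>\<^bsub>G\<^esub> x = x"
    and f_mult: "\<And>g h x. g \<in> carrier G \<Longrightarrow> h \<in> carrier G \<Longrightarrow> x \<in> B \<Longrightarrow> f (g \<otimes>\<^bsub>G\<^esub> h) x = f g (f h x)"
    and l_norm: "\<And>g x. g \<in> carrier G \<Longrightarrow> x \<in> B \<Longrightarrow> cmod (l g x) = 1"
    and l_mult: "\<And>g h x. g \<in> carrier G \<Longrightarrow> h \<in> carrier G \<Longrightarrow> x \<in> B \<Longrightarrow> l (g \<otimes>\<^bsub>G\<^esub> h) x = l g (f h x) * l h x"
  shows "(\<lambda>g. kernel_mat e m (\<lambda>y x. if y = f g x then l g x else 0)) \<in> hom G (unitary_group m)"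
proof (rule homI)
  interpret group G by (rule G)
  have B: "finite B" using e bij_betw_finite by blast
  let ?\<sigma> = "\<lambda>g. kernel_mat e m (\<lambda>y x. if y = f g x then l g x else 0)"
  fix g assume g: "g \<in> carrier G"
  have inj: "x = y" if "x \<in> B" "y \<in> B" "f g x = f g y" for x y
    using f_mult[OF inv_closed[OF g] g] that f_one g by (metis l_inv)
  have l: "cnj (l g x) * l g x = 1" if "x \<in> B" for x
    using l_norm[OF g that] by (simp add: complex_norm_square[symmetric] mult.commute)
  have "mat_adjoint (?\<sigma> g) * ?\<sigma> g = 1\<^sub>m m"
    unfolding kernel_mat_adjoint kernel_mat_mult
  proof (rule kernel_mat_one)
    fix x z assume xz: "x \<in> B" "z \<in> B"
    have "(\<Sum>y\<in>B. cnj (if y = f g x then l g x else 0) * (if y = f g z then l g z else 0))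
        = (\<Sum>y\<in>B. if y = f g x then cnj (l g x) * (if f g x = f g z then l g z else 0) else 0)"
      by (rule sum.cong) auto
    also have "\<dots> = (if x = z then 1 else 0)"
      using f[OF g xz(1)] B inj[OF xz] l[OF xz(1)] by auto
    finally show "(\<Sum>y\<in>B. cnj (if y = f g x then l g x else 0) * (if y = f g z then l g z else 0))
        = (if x = z then 1 else 0)" .
  qed
  moreover from this have "?\<sigma> g * mat_adjoint (?\<sigma> g) = 1\<^sub>m m"
    by (rule mat_mult_left_right_inverse[rotated 2]) auto
  ultimately show "?\<sigma> g \<in> carrier (unitary_group m)" by (simp add: unitary_group_def)
  fix h assume h: "h \<in> carrier G"
  have "?\<sigma> (g \<otimes>\<^bsub>G\<^esub> h) = ?\<sigma> g * ?\<sigma> h"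
    unfolding kernel_mat_mult
  proof (rule kernel_mat_cong)
    fix x z assume xz: "x \<in> B" "z \<in> B"
    have "(\<Sum>y\<in>B. (if x = f g y then l g y else 0) * (if y = f h z then l h z else 0))
        = (\<Sum>y\<in>B. if y = f h z then (if x = f g (f h z) then l g (f h z) else 0) * l h z else 0)"
      by (rule sum.cong) auto
    also have "\<dots> = (if x = f (g \<otimes>\<^bsub>G\<^esub> h) z then l (g \<otimes>\<^bsub>G\<^esub> h) z else 0)"
      using f[OF h xz(2)] B f_mult[OF g h xz(2)] l_mult[OF g h xz(2)] by auto
    finally show "(if x = f (g \<otimes>\<^bsub>G\<^esub> h) z then l (g \<otimes>\<^bsub>G\<^esub> h) z else 0)
        = (\<Sum>y\<in>B. (if x = f g y then l g y else 0) * (if y = f h z then l h z else 0))" ..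
  qed
  thus "?\<sigma> (g \<otimes>\<^bsub>G\<^esub> h) = ?\<sigma> g \<otimes>\<^bsub>unitary_group m\<^esub> ?\<sigma> h" by (simp add: unitary_group_def)
qed

text \<open>\<open>shift\<close> is the relation \<open>v * P i = P (i + 1) * v\<close>, with cyclic
  index, read in row \<open>f x\<close> and column \<open>y\<close>. This form avoids the inverse of
  \<open>f\<close>, and every row is reached since \<open>f\<close> is onto.\<close>

lemma kernel_mat_cyclic_tower:
  fixes f :: "'b \<Rightarrow> 'b" and l :: "'b \<Rightarrow> complex" and P :: "nat \<Rightarrow> 'b \<Rightarrow> 'b \<Rightarrow> complex"
  defines "v \<equiv> kernel_mat e m (\<lambda>y x. if y = f x then l x else 0)"
  assumes f: "bij_betw f B B" and v: "v \<in> carrier (unitary_group m)"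
    and herm: "\<And>i x y. i \<in> {1..k} \<Longrightarrow> x \<in> B \<Longrightarrow> y \<in> B \<Longrightarrow> cnj (P i y x) = P i x y"
    and mult: "\<And>i j x z. i \<in> {1..k} \<Longrightarrow> j \<in> {1..k} \<Longrightarrow> x \<in> B \<Longrightarrow> z \<in> B \<Longrightarrow>
       (\<Sum>y\<in>B. P i x y * P j y z) = (if i = j then P i x z else 0)"
    and total: "\<And>x y. x \<in> B \<Longrightarrow> y \<in> B \<Longrightarrow> (\<Sum>i\<in>{1..k}. P i x y) = (if x = y then 1 else 0)"
    and shift: "\<And>i x y. i \<in> {1..k} \<Longrightarrow> x \<in> B \<Longrightarrow> y \<in> B \<Longrightarrow>
       P (if i = k then 1 else i + 1) (f x) (f y) * l y = l x * P i x y"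
  shows "cyclic_tower k m v (\<lambda>i. kernel_mat e m (P i))"
  unfolding cyclic_tower_def
proof (intro conjI ballI allI impI)
  have B: "finite B" using e bij_betw_finite by blast
  fix i assume i: "i \<in> {1..k}"
  show "mat_adjoint (kernel_mat e m (P i)) = kernel_mat e m (P i)"
    unfolding kernel_mat_adjoint by (rule kernel_mat_cong) (rule herm[OF i])
  show "kernel_mat e m (P i) * kernel_mat e m (P i) = kernel_mat e m (P i)"
    unfolding kernel_mat_mult by (rule kernel_mat_cong) (simp add: mult[OF i i])
  show "kernel_mat e m (P i) * kernel_mat e m (P j) = 0\<^sub>m m m" if "j \<in> {1..k}" "i \<noteq> j" for j
  proof -
    have "kernel_mat e m (\<lambda>x z. \<Sum>y\<in>B. P i x y * P j y z) = kernel_mat e m (\<lambda>x z. 0)"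
      by (rule kernel_mat_cong) (simp add: mult[OF i that(1)] that(2))
    also have "\<dots> = 0\<^sub>m m m" by (intro eq_matI) (auto simp: kernel_mat_def)
    finally show ?thesis unfolding kernel_mat_mult .
  qed
  let ?j = "if i = k then 1 else i + 1"
  have "v * kernel_mat e m (P i) = kernel_mat e m (P ?j) * v"
    unfolding v_def kernel_mat_mult
  proof (rule kernel_mat_cong)
    fix y z assume y: "y \<in> B" and z: "z \<in> B"
    obtain x where x: "x \<in> B" "y = f x" using f y by (auto simp: bij_betw_def)
    have inj: "f x = f w \<longleftrightarrow> w = x" if "w \<in> B" for w
      using f that x(1) by (auto simp: bij_betw_def inj_on_def)
    have fz: "f z \<in> B" using f z by (auto simp: bij_betw_def)
    have "(\<Sum>w\<in>B. (if y = f w then l w else 0) * P i w z) = (\<Sum>w\<in>B. if w = x then l x * P i x z else 0)"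
      by (rule sum.cong) (auto simp: x(2) inj)
    also have "\<dots> = l x * P i x z" using B x(1) by simp
    also have "\<dots> = P ?j y (f z) * l z" unfolding x(2) by (rule shift[OF i x(1) z, symmetric])
    also have "\<dots> = (\<Sum>w\<in>B. if w = f z then P ?j y (f z) * l z else 0)" using B fz by simp
    also have "\<dots> = (\<Sum>w\<in>B. P ?j y w * (if w = f z then l z else 0))" by (rule sum.cong) auto
    finally show "(\<Sum>w\<in>B. (if y = f w then l w else 0) * P i w z)
        = (\<Sum>w\<in>B. P ?j y w * (if w = f z then l z else 0))" .
  qed
  moreover have "v \<in> carrier_mat m m" "mat_adjoint v \<in> carrier_mat m m" "v * mat_adjoint v = 1\<^sub>m m"
    using v by (auto simp: unitary_group_def)
  ultimately show "v * kernel_mat e m (P i) * mat_adjoint v = kernel_mat e m (P ?j)"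
    using assoc_mult_mat[of "kernel_mat e m (P ?j)" m m v m "mat_adjoint v" m]
      right_mult_one_mat[OF kernel_mat_carrier, of e m "P ?j"] by simp
next
  fix a b assume ab: "a < m" "b < m"
  hence "e a \<in> B" "e b \<in> B" "e a = e b \<longleftrightarrow> a = b"
    using bij_betwE[OF e] inj_on_eq_iff[OF bij_betw_imp_inj_on[OF e]] by auto
  thus "(\<Sum>i\<in>{1..k}. kernel_mat e m (P i) $$ (a, b)) = (if a = b then 1 else 0)"
    using total[of "e a" "e b"] ab by (simp add: kernel_mat_def)
qed simp

end

section \<open>Cyclically permuted projections over a finite set of cosets\<close>

lemma sum_root_powers:
  fixes \<zeta> :: complex
  assumes "\<zeta> ^ N = 1"
  shows "(\<Sum>n<N. \<zeta> ^ n) = (if \<zeta> = 1 then of_nat N else 0)"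
  using assms by (simp add: geometric_sum)

lemma unit_cnj_mult: "cmod z = 1 \<Longrightarrow> cnj z * z = 1"
  by (simp add: complex_norm_square[symmetric] mult.commute)

text \<open>
  A pair \<open>(x, a)\<close> is a basis vector of $\bigotimes_{y \in S} \mathbb{C}^N$ over the coset \<open>x\<close>. Over \<open>x\<close>, the
  kernel is the projection onto the vector $N^{-1/2} (\alpha(x)^k)_{k<N}$ in the tensor factor \<open>r x\<close>, and
  the identity in the other factors.
\<close>

definition fibre_kernel :: "nat \<Rightarrow> 'x set \<Rightarrow> ('x \<Rightarrow> 'x) \<Rightarrow> ('x \<Rightarrow> complex) \<Rightarrow>
    'x \<times> ('x \<Rightarrow> nat) \<Rightarrow> 'x \<times> ('x \<Rightarrow> nat) \<Rightarrow> complex" where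
  "fibre_kernel N S r \<alpha> = (\<lambda>(x, a) (y, b).
     if x = y \<and> (\<forall>z\<in>S - {r x}. a z = b z) then \<alpha> x ^ a (r x) * cnj (\<alpha> x ^ b (r x)) / of_nat N else 0)"

lemma fibre_kernel_hermitian: "cnj (fibre_kernel N S r \<alpha> v u) = fibre_kernel N S r \<alpha> u v"
  by (cases u; cases v) (auto simp: fibre_kernel_def mult.commute)

context
  fixes S :: "'x set" and N :: nat and r :: "'x \<Rightarrow> 'x" and \<omega> :: complex and \<psi> :: "'x \<Rightarrow> complex"
  assumes S: "finite S" and N: "N > 0" and r: "\<And>x. x \<in> S \<Longrightarrow> r x \<in> S"
    and \<omega>: "cmod \<omega> = 1" "\<omega> ^ N = 1" "inj_on (\<lambda>n. \<omega> ^ n) {..<N}"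
    and \<psi>: "\<And>x. x \<in> S \<Longrightarrow> cmod (\<psi> x) = 1"
begin

private abbreviation "B \<equiv> S \<times> (S \<rightarrow>\<^sub>E {..<N})"
private abbreviation "P i \<equiv> fibre_kernel N S r (\<lambda>x. \<omega> ^ i * \<psi> x)"

text \<open>The ratio of two powers of \<open>\<omega>\<close>: it is the ratio of the geometric
  sums in the next two lemmas.\<close>

private lemma root_quotient:
  "(cnj (\<omega> ^ a) * \<omega> ^ b) ^ N = 1" "cnj (\<omega> ^ a) * \<omega> ^ b = 1 \<longleftrightarrow> \<omega> ^ a = \<omega> ^ b"
proof -
  have "(\<omega> ^ a) ^ N = 1" for a using \<omega>(2) by (metis mult.commute power_mult power_one)
  thus "(cnj (\<omega> ^ a) * \<omega> ^ b) ^ N = 1" 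
    by (simp add: power_mult_distrib flip: complex_cnj_power)
  have "cmod (\<omega> ^ a) = 1" by (simp add: norm_power \<omega>(1))
  hence 1: "cnj (\<omega> ^ a) * \<omega> ^ a = 1" by (rule unit_cnj_mult)
  hence "cnj (\<omega> ^ a) \<noteq> 0" by (metis mult_zero_left zero_neq_one)
  thus "cnj (\<omega> ^ a) * \<omega> ^ b = 1 \<longleftrightarrow> \<omega> ^ a = \<omega> ^ b" using 1 by (metis mult_left_cancel)
qed

text \<open>As a function of \<open>i\<close>, the entry of \<open>P i\<close> is a constant times
  \<open>\<zeta> ^ i\<close>, where \<open>\<zeta>\<close> compares the labels of \<open>u\<close>
  and \<open>v\<close> in the factor \<open>r x\<close>. Summing over all \<open>i\<close> leaves
  only equal labels.\<close>

lemma fibre_kernel_total: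
  assumes "u \<in> B" "v \<in> B"
  shows "(\<Sum>i\<in>{1..N}. P i u v) = (if u = v then 1 else 0)"
proof -
  obtain x a y b where uv: "u = (x, a)" "v = (y, b)" by (metis surj_pair)
  show ?thesis
  proof (cases "x = y \<and> (\<forall>z\<in>S - {r x}. a z = b z)")
    case False
    hence "P i u v = 0" for i by (auto simp: fibre_kernel_def uv)
    moreover have "u \<noteq> v" using False by (auto simp: uv)
    ultimately show ?thesis by simp
  next
    case True
    have x: "x \<in> S" "a (r x) < N" "b (r x) < N" using assms r True by (auto simp: uv PiE_iff)
    have ab: "a = b \<longleftrightarrow> a (r x) = b (r x)"
    proof
      assume e: "a (r x) = b (r x)"
      show "a = b" using assms True e by (intro PiE_ext[of a S "\<lambda>_. {..<N}" b]) (auto simp: uv)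
    qed simp
    define \<zeta> where "\<zeta> = cnj (\<omega> ^ b (r x)) * \<omega> ^ a (r x)"
    have \<zeta>: "\<zeta> ^ N = 1" "\<zeta> = 1 \<longleftrightarrow> a = b"
      unfolding \<zeta>_def root_quotient ab using x inj_on_eq_iff[OF \<omega>(3)] by auto
    define C where "C = \<psi> x ^ a (r x) * cnj (\<psi> x ^ b (r x)) / of_nat N"
    have "P i u v = C * \<zeta> ^ i" for i
      using True by (simp add: fibre_kernel_def uv C_def \<zeta>_def power_mult_distrib power_mult[symmetric] mult_ac)
    hence "(\<Sum>i\<in>{1..N}. P i u v) = C * (\<Sum>i\<in>{1..N}. \<zeta> ^ i)" by (simp add: sum_distrib_left)
    \<comment> \<open>Starting the sum at 0 costs a factor \<open>\<zeta>\<close>, which is 1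
      whenever the sum is nonzero.\<close>
    also have "(\<Sum>i\<in>{1..N}. \<zeta> ^ i) = (\<Sum>i<N. \<zeta> ^ Suc i)"
      by (rule sum.reindex_bij_witness[of _ Suc "\<lambda>i. i - 1"]) auto
    also have "\<dots> = \<zeta> * (\<Sum>i<N. \<zeta> ^ i)" by (simp add: sum_distrib_left)
    also have "\<dots> = (if a = b then of_nat N else 0)" unfolding sum_root_powers[OF \<zeta>(1)] \<zeta>(2) using \<zeta>(2) by auto
    finally have "(\<Sum>i\<in>{1..N}. P i u v) = C * (if a = b then of_nat N else 0)" .
    moreover have "C * of_nat N = 1" if "a = b"
    proof -
      have "cmod (\<psi> x ^ a (r x)) = 1" by (simp add: norm_power \<psi>[OF x(1)])
      from unit_cnj_mult[OF this] show ?thesis using that N by (simp add: C_def mult.commute)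
    qed
    ultimately show ?thesis using True by (simp add: uv)
  qed
qed

text \<open>The vectors defining \<open>P i\<close> and \<open>P j\<close> over one coset are
  orthonormal: their inner product is \<open>1 / N\<close> times the geometric sum with ratio
  \<open>\<omega> ^ j / \<omega> ^ i\<close>.\<close>

lemma fibre_kernel_mult:
  assumes u: "u \<in> B" and v: "v \<in> B" and ij: "i \<in> {1..N}" "j \<in> {1..N}"
  shows "(\<Sum>w\<in>B. P i u w * P j w v) = (if i = j then P i u v else 0)"
proof -
  obtain x a y b where uv: "u = (x, a)" "v = (y, b)" by (metis surj_pair)
  have B: "finite B" using S by (intro finite_cartesian_product finite_PiE) auto
  have x: "x \<in> S" "a \<in> S \<rightarrow>\<^sub>E {..<N}" using u by (auto simp: uv)
  show ?thesis
  proof (cases "x = y \<and> (\<forall>z\<in>S - {r x}. a z = b z)")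
    case False
    hence "P i u w * P j w v = 0" for w by (cases w) (auto simp: fibre_kernel_def uv)
    moreover have "P i u v = 0" using False by (auto simp: fibre_kernel_def uv)
    ultimately show ?thesis by auto
  next
    case True
    \<comment> \<open>The intermediate basis vectors that can contribute: both kernels fix all
      labels except the one in the factor \<open>r x\<close>.\<close>
    define D where "D = (\<lambda>n. (x, a(r x := n))) ` {..<N}"
    have D: "D \<subseteq> B" using x r[OF x(1)] by (auto simp: D_def PiE_iff extensional_def)
    define \<zeta> where "\<zeta> = cnj (\<omega> ^ i) * \<omega> ^ j"
    define C where "C = (\<omega> ^ i * \<psi> x) ^ a (r x) * cnj ((\<omega> ^ j * \<psi> x) ^ b (r x)) / of_nat N"
    \<comment> \<open>Indices run from 1 to \<open>N\<close>, whereas injectivity is assumed on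
      \<open>{..<N}\<close>; one factor \<open>\<omega>\<close> is cancelled to pass between the
      two.\<close>
    have "\<omega> ^ i = \<omega> ^ j \<longleftrightarrow> i = j"
    proof
      assume "\<omega> ^ i = \<omega> ^ j"
      hence "\<omega> * \<omega> ^ (i - 1) = \<omega> * \<omega> ^ (j - 1)" using ij by (simp flip: power_Suc)
      hence "\<omega> ^ (i - 1) = \<omega> ^ (j - 1)" using \<omega>(1) by auto
      hence "i - 1 = j - 1" using inj_on_eq_iff[OF \<omega>(3), of "i - 1" "j - 1"] ij N by auto
      thus "i = j" using ij by auto
    qed simp
    hence \<zeta>: "\<zeta> ^ N = 1" "\<zeta> = 1 \<longleftrightarrow> i = j" unfolding \<zeta>_def root_quotient by simp_all
    have \<psi>x: "cnj (\<omega> ^ i * \<psi> x) * (\<omega> ^ j * \<psi> x) = \<zeta>"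
    proof -
      have "cnj (\<omega> ^ i * \<psi> x) * (\<omega> ^ j * \<psi> x) = \<zeta> * (cnj (\<psi> x) * \<psi> x)" by (simp add: \<zeta>_def mult_ac)
      thus ?thesis by (simp add: unit_cnj_mult[OF \<psi>[OF x(1)]])
    qed
    have "(\<Sum>w\<in>B. P i u w * P j w v) = (\<Sum>w\<in>D. P i u w * P j w v)"
    proof (rule sum.mono_neutral_right[OF B D], rule ballI)
      fix w assume w: "w \<in> B - D"
      obtain z c where zc: "w = (z, c)" by (metis surj_pair)
      have "P i u w = 0"
      proof (rule ccontr)
        assume "P i u w \<noteq> 0"
        hence *: "z = x" "\<forall>z\<in>S - {r x}. a z = c z" by (auto simp: fibre_kernel_def uv zc split: if_splits)
        have "c = a(r x := c (r x))"
        proof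
          fix z' show "c z' = (a(r x := c (r x))) z'"
            using w x *(2) by (cases "z' \<in> S") (auto simp: zc PiE_iff extensional_def)
        qed
        moreover have "c (r x) < N" using w r[OF x(1)] by (auto simp: zc PiE_iff)
        ultimately have "w \<in> D" unfolding D_def zc *(1) by blast
        thus False using w by simp
      qed
      thus "P i u w * P j w v = 0" by simp
    qed
    also have "\<dots> = (\<Sum>n<N. P i u (x, a(r x := n)) * P j (x, a(r x := n)) v)"
      unfolding D_def by (subst sum.reindex) (auto simp: inj_on_def fun_upd_eqD o_def)
    also have "\<dots> = (\<Sum>n<N. C / of_nat N * \<zeta> ^ n)"
    proof (rule sum.cong[OF refl])
      fix n
      have "P i u (x, a(r x := n)) * P j (x, a(r x := n)) v =
         C / of_nat N * (cnj (\<omega> ^ i * \<psi> x) * (\<omega> ^ j * \<psi> x)) ^ n"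
        using True by (simp add: fibre_kernel_def uv C_def power_mult_distrib)
      thus "P i u (x, a(r x := n)) * P j (x, a(r x := n)) v = C / of_nat N * \<zeta> ^ n" unfolding \<psi>x .
    qed
    also have "\<dots> = C / of_nat N * (\<Sum>n<N. \<zeta> ^ n)" by (simp only: sum_distrib_left)
    also have "\<dots> = (if i = j then C else 0)" unfolding sum_root_powers[OF \<zeta>(1)] \<zeta>(2) using N by simp
    also have "\<dots> = (if i = j then P i u v else 0)" using True by (auto simp: fibre_kernel_def uv C_def)
    finally show ?thesis .
  qed
qed

text \<open>In the factor \<open>r x\<close>, which \<open>x\<close> and \<open>act x\<close> share,
  \<open>l\<close> multiplies label \<open>n\<close> by \<open>Q ^ n\<close> and so turns the vector
  of powers of \<open>\<alpha>\<close> into that of \<open>Q * \<alpha>\<close>. By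
  \<open>\<psi>_act\<close> this belongs to the next index over \<open>act x\<close>. The scalars of
  the other factors agree on both sides, as the labels there agree.\<close>

lemma fibre_kernel_shift:
  fixes q :: "'x \<Rightarrow> 'x \<Rightarrow> complex"
  assumes act: "inj_on act S"
    and r_act: "\<And>x. x \<in> S \<Longrightarrow> r (act x) = r x"
    and \<psi>_act: "\<And>x. x \<in> S \<Longrightarrow> \<psi> (act x) = inverse \<omega> * q (r x) x * \<psi> x"
    and q: "\<And>x y. x \<in> S \<Longrightarrow> y \<in> S \<Longrightarrow> cmod (q y x) = 1"
    and u: "u \<in> B" and v: "v \<in> B"
  defines "f \<equiv> map_prod act id" and "l \<equiv> \<lambda>(x, a). \<Prod>y\<in>S. q y x ^ a y"
  shows "P (if i = N then 1 else i + 1) (f u) (f v) * l v = l u * P i u v"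
proof -
  obtain x a y b where uv: "u = (x, a)" "v = (y, b)" by (metis surj_pair)
  have xy: "x \<in> S" "y \<in> S" using u v by (auto simp: uv)
  show ?thesis
  proof (cases "x = y \<and> (\<forall>z\<in>S - {r x}. a z = b z)")
    case False
    thus ?thesis using r_act[OF xy(1)] inj_on_eq_iff[OF act xy]
      by (auto simp: fibre_kernel_def uv f_def)
  next
    case True
    define \<alpha> Q where "\<alpha> = \<omega> ^ i * \<psi> x" and "Q = q (r x) x"
    \<comment> \<open>At \<open>i = N\<close> the index wraps to 1, which is again multiplication by
      \<open>\<omega>\<close> because \<open>\<omega> ^ N = 1\<close>.\<close>
    have "\<omega> ^ (if i = N then 1 else i + 1) = \<omega> * \<omega> ^ i" using \<omega>(2) by auto
    hence \<alpha>': "\<omega> ^ (if i = N then 1 else i + 1) * \<psi> (act x) = Q * \<alpha>"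
      using \<omega>(1) unfolding \<psi>_act[OF xy(1)] by (auto simp: \<alpha>_def Q_def field_simps)
    have split: "l (x, c) = Q ^ c (r x) * (\<Prod>y\<in>S - {r x}. q y x ^ c y)" for c
      unfolding l_def Q_def using prod.remove[OF S r[OF xy(1)]] by simp
    define K where "K = (\<Prod>y\<in>S - {r x}. q y x ^ a y)"
    have K: "(\<Prod>y\<in>S - {r x}. q y x ^ b y) = K"
      unfolding K_def using True by (intro prod.cong) auto
    have "cmod (Q ^ b (r x)) = 1" using q[OF xy(1) r[OF xy(1)]] by (simp add: Q_def norm_power)
    hence Q1: "cnj (Q ^ b (r x)) * Q ^ b (r x) = 1" by (rule unit_cnj_mult)
    have yx: "y = x" and off: "\<forall>z\<in>S - {r x}. a z = b z" using True by auto
    have "P (if i = N then 1 else i + 1) (f u) (f v) = (Q * \<alpha>) ^ a (r x) * cnj ((Q * \<alpha>) ^ b (r x)) / of_nat N"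
      unfolding uv f_def yx map_prod_simp id_apply fibre_kernel_def prod.case r_act[OF xy(1)] \<alpha>' using off by simp
    moreover have "l v = Q ^ b (r x) * K" unfolding uv yx split K ..
    ultimately have "P (if i = N then 1 else i + 1) (f u) (f v) * l v
        = (Q * \<alpha>) ^ a (r x) * cnj ((Q * \<alpha>) ^ b (r x)) / of_nat N * (Q ^ b (r x) * K)" by (simp only:)
    also have "\<dots> = Q ^ a (r x) * \<alpha> ^ a (r x) * cnj (\<alpha> ^ b (r x)) * K / of_nat N * (cnj (Q ^ b (r x)) * Q ^ b (r x))"
      by (simp add: power_mult_distrib mult_ac)
    also have "\<dots> = (Q ^ a (r x) * K) * (\<alpha> ^ a (r x) * cnj (\<alpha> ^ b (r x)) / of_nat N)"
      unfolding Q1 by simp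
    also have "Q ^ a (r x) * K = l u" unfolding uv split K_def ..
    also have "\<alpha> ^ a (r x) * cnj (\<alpha> ^ b (r x)) / of_nat N = P i u v"
      unfolding uv yx fibre_kernel_def prod.case \<alpha>_def using off yx by simp
    finally show ?thesis .
  qed
qed

end

section \<open>Cosets, and characters prescribed on stabilisers\<close>

lemma (in group) inv_mult_cancel_left:
  "x \<in> carrier G \<Longrightarrow> y \<in> carrier G \<Longrightarrow> inv x \<otimes> (x \<otimes> y) = y"
  "x \<in> carrier G \<Longrightarrow> y \<in> carrier G \<Longrightarrow> x \<otimes> (inv x \<otimes> y) = y"
  by (simp_all add: m_assoc[symmetric])

text \<open>The image of \<open>t\<close> stands for the coset space inside the group. As
  \<open>t a\<close> is chosen from the set \<open>H #> a\<close> alone, equal cosets get equal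
  representatives.\<close>

lemma (in group) coset_representatives:
  assumes H: "subgroup H G" and fin: "finite (rcosets H)"
  obtains t where "finite (t ` carrier G)"
    and "\<And>a. a \<in> carrier G \<Longrightarrow> t a \<in> carrier G"
    and "\<And>a. a \<in> carrier G \<Longrightarrow> a \<otimes> inv (t a) \<in> H"
    and "\<And>a b. a \<in> carrier G \<Longrightarrow> b \<in> carrier G \<Longrightarrow> a \<otimes> inv b \<in> H \<Longrightarrow> t a = t b"
proof
  define t where "t = (\<lambda>a. SOME b. b \<in> H #> a)"
  have t: "t a \<in> H #> a" if "a \<in> carrier G" for a
    unfolding t_def using rcos_self[OF that H] by (rule someI)
  have sub: "H \<subseteq> carrier G" using H by (rule subgroup.subset)
  have "t ` carrier G \<subseteq> (\<lambda>C. SOME b. b \<in> C) ` (rcosets H)"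
    by (auto simp: t_def RCOSETS_def)
  thus "finite (t ` carrier G)" using fin by (meson finite_imageI finite_subset)
  show tc: "t a \<in> carrier G" if "a \<in> carrier G" for a
    using t[OF that] that r_coset_subset_G[OF sub that] by blast
  show "a \<otimes> inv (t a) \<in> H" if a: "a \<in> carrier G" for a
  proof -
    obtain h where h: "h \<in> H" "t a = h \<otimes> a" using t[OF a] by (auto simp: r_coset_def)
    hence "a \<otimes> inv (t a) = inv h" using sub a by (simp add: inv_mult_group inv_mult_cancel_left subset_iff)
    thus ?thesis using h subgroup.m_inv_closed[OF H] by simp
  qed
  show "t a = t b" if a: "a \<in> carrier G" and b: "b \<in> carrier G" and ab: "a \<otimes> inv b \<in> H" for a b
  proof -
    have "(a \<otimes> inv b) \<otimes> b \<in> H #> b" using ab by (auto simp: r_coset_def)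
    hence "a \<in> H #> b" using a b by (simp add: m_assoc)
    hence "H #> b = H #> a" by (rule repr_independence[OF _ b H])
    thus ?thesis by (simp add: t_def)
  qed
qed

text \<open>The condition \<open>y \<otimes> g [^] (- i) \<otimes> inv y \<in> H\<close> says that \<open>g [^] i\<close> fixes the coset \<open>H #> y\<close>.\<close>

lemma (in group) character_of_stabiliser:
  assumes H: "subgroup H G" and comm: "comm_group (G\<lparr>carrier := H\<rparr>)"
    and g: "g \<in> carrier G" and y: "y \<in> carrier G" and \<omega>: "cmod \<omega> = 1"
    and ord: "\<And>i :: int. g [^] i = \<one> \<Longrightarrow> \<omega> powi i = 1"
  shows "\<exists>\<chi>. character (G\<lparr>carrier := H\<rparr>) \<chi> \<and>
    (\<forall>i :: int. y \<otimes> g [^] (- i) \<otimes> inv y \<in> H \<longrightarrow> \<chi> (y \<otimes> g [^] (- i) \<otimes> inv y) = \<omega> powi i)"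
proof -
  \<comment> \<open>The minus sign is there because \<open>g\<close> acts on the cosets
    \<open>H #> y\<close> by right multiplication with \<open>inv g\<close>.\<close>
  define k where "k = (\<lambda>i :: int. y \<otimes> g [^] (- i) \<otimes> inv y)"
  \<comment> \<open>The \<open>k i\<close> that lie in \<open>H\<close> form a subgroup of
    \<open>H\<close>; the prescribed values on it are extended to \<open>H\<close>.\<close>
  define R where "R = {(k i, \<omega> powi i) | i. k i \<in> H}"
  have k0: "k 0 = \<one>" using y by (simp add: k_def)
  have kadd: "k i \<otimes> k j = k (i + j)" for i j
  proof -
    have "g [^] (- (i + j)) = g [^] (- i) \<otimes> g [^] (- j)" using g by (simp add: int_pow_mult[symmetric])
    thus ?thesis using g y by (simp add: k_def m_assoc inv_mult_cancel_left)
  qed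
  have kc: "k i \<in> carrier G" for i using g y by (simp add: k_def)
  have kneg: "inv (k i) = k (- i)" for i
    using kadd[of "- i" i] k0 kc by (simp add: inv_equality)
  \<comment> \<open>Here the assumption relating \<open>\<omega>\<close> to the order of
    \<open>g\<close> enters: it makes the values on \<open>R\<close> well defined.\<close>
  have kone: "\<omega> powi i = 1" if "k i = \<one>" for i
  proof -
    have "inv y \<otimes> (k i \<otimes> y) = g [^] (- i)" unfolding k_def using g y by (simp add: m_assoc inv_mult_cancel_left)
    hence "g [^] (- i) = \<one>" using that y by simp
    hence "\<omega> powi (- i) = 1" by (rule ord)
    thus ?thesis by (simp add: power_int_minus)
  qed
  have \<omega>0: "\<omega> \<noteq> 0" using \<omega> by auto
  have "partial_character (G\<lparr>carrier := H\<rparr>) R"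
    unfolding partial_character_def
  proof (intro conjI ballI allI impI; (clarify)?)
    have "k 0 \<in> H" unfolding k0 by (rule subgroup.one_closed[OF H])
    hence "(k 0, \<omega> powi 0) \<in> R" unfolding R_def by blast
    thus "(\<one>\<^bsub>G\<lparr>carrier := H\<rparr>\<^esub>, 1) \<in> R" by (simp add: k0)
  next
    fix a z assume "(a, z) \<in> R"
    then obtain i where i: "a = k i" "z = \<omega> powi i" "k i \<in> H" by (auto simp: R_def)
    have "k (- i) \<in> H" using subgroup.m_inv_closed[OF H i(3)] by (simp add: kneg)
    hence "(k (- i), \<omega> powi (- i)) \<in> R" unfolding R_def by blast
    moreover have "inv\<^bsub>G\<lparr>carrier := H\<rparr>\<^esub> a = k (- i)" using m_inv_consistent[OF H] i by (simp add: kneg)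
    ultimately show "a \<in> carrier (G\<lparr>carrier := H\<rparr>) \<and> cmod z = 1 \<and> (inv\<^bsub>G\<lparr>carrier := H\<rparr>\<^esub> a, inverse z) \<in> R"
      using i by (simp add: power_int_minus norm_power_int \<omega>)
  next
    fix a z b w assume "(a, z) \<in> R" "(b, w) \<in> R"
    then obtain i j where i: "a = k i" "z = \<omega> powi i" "k i \<in> H" and j: "b = k j" "w = \<omega> powi j" "k j \<in> H"
      unfolding R_def by blast
    have "k (i + j) \<in> H" using subgroup.m_closed[OF H i(3) j(3)] by (simp add: kadd)
    hence "(k (i + j), \<omega> powi (i + j)) \<in> R" unfolding R_def by blast
    thus "(a \<otimes>\<^bsub>G\<lparr>carrier := H\<rparr>\<^esub> b, z * w) \<in> R" using i j \<omega>0 by (simp add: kadd power_int_add)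
  next
    fix z assume "(\<one>\<^bsub>G\<lparr>carrier := H\<rparr>\<^esub>, z) \<in> R"
    thus "z = 1" using kone by (auto simp: R_def)
  qed
  from comm_group.partial_character_extension[OF comm this]
  obtain \<chi> where \<chi>: "character (G\<lparr>carrier := H\<rparr>) \<chi>" "\<forall>(a, z)\<in>R. \<chi> a = z" by blast
  have "\<chi> (k i) = \<omega> powi i" if "k i \<in> H" for i
  proof -
    have "(k i, \<omega> powi i) \<in> R" using that unfolding R_def by blast
    thus ?thesis using \<chi>(2) by auto
  qed
  thus ?thesis using \<chi>(1) unfolding k_def by blast
qed

section \<open>Orbits of one element on the cosets, and the induced representation\<close>

lemma characterD:
  assumes "character G \<chi>"
  shows "a \<in> carrier G \<Longrightarrow> cmod (\<chi> a) = 1"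
    and "a \<in> carrier G \<Longrightarrow> b \<in> carrier G \<Longrightarrow> \<chi> (a \<otimes>\<^bsub>G\<^esub> b) = \<chi> a * \<chi> b"
  using assms by (auto simp: character_def)

text \<open>
  The matrix of \<open>g\<close> is a cocycle times the permutation of the cosets of \<open>H\<close>, so that an orbit of \<open>g\<close> on
  the cosets may close up with a nontrivial phase. The characters \<open>\<chi>\<close> are chosen such that the total phase
  around an orbit of length \<open>l\<close> is \<open>\<omega> ^ l\<close>; hence it is \<open>\<omega>\<close> times the coboundary of \<open>\<psi>\<close>.
\<close>

lemma (in group) cocycle_trivialisation:
  fixes \<omega> :: complex and t :: "'a \<Rightarrow> 'a"
  assumes H: "subgroup H G" and g: "g \<in> carrier G" and \<omega>: "cmod \<omega> = 1"
    and t: "\<And>a. a \<in> carrier G \<Longrightarrow> t a \<in> carrier G" "\<And>a. a \<in> carrier G \<Longrightarrow> a \<otimes> inv (t a) \<in> H"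
    and \<chi>: "\<And>y. y \<in> carrier G \<Longrightarrow> character (G\<lparr>carrier := H\<rparr>) (\<chi> y)"
    and \<chi>g: "\<And>y (i :: int). y \<in> carrier G \<Longrightarrow> y \<otimes> g [^] (- i) \<otimes> inv y \<in> H \<Longrightarrow>
        \<chi> y (y \<otimes> g [^] (- i) \<otimes> inv y) = \<omega> powi i"
  defines "S \<equiv> t ` carrier G"
  obtains r \<psi> where "\<And>x. x \<in> S \<Longrightarrow> r x \<in> S" "\<And>x. x \<in> S \<Longrightarrow> r (t (x \<otimes> inv g)) = r x"
    and "\<And>x. x \<in> S \<Longrightarrow> cmod (\<psi> x) = 1"
    and "\<And>x. x \<in> S \<Longrightarrow> \<psi> (t (x \<otimes> inv g)) = inverse \<omega> * \<chi> (r x) (x \<otimes> inv g \<otimes> inv (t (x \<otimes> inv g))) * \<psi> x"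
proof -
  have \<omega>0: "\<omega> \<noteq> 0" using \<omega> by auto
  have SG: "x \<in> carrier G" if "x \<in> S" for x using that t(1) by (auto simp: S_def)
  have HG: "a \<in> carrier G" if "a \<in> H" for a using that subgroup.subset[OF H] by blast
  \<comment> \<open>\<open>k y i x \<in> H\<close> means that \<open>g [^] i\<close> moves the coset
    of \<open>y\<close> to that of \<open>x\<close>; the element is then the cocycle of this
    move.\<close>
  define k where "k = (\<lambda>y (i :: int) x. y \<otimes> g [^] (- i) \<otimes> inv x)"
  have kG: "k y i x \<in> carrier G" if "x \<in> carrier G" "y \<in> carrier G" for x y i
    using that g by (simp add: k_def)
  have gadd: "g [^] (- (i + j)) = g [^] (- i) \<otimes> g [^] (- j)" for i j :: int
    using g by (simp add: int_pow_mult[symmetric])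
  \<comment> \<open>\<open>P x\<close> describes the orbit of \<open>x\<close> under
    \<open>g\<close>. As \<open>r\<close> chooses from this predicate alone, it is a base point
    common to the whole orbit.\<close>
  define P where "P = (\<lambda>x y. y \<in> S \<and> (\<exists>i. k y i x \<in> H))"
  define r where "r = (\<lambda>x. SOME y. P x y)"
  have "P x x" if "x \<in> S" for x
    unfolding P_def using that SG[OF that] subgroup.one_closed[OF H] by (auto simp: k_def intro!: exI[of _ 0])
  hence r: "P x (r x)" if "x \<in> S" for x unfolding r_def using that by (metis someI)
  define j where "j = (\<lambda>x. SOME i. k (r x) i x \<in> H)"
  have j: "k (r x) (j x) x \<in> H" if "x \<in> S" for x
    using r[OF that] unfolding P_def j_def by (meson someI_ex)
  \<comment> \<open>The phase collected on the way from the base point \<open>r x\<close> to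
    \<open>x\<close>, divided by \<open>\<omega>\<close> once for each step.\<close>
  define \<psi> where "\<psi> = (\<lambda>x. \<omega> powi (- j x) * \<chi> (r x) (k (r x) (j x) x))"
  have rS: "r x \<in> S" if "x \<in> S" for x using r[OF that] by (simp add: P_def)
  note rG = SG[OF rS]
  have \<chi>1: "cmod (\<chi> y a) = 1" if "y \<in> carrier G" "a \<in> H" for y a
    using characterD(1)[OF \<chi>[OF that(1)]] that(2) by simp
  have \<chi>m: "\<chi> y (a \<otimes> b) = \<chi> y a * \<chi> y b" if "y \<in> carrier G" "a \<in> H" "b \<in> H" for y a b
    using characterD(2)[OF \<chi>[OF that(1)]] that(2,3) by simp
  \<comment> \<open>Two exponents leading from \<open>r x\<close> to \<open>x\<close> differ by a
    stabiliser of the base point, where \<open>\<chi>g\<close> prescribes exactly the power of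
    \<open>\<omega>\<close> that compensates the difference.\<close>
  have indep: "\<omega> powi (- i) * \<chi> (r x) (k (r x) i x) = \<psi> x" if x: "x \<in> S" and i: "k (r x) i x \<in> H" for x i
  proof -
    define y where "y = r x"
    have y: "y \<in> carrier G" "x \<in> carrier G" using rG[OF x] SG[OF x] by (auto simp: y_def)
    have e: "k y (i - j x) y \<otimes> k y (j x) x = k y i x"
      using y g gadd[of "i - j x" "j x"] by (simp add: k_def m_assoc inv_mult_cancel_left)
    have "k y (i - j x) y = k y i x \<otimes> inv (k y (j x) x)"
      unfolding e[symmetric] using y g by (simp add: k_def m_assoc)
    moreover have "inv (k y (j x) x) \<in> H" using subgroup.m_inv_closed[OF H j[OF x]] by (simp add: y_def)
    ultimately have kH: "k y (i - j x) y \<in> H" using subgroup.m_closed[OF H i[folded y_def]] by simp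
    hence "\<chi> y (k y (i - j x) y) = \<omega> powi (i - j x)"
      unfolding k_def by (rule \<chi>g[OF y(1)])
    hence "\<chi> y (k y i x) = \<omega> powi (i - j x) * \<chi> y (k y (j x) x)"
      unfolding e[symmetric] \<chi>m[OF y(1) kH j[OF x, folded y_def]] by simp
    thus ?thesis unfolding \<psi>_def y_def[symmetric]
      using \<omega>0 by (simp add: power_int_diff power_int_minus field_simps)
  qed
  show thesis
  proof (rule that[of r \<psi>])
    fix x assume x: "x \<in> S"
    note xG = SG[OF x]
    define x' where "x' = t (x \<otimes> inv g)"
    have x'S: "x' \<in> S" using xG g by (auto simp: x'_def S_def)
    note x'G = SG[OF x'S]
    define c where "c = x \<otimes> inv g \<otimes> inv x'"
    have c: "c \<in> H" using t(2)[of "x \<otimes> inv g"] xG g by (simp add: c_def x'_def)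
    have step: "k y (i + 1) x' = k y i x \<otimes> c" if "y \<in> carrier G" for y i
    proof -
      have "g [^] (- (i + 1)) = g [^] (- i) \<otimes> inv g" unfolding gadd using g by (simp add: int_pow_neg int_pow_1)
      thus ?thesis using that g xG x'G by (simp add: k_def c_def m_assoc inv_mult_cancel_left)
    qed
    have "P x' y \<longleftrightarrow> P x y" for y
    proof -
      have "(\<exists>i. k y i x' \<in> H) \<longleftrightarrow> (\<exists>i. k y i x \<in> H)" if y: "y \<in> S"
      proof
        assume "\<exists>i. k y i x' \<in> H"
        then obtain i where "k y i x' \<in> H" by blast
        hence "k y (i - 1) x \<otimes> c \<in> H" using step[OF SG[OF y], of "i - 1"] by simp
        hence "(k y (i - 1) x \<otimes> c) \<otimes> inv c \<in> H"
          by (rule subgroup.m_closed[OF H _ subgroup.m_inv_closed[OF H c]])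
        hence "k y (i - 1) x \<in> H" using kG[OF xG SG[OF y]] HG[OF c] by (simp add: m_assoc)
        thus "\<exists>i. k y i x \<in> H" ..
      next
        assume "\<exists>i. k y i x \<in> H"
        then obtain i where "k y i x \<in> H" by blast
        hence "k y (i + 1) x' \<in> H" using step[OF SG[OF y]] subgroup.m_closed[OF H _ c] by simp
        thus "\<exists>i. k y i x' \<in> H" ..
      qed
      thus ?thesis unfolding P_def by blast
    qed
    hence "P x' = P x" by (rule ext)
    hence rx': "r x' = r x" by (simp add: r_def)
    show "r (t (x \<otimes> inv g)) = r x" using rx' unfolding x'_def .
    show "r x \<in> S" by (rule rS[OF x])
    show "cmod (\<psi> x) = 1" unfolding \<psi>_def using \<chi>1[OF rG[OF x] j[OF x]] \<omega> by (simp add: norm_mult norm_power_int)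
    have s: "k (r x) (j x + 1) x' = k (r x) (j x) x \<otimes> c" by (rule step[OF rG[OF x]])
    have "k (r x) (j x + 1) x' \<in> H" unfolding s by (rule subgroup.m_closed[OF H j[OF x] c])
    \<comment> \<open>Independence allows the exponent \<open>j x + 1\<close> at \<open>x'\<close>
      instead of the arbitrarily chosen \<open>j x'\<close>.\<close>
    from indep[OF x'S, unfolded rx', OF this]
    have "\<psi> x' = \<omega> powi (- (j x + 1)) * (\<chi> (r x) (k (r x) (j x) x) * \<chi> (r x) c)"
      unfolding s \<chi>m[OF rG[OF x] j[OF x] c] ..
    also have "\<dots> = inverse \<omega> * \<chi> (r x) c * \<psi> x"
    proof -
      have "\<omega> powi (- (j x + 1)) = inverse \<omega> * \<omega> powi (- j x)"
        using power_int_add[of \<omega> "- 1" "- j x"] \<omega>0 by (simp add: algebra_simps)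
      thus ?thesis by (simp add: \<psi>_def)
    qed
    finally show "\<psi> (t (x \<otimes> inv g)) = inverse \<omega> * \<chi> (r x) (x \<otimes> inv g \<otimes> inv (t (x \<otimes> inv g))) * \<psi> x"
      unfolding c_def x'_def .
  qed
qed

text \<open>The assumption \<open>ord\<close> says that \<open>N\<close> divides every
  \<open>i\<close> with \<open>g [^] i = \<one>\<close>, so a character may take a primitive
  \<open>N\<close>-th root of unity as its value at \<open>g\<close>. The induced representation is
  monomial, and \<open>\<psi>\<close> corrects its phases along the orbits of
  \<open>g\<close>.\<close>

lemma (in group) representation_with_tower:
  assumes H: "subgroup H G" and comm: "comm_group (G\<lparr>carrier := H\<rparr>)" and fin: "finite (rcosets H)"
    and g: "g \<in> carrier G" and N: "N > 0"
    and ord: "\<And>i :: int. g [^] i = \<one> \<Longrightarrow> cis (2 * pi / real N) powi i = 1"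
  shows "\<exists>m>0. \<exists>\<sigma>\<in>hom G (unitary_group m). \<exists>p. cyclic_tower N m (\<sigma> g) p"
proof -
  define \<omega> where "\<omega> = cis (2 * pi / real N)"
  have pow: "\<omega> ^ n = cis (2 * pi * real n / real N)" for n
    unfolding \<omega>_def DeMoivre by (simp add: mult_ac)
  have \<omega>: "cmod \<omega> = 1" "\<omega> ^ N = 1" "inj_on (\<lambda>n. \<omega> ^ n) {..<N}"
    using N bij_betw_imp_inj_on[OF bij_betw_roots_unity[OF N]] by (simp_all add: pow) (simp add: \<omega>_def)
  obtain t where S: "finite (t ` carrier G)"
    and t: "\<And>a. a \<in> carrier G \<Longrightarrow> t a \<in> carrier G" "\<And>a. a \<in> carrier G \<Longrightarrow> a \<otimes> inv (t a) \<in> H"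
      "\<And>a b. a \<in> carrier G \<Longrightarrow> b \<in> carrier G \<Longrightarrow> a \<otimes> inv b \<in> H \<Longrightarrow> t a = t b"
    using coset_representatives[OF H fin] by blast
  have "\<forall>y\<in>carrier G. \<exists>\<chi>. character (G\<lparr>carrier := H\<rparr>) \<chi> \<and>
    (\<forall>i :: int. y \<otimes> g [^] (- i) \<otimes> inv y \<in> H \<longrightarrow> \<chi> (y \<otimes> g [^] (- i) \<otimes> inv y) = \<omega> powi i)"
    using character_of_stabiliser[OF H comm g _ \<omega>(1)] ord unfolding \<omega>_def by blast
  then obtain \<chi> where \<chi>: "\<And>y. y \<in> carrier G \<Longrightarrow> character (G\<lparr>carrier := H\<rparr>) (\<chi> y)"
    and \<chi>g: "\<And>y (i :: int). y \<in> carrier G \<Longrightarrow> y \<otimes> g [^] (- i) \<otimes> inv y \<in> H \<Longrightarrow>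
        \<chi> y (y \<otimes> g [^] (- i) \<otimes> inv y) = \<omega> powi i"
    unfolding bchoice_iff by blast
  define S where "S = t ` carrier G"
  have fS: "finite S" using S by (simp add: S_def)
  obtain r \<psi> where r: "\<And>x. x \<in> S \<Longrightarrow> r x \<in> S" "\<And>x. x \<in> S \<Longrightarrow> r (t (x \<otimes> inv g)) = r x"
    and \<psi>: "\<And>x. x \<in> S \<Longrightarrow> cmod (\<psi> x) = 1"
      "\<And>x. x \<in> S \<Longrightarrow> \<psi> (t (x \<otimes> inv g)) = inverse \<omega> * \<chi> (r x) (x \<otimes> inv g \<otimes> inv (t (x \<otimes> inv g))) * \<psi> x"
    using cocycle_trivialisation[OF H g \<omega>(1) t(1,2) \<chi> \<chi>g, folded S_def] by blast
  have SG: "x \<in> carrier G" if "x \<in> S" for x using that t(1) by (auto simp: S_def)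
  have HG: "a \<in> carrier G" if "a \<in> H" for a using that subgroup.subset[OF H] by blast
  \<comment> \<open>The action on cosets, written on representatives; \<open>c a x\<close> below is
    the element of \<open>H\<close> that compares \<open>x \<otimes> inv a\<close> with its
    representative.\<close>
  define act where "act = (\<lambda>a x. t (x \<otimes> inv a))"
  define c where "c = (\<lambda>a x. x \<otimes> inv a \<otimes> inv (act a x))"
  have actS: "act a x \<in> S" if "a \<in> carrier G" "x \<in> S" for a x
    using that SG by (auto simp: act_def S_def)
  have cH: "c a x \<in> H" if "a \<in> carrier G" "x \<in> S" for a x
    unfolding c_def act_def using that SG by (intro t(2)) simp
  have act_one: "act \<one> x = x" if x: "x \<in> S" for x
  proof -
    obtain a where a: "a \<in> carrier G" "x = t a" using x by (auto simp: S_def)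
    thus ?thesis using t(3)[OF a(1) t(1)[OF a(1)] t(2)[OF a(1)]] t(1) by (simp add: act_def)
  qed
  have act_mult: "act (a \<otimes> b) x = act a (act b x)" if "a \<in> carrier G" "b \<in> carrier G" "x \<in> S" for a b x
  proof -
    note x = SG[OF that(3)] SG[OF actS[OF that(2,3)]]
    have "(x \<otimes> inv (a \<otimes> b)) \<otimes> inv (act b x \<otimes> inv a) = c b x"
      using that(1,2) x by (simp add: c_def inv_mult_group m_assoc inv_mult_cancel_left)
    thus ?thesis using t(3)[of "x \<otimes> inv (a \<otimes> b)" "act b x \<otimes> inv a"] cH[OF that(2,3)] that(1,2) x
      by (simp add: act_def)
  qed
  have c_mult: "c (a \<otimes> b) x = c b x \<otimes> c a (act b x)" if "a \<in> carrier G" "b \<in> carrier G" "x \<in> S" for a b x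
    unfolding c_def act_mult[OF that]
    using that(1,2) SG[OF that(3)] SG[OF actS[OF that(2,3)]] SG[OF actS[OF that(1) actS[OF that(2,3)]]]
    by (simp add: inv_mult_group m_assoc inv_mult_cancel_left)
  define q where "q = (\<lambda>a y x. \<chi> y (c a x))"
  have q1: "cmod (q a y x) = 1" if "a \<in> carrier G" "x \<in> S" "y \<in> S" for a y x
    unfolding q_def using characterD(1)[OF \<chi>[OF SG[OF that(3)]]] cH[OF that(1,2)] by simp
  have q_mult: "q (a \<otimes> b) y x = q a y (act b x) * q b y x"
    if "a \<in> carrier G" "b \<in> carrier G" "x \<in> S" "y \<in> S" for a b y x
    unfolding q_def c_mult[OF that(1-3)]
    using characterD(2)[OF \<chi>[OF SG[OF that(4)]]] cH[OF that(2,3)] cH[OF that(1) actS[OF that(2,3)]] by simp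
  \<comment> \<open>Basis of the induced representation: a coset, with a label below
    \<open>N\<close> for each tensor factor.\<close>
  define B where "B = S \<times> (S \<rightarrow>\<^sub>E {..<N})"
  have fB: "finite B" unfolding B_def using fS by (intro finite_cartesian_product finite_PiE) auto
  define m where "m = card B"
  have "t \<one> \<in> S" by (simp add: S_def)
  hence "(t \<one>, \<lambda>x\<in>S. 0) \<in> B" using N by (auto simp: B_def)
  hence m: "m > 0" unfolding m_def using fB card_gt_0_iff by blast
  obtain e where e: "bij_betw e {..<m} B"
    using ex_bij_betw_nat_finite[OF fB] unfolding m_def by (auto simp: atLeast0LessThan)
  define f where "f = (\<lambda>a. map_prod (act a) (id :: ('a \<Rightarrow> nat) \<Rightarrow> _))"
  \<comment> \<open>Label \<open>n\<close> in factor \<open>y\<close> is multiplied by the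
    \<open>n\<close>-th power of \<open>\<chi> y\<close> at the cocycle, so this factor carries the
    powers 0 to \<open>N - 1\<close> of one character.\<close>
  define l where "l = (\<lambda>a (x, n). \<Prod>y\<in>S. q a y x ^ n y)"
  define \<sigma> where "\<sigma> = (\<lambda>a. kernel_mat e m (\<lambda>v u. if v = f a u then l a u else 0))"
  have fB': "f a u \<in> B" if "a \<in> carrier G" "u \<in> B" for a u
    using that actS by (auto simp: f_def B_def)
  have f_mult: "f (a \<otimes> b) u = f a (f b u)" if "a \<in> carrier G" "b \<in> carrier G" "u \<in> B" for a b u
    using that act_mult by (auto simp: f_def B_def)
  have f_one: "f \<one> u = u" if "u \<in> B" for u using that act_one by (auto simp: f_def B_def)
  have \<sigma>: "\<sigma> \<in> hom G (unitary_group m)"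
    unfolding \<sigma>_def
  proof (rule kernel_mat_monomial_hom[OF e])
    show "group G" by (rule is_group)
    show "cmod (l a u) = 1" if "a \<in> carrier G" "u \<in> B" for a u
      using that q1 by (auto simp: l_def B_def prod_norm[symmetric] norm_power intro!: prod.neutral)
    show "l (a \<otimes> b) u = l a (f b u) * l b u" if a: "a \<in> carrier G" "b \<in> carrier G" and uB: "u \<in> B" for a b u
    proof -
      obtain x n where u: "u = (x, n)" "x \<in> S" using uB by (auto simp: B_def)
      have "(\<Prod>y\<in>S. q (a \<otimes> b) y x ^ n y) = (\<Prod>y\<in>S. q a y (act b x) ^ n y * q b y x ^ n y)"
        by (intro prod.cong) (simp_all add: q_mult a u(2) power_mult_distrib)
      thus ?thesis by (simp add: u(1) l_def f_def prod.distrib)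
    qed
  qed (use fB' f_mult f_one in auto)
  have ginv: "inv g \<in> carrier G" using g by simp
  have bij: "bij_betw (f g) B B"
    by (rule bij_betwI[of _ _ _ "f (inv g)"])
      (use fB'[OF g] fB'[OF ginv] f_mult[OF g ginv] f_mult[OF ginv g] f_one g in auto)
  have inj: "inj_on (act g) S"
    by (rule inj_on_inverseI[of _ "act (inv g)"]) (use act_mult[OF ginv g] act_one g in simp)
  define P where "P = (\<lambda>i. fibre_kernel N S r (\<lambda>x. \<omega> ^ i * \<psi> x))"
  have "\<sigma> g \<in> carrier (unitary_group m)" using \<sigma> g by (auto simp: hom_def)
  hence "cyclic_tower N m (\<sigma> g) (\<lambda>i. kernel_mat e m (P i))"
    unfolding \<sigma>_def
  proof (rule kernel_mat_cyclic_tower[OF e bij])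
    show "cnj (P i v u) = P i u v" for i u v unfolding P_def by (rule fibre_kernel_hermitian)
    show "(\<Sum>w\<in>B. P i u w * P j w v) = (if i = j then P i u v else 0)"
      if "i \<in> {1..N}" "j \<in> {1..N}" "u \<in> B" "v \<in> B" for i j u v
      using that unfolding P_def B_def by (intro fibre_kernel_mult[OF fS N r(1) \<omega> \<psi>(1)]) auto
    show "(\<Sum>i\<in>{1..N}. P i u v) = (if u = v then 1 else 0)" if "u \<in> B" "v \<in> B" for u v
      using that unfolding P_def B_def by (intro fibre_kernel_total[OF fS N r(1) \<omega> \<psi>(1)]) auto
    show "P (if i = N then 1 else i + 1) (f g u) (f g v) * l g v = l g u * P i u v"
      if "i \<in> {1..N}" "u \<in> B" "v \<in> B" for i u v
      unfolding P_def f_def l_def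
    proof (rule fibre_kernel_shift[OF fS N r(1) \<omega> \<psi>(1) inj])
      show "r (act g x) = r x" if "x \<in> S" for x using r(2)[OF that] by (simp add: act_def)
      show "\<psi> (act g x) = inverse \<omega> * q g (r x) x * \<psi> x" if "x \<in> S" for x
        using \<psi>(2)[OF that] by (simp add: act_def q_def c_def)
    qed (use that q1[OF g] in \<open>auto simp: B_def\<close>)
  qed
  thus ?thesis using m \<sigma> by blast
qed

section \<open>The product type action\<close>

text \<open>Multiples of a representation fill those factors whose size is a multiple of
  \<open>m\<close>.\<close>

lemma hom_kron_one:
  assumes "\<sigma> \<in> hom G (unitary_group m)"
  shows "(\<lambda>g. kron (\<sigma> g) (1\<^sub>m c)) \<in> hom G (unitary_group (m * c))"
proof (rule homI)
  have \<sigma>: "\<sigma> g \<in> carrier_mat m m" "mat_adjoint (\<sigma> g) * \<sigma> g = 1\<^sub>m m" "\<sigma> g * mat_adjoint (\<sigma> g) = 1\<^sub>m m"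
    if "g \<in> carrier G" for g
    using hom_in_carrier[OF assms that] by (auto simp: unitary_group_def)
  fix g assume g: "g \<in> carrier G"
  note \<sigma>' = mat_adjoint_carrier[OF \<sigma>(1)[OF g]]
  show "kron (\<sigma> g) (1\<^sub>m c) \<in> carrier (unitary_group (m * c))"
    using kron_mult[OF \<sigma>(1)[OF g] one_carrier_mat \<sigma>' one_carrier_mat, of c]
      kron_mult[OF \<sigma>' one_carrier_mat \<sigma>(1)[OF g] one_carrier_mat, of c]
    by (simp add: unitary_group_def kron_adjoint \<sigma>[OF g] kron_one_one kron_carrier)
  fix h assume h: "h \<in> carrier G"
  show "kron (\<sigma> (g \<otimes>\<^bsub>G\<^esub> h)) (1\<^sub>m c) = kron (\<sigma> g) (1\<^sub>m c) \<otimes>\<^bsub>unitary_group (m * c)\<^esub> kron (\<sigma> h) (1\<^sub>m c)"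
    using kron_mult[OF \<sigma>(1)[OF g] one_carrier_mat \<sigma>(1)[OF h] one_carrier_mat, of c] hom_mult[OF assms g h]
    by (simp add: unitary_group_def)
qed

lemma cyclic_tower_kron_one:
  assumes v: "v \<in> carrier_mat m m" and p: "cyclic_tower k m v p"
  shows "cyclic_tower k (m * c) (kron v (1\<^sub>m c)) (\<lambda>i. kron (p i) (1\<^sub>m c))"
proof -
  have P: "p i \<in> carrier_mat m m" "mat_adjoint (p i) = p i" "p i * p i = p i"
    "v * p i * mat_adjoint v = p (if i = k then 1 else i + 1)" if "i \<in> {1..k}" for i
    using p that unfolding cyclic_tower_def by blast+
  have O: "p i * p j = 0\<^sub>m m m" if "i \<in> {1..k}" "j \<in> {1..k}" "i \<noteq> j" for i j
    using p that unfolding cyclic_tower_def by blast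
  have T: "(\<Sum>i\<in>{1..k}. p i $$ (a, b)) = (if a = b then 1 else 0)" if "a < m" "b < m" for a b
    using p that unfolding cyclic_tower_def by blast
  have mult: "kron A (1\<^sub>m c) * kron B (1\<^sub>m c) = kron (A * B) (1\<^sub>m c)"
    if "A \<in> carrier_mat m m" "B \<in> carrier_mat m m" for A B
    using kron_mult[OF that(1) one_carrier_mat that(2) one_carrier_mat, of c] by simp
  show ?thesis
    unfolding cyclic_tower_def
  proof (intro conjI ballI allI impI)
    fix i assume i: "i \<in> {1..k}"
    show "kron (p i) (1\<^sub>m c) \<in> carrier_mat (m * c) (m * c)" using P(1)[OF i] by (intro kron_carrier) auto
    show "mat_adjoint (kron (p i) (1\<^sub>m c)) = kron (p i) (1\<^sub>m c)" by (simp add: kron_adjoint P(2)[OF i])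
    show "kron (p i) (1\<^sub>m c) * kron (p i) (1\<^sub>m c) = kron (p i) (1\<^sub>m c)"
      using mult[OF P(1)[OF i] P(1)[OF i]] by (simp add: P(3)[OF i])
    show "kron (p i) (1\<^sub>m c) * kron (p j) (1\<^sub>m c) = 0\<^sub>m (m * c) (m * c)" if j: "j \<in> {1..k}" "i \<noteq> j" for j
      using mult[OF P(1)[OF i] P(1)[OF j(1)]] by (simp add: O[OF i j] kron_zero_left)
    show "kron v (1\<^sub>m c) * kron (p i) (1\<^sub>m c) * mat_adjoint (kron v (1\<^sub>m c)) = kron (p (if i = k then 1 else i + 1)) (1\<^sub>m c)"
      unfolding kron_adjoint mat_adjoint_one mult[OF v P(1)[OF i]]
        mult[OF mult_carrier_mat[OF v P(1)[OF i]] mat_adjoint_carrier[OF v]] P(4)[OF i] by simp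
  next
    fix a b assume ab: "a < m * c" "b < m * c"
    note dm = div_mod_less[OF ab(1)] div_mod_less[OF ab(2)]
    have "kron (p i) (1\<^sub>m c) $$ (a, b) = p i $$ (a div c, b div c) * 1\<^sub>m c $$ (a mod c, b mod c)" if "i \<in> {1..k}" for i
      using P(1)[OF that] ab by (simp add: kron_index)
    hence "(\<Sum>i\<in>{1..k}. kron (p i) (1\<^sub>m c) $$ (a, b)) = (\<Sum>i\<in>{1..k}. p i $$ (a div c, b div c)) * 1\<^sub>m c $$ (a mod c, b mod c)"
      by (simp add: sum_distrib_right)
    also have "\<dots> = (if a = b then 1 else 0)"
    proof -
      have "a = b \<longleftrightarrow> a div c = b div c \<and> a mod c = b mod c" by (metis div_mult_mod_eq)
      thus ?thesis unfolding T[OF dm(1,3)] using dm(2,4) by auto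
    qed
    finally show "(\<Sum>i\<in>{1..k}. kron (p i) (1\<^sub>m c) $$ (a, b)) = (if a = b then 1 else 0)" .
  qed
qed

text \<open>Without movement, neighbouring projections are both equal and orthogonal, hence zero,
  and cannot add up to 1. This will give injectivity of the action.\<close>

lemma cyclic_tower_nontrivial:
  assumes p: "cyclic_tower k m (1\<^sub>m m) p" and m: "m > 0" and k: "k \<ge> 2"
  shows False
proof -
  have "p i $$ (0, 0) = 0" if i: "i \<in> {1..k}" for i
  proof -
    define j where "j = (if i = k then 1 else i + 1)"
    have j: "j \<in> {1..k}" "i \<noteq> j" using i k by (auto simp: j_def)
    have c: "p i \<in> carrier_mat m m" "p i * p i = p i" using p i unfolding cyclic_tower_def by blast+
    have "1\<^sub>m m * p i * mat_adjoint (1\<^sub>m m) = p j" using p i unfolding cyclic_tower_def j_def by blast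
    hence "p i = p j" using c(1) by simp
    hence "p i = p i * p j" using c(2) by simp
    also have "\<dots> = 0\<^sub>m m m" using p i j unfolding cyclic_tower_def by blast
    finally show ?thesis using m by simp
  qed
  hence "(\<Sum>i\<in>{1..k}. p i $$ (0, 0)) = 0" by simp
  thus False using p m unfolding cyclic_tower_def by auto
qed

text \<open>An element \<open>x\<close> is placed at the numbers \<open>fact j\<close> for infinitely many \<open>j\<close>, almost all of which are
  divisible by \<open>d x\<close>.\<close>

lemma enumerate_at_multiples:
  fixes d :: "'b \<Rightarrow> nat"
  assumes V: "countable V" "V \<noteq> {}" and d: "\<And>x. x \<in> V \<Longrightarrow> d x > 0"
  shows "\<exists>\<kappa>. (\<forall>n. \<kappa> n \<in> V) \<and> (\<forall>x\<in>V. \<forall>M. \<exists>n\<ge>M. \<kappa> (Suc n) = x \<and> d x dvd Suc n)"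
proof -
  \<comment> \<open>\<open>LEAST\<close> inverts the factorial, and the first component of
    \<open>prod_decode\<close> takes every value infinitely often. At numbers that are not
    factorials the value is arbitrary, but still in \<open>V\<close>.\<close>
  define \<kappa> where "\<kappa> = (\<lambda>n :: nat. from_nat_into V (fst (prod_decode (LEAST j. fact j = n))))"
  have "\<exists>n\<ge>M. \<kappa> (Suc n) = x \<and> d x dvd Suc n" if x: "x \<in> V" for x M
  proof -
    obtain i where i: "from_nat_into V i = x" using from_nat_into_surj[OF V(1) x] by blast
    \<comment> \<open>The second component makes \<open>j\<close> large: at least \<open>M\<close>,
      at least \<open>d x\<close> so that \<open>d x\<close> divides \<open>fact j\<close>, and at
      least 2 to avoid the coincidence of \<open>fact 0\<close> and \<open>fact 1\<close>.\<close>
    define j where "j = prod_encode (i, M + d x + 2)"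
    have j: "M + d x + 2 \<le> j" unfolding j_def by (rule le_prod_encode_2)
    have "(LEAST j'. fact j' = (fact j :: nat)) = j"
    proof (rule Least_equality)
      fix j' assume e: "fact j' = (fact j :: nat)"
      show "j \<le> j'"
      proof (rule ccontr)
        assume "\<not> j \<le> j'"
        moreover have "(fact 1 :: nat) < fact j" using j by (intro fact_less_mono) auto
        hence "j' \<noteq> 0" using e by (intro notI) simp
        ultimately have "(fact j' :: nat) < fact j" by (intro fact_less_mono) auto
        thus False using e by simp
      qed
    qed simp
    hence "\<kappa> (fact j) = from_nat_into V (fst (prod_decode j))" by (simp add: \<kappa>_def)
    hence \<kappa>: "\<kappa> (fact j) = x" by (simp add: j_def i)
    have "d x dvd fact j" using d[OF x] j by (intro dvd_fact) auto
    moreover have "Suc (fact j - 1) = (fact j :: nat)" by simp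
    moreover have "M \<le> fact j - 1" using j fact_ge_self[of j] by linarith
    ultimately show ?thesis using \<kappa> by metis
  qed
  moreover have "\<kappa> n \<in> V" for n unfolding \<kappa>_def by (rule from_nat_into[OF V(2)])
  ultimately show ?thesis by blast
qed

text \<open>There are only countably many admissible pairs \<open>(g, N)\<close>, so each can
  receive infinitely many factors, and a factor has to serve only its own pair.\<close>

lemma (in group) almost_abelian_towers:
  assumes G: "countable (carrier G)" "almost_abelian G"
  shows "\<exists>u\<in>hom G U_prod. \<forall>g\<in>carrier G. \<forall>N>0.
      (\<forall>i :: int. g [^] i = \<one> \<longrightarrow> cis (2 * pi / real N) powi i = 1) \<longrightarrow>
      (\<forall>M. \<exists>n\<ge>M. \<exists>p. cyclic_tower N (Suc n) (u g (Suc n)) p)"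
proof -
  obtain H where H: "subgroup H G" "comm_group (G\<lparr>carrier := H\<rparr>)" "finite (rcosets H)"
    using G(2) by (auto simp: almost_abelian_def)
  define V where "V = {(g, N :: nat). g \<in> carrier G \<and> N > 0 \<and>
    (\<forall>i :: int. g [^] i = \<one> \<longrightarrow> cis (2 * pi / real N) powi i = 1)}"
  have "\<forall>x\<in>V. \<exists>y. fst y > 0 \<and> snd y \<in> hom G (unitary_group (fst y)) \<and>
      (\<exists>p. cyclic_tower (snd x) (fst y) (snd y (fst x)) p)"
  proof
    fix x assume "x \<in> V"
    hence "\<exists>m>0. \<exists>\<sigma>\<in>hom G (unitary_group m). \<exists>p. cyclic_tower (snd x) m (\<sigma> (fst x)) p"
      by (intro representation_with_tower[OF H]) (auto simp: V_def)
    then obtain m \<sigma> where "m > 0" "\<sigma> \<in> hom G (unitary_group m)" "\<exists>p. cyclic_tower (snd x) m (\<sigma> (fst x)) p"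
      by blast
    thus "\<exists>y. fst y > 0 \<and> snd y \<in> hom G (unitary_group (fst y)) \<and>
        (\<exists>p. cyclic_tower (snd x) (fst y) (snd y (fst x)) p)"
      by (intro exI[of _ "(m, \<sigma>)"]) simp
  qed
  from bchoice[OF this] obtain y where y: "\<forall>x\<in>V. fst (y x) > 0 \<and> snd (y x) \<in> hom G (unitary_group (fst (y x))) \<and>
      (\<exists>p. cyclic_tower (snd x) (fst (y x)) (snd (y x) (fst x)) p)" ..
  define d \<sigma> where "d = (\<lambda>x. fst (y x))" and "\<sigma> = (\<lambda>x. snd (y x))"
  have d: "d x > 0" and \<sigma>: "\<sigma> x \<in> hom G (unitary_group (d x))"
    and tower: "\<exists>p. cyclic_tower (snd x) (d x) (\<sigma> x (fst x)) p" if "x \<in> V" for x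
    using bspec[OF y that] by (simp_all add: d_def \<sigma>_def)
  have "V \<subseteq> carrier G \<times> UNIV" by (auto simp: V_def)
  hence V: "countable V" using G(1) by (meson countable_SIGMA countableI_type countable_subset)
  have "(\<one>, 1) \<in> V" by (simp add: V_def)
  hence "V \<noteq> {}" by blast
  hence "\<exists>\<kappa>. (\<forall>n. \<kappa> n \<in> V) \<and> (\<forall>x\<in>V. \<forall>M. \<exists>n\<ge>M. \<kappa> (Suc n) = x \<and> d x dvd Suc n)"
    by (intro enumerate_at_multiples V d)
  then obtain \<kappa> where "\<forall>n. \<kappa> n \<in> V" "\<forall>x\<in>V. \<forall>M. \<exists>n\<ge>M. \<kappa> (Suc n) = x \<and> d x dvd Suc n"
    by (elim exE conjE)
  hence \<kappa>: "\<And>n. \<kappa> n \<in> V" "\<And>x M. x \<in> V \<Longrightarrow> \<exists>n\<ge>M. \<kappa> (Suc n) = x \<and> d x dvd Suc n" by simp_all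
  \<comment> \<open>A multiple of the assigned representation when its dimension divides
    \<open>n\<close>; otherwise the trivial representation as a default.\<close>
  define \<rho> where "\<rho> = (\<lambda>n g. if d (\<kappa> n) dvd n then kron (\<sigma> (\<kappa> n) g) (1\<^sub>m (n div d (\<kappa> n))) else 1\<^sub>m n)"
  have \<rho>: "\<rho> n \<in> hom G (unitary_group n)" for n
  proof (cases "d (\<kappa> n) dvd n")
    case True
    thus ?thesis using hom_kron_one[OF \<sigma>[OF \<kappa>(1)[of n]], of "n div d (\<kappa> n)"] by (simp add: \<rho>_def)
  next
    case False
    thus ?thesis by (auto simp: \<rho>_def hom_def unitary_group_def)
  qed
  define u where "u = (\<lambda>g. \<lambda>n\<in>{1..}. \<rho> n g)"
  have "u \<in> hom G U_prod"
  proof (rule homI)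
    show "u g \<in> carrier U_prod" if "g \<in> carrier G" for g
      using hom_in_carrier[OF \<rho> that] by (auto simp: u_def U_prod_def)
    show "u (g \<otimes> h) = u g \<otimes>\<^bsub>U_prod\<^esub> u h" if "g \<in> carrier G" "h \<in> carrier G" for g h
      using hom_mult[OF \<rho> that] by (auto simp: u_def U_prod_def)
  qed
  moreover have "\<exists>n\<ge>M. \<exists>p. cyclic_tower N (Suc n) (u g (Suc n)) p"
    if "g \<in> carrier G" "N > 0" "\<And>i :: int. g [^] i = \<one> \<Longrightarrow> cis (2 * pi / real N) powi i = 1" for g N M
  proof -
    have x: "(g, N) \<in> V" using that by (simp add: V_def)
    obtain n where n: "n \<ge> M" "\<kappa> (Suc n) = (g, N)" "d (g, N) dvd Suc n" using \<kappa>(2)[OF x] by blast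
    obtain p where "cyclic_tower N (d (g, N)) (\<sigma> (g, N) g) p" using tower[OF x] by auto
    moreover have "\<sigma> (g, N) g \<in> carrier_mat (d (g, N)) (d (g, N))"
      using hom_in_carrier[OF \<sigma>[OF x] that(1)] by (simp add: unitary_group_def)
    ultimately have "\<exists>p. cyclic_tower N (d (g, N) * (Suc n div d (g, N))) (kron (\<sigma> (g, N) g) (1\<^sub>m (Suc n div d (g, N)))) p"
      using cyclic_tower_kron_one by blast
    moreover have "u g (Suc n) = kron (\<sigma> (g, N) g) (1\<^sub>m (Suc n div d (g, N)))"
      using n by (simp add: u_def \<rho>_def)
    ultimately have "\<exists>p. cyclic_tower N (Suc n) (u g (Suc n)) p"
      using n(3) by (simp only: dvd_mult_div_cancel)
    thus ?thesis using n(1) by blast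
  qed
  ultimately show ?thesis by blast
qed

text \<open>An element of finite order gets towers whose height is its order, one of infinite order
  gets towers of every height. In both cases an element other than \<open>\<one>\<close> has a tower
  of height at least 2, so \<open>u\<close> is injective.\<close>

lemma (in group) almost_abelian_rokhlin:
  assumes "countable (carrier G)" "almost_abelian G"
  shows "\<exists>u \<in> mon G U_prod.
           tensor_Ad \<circ> u \<in> hom G cstar_aut_group \<and> rokhlin_action G (tensor_Ad \<circ> u)"
proof -
  obtain u where u: "u \<in> hom G U_prod"
    and tower: "\<And>g N M. g \<in> carrier G \<Longrightarrow> N > 0 \<Longrightarrow>
      (\<And>i :: int. g [^] i = \<one> \<Longrightarrow> cis (2 * pi / real N) powi i = 1) \<Longrightarrow>
      \<exists>n\<ge>M. \<exists>p. cyclic_tower N (Suc n) (u g (Suc n)) p"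
    using almost_abelian_towers[OF assms] by blast
  have fin: "\<exists>n\<ge>M. \<exists>p. cyclic_tower (ord g) (Suc n) (u g (Suc n)) p" if g: "g \<in> carrier G" "ord g \<noteq> 0" for g M
  proof (rule tower)
    fix i :: int assume "g [^] i = \<one>"
    hence "int (ord g) dvd i" using int_pow_eq_id[OF g(1)] by simp
    then obtain j where "i = int (ord g) * j" by blast
    moreover have "cis (2 * pi / real (ord g)) ^ ord g = 1" using g(2) by (simp add: DeMoivre)
    ultimately show "cis (2 * pi / real (ord g)) powi i = 1" by (simp add: power_int_mult)
  qed (use g in auto)
  have inf: "\<exists>n\<ge>M. \<exists>p. cyclic_tower N (Suc n) (u g (Suc n)) p" if g: "g \<in> carrier G" "ord g = 0" and N: "N > 0" for g N M
  proof (rule tower)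
    fix i :: int assume "g [^] i = \<one>"
    hence "i = 0" using int_pow_eq_id[OF g(1)] g(2) by simp
    thus "cis (2 * pi / real N) powi i = 1" by simp
  qed (use g N in auto)
  have "inj_on u (carrier G)"
  proof -
    have hom: "group_hom G U_prod u"
      by (intro group_hom.intro group_hom_axioms.intro is_group group_U_prod u)
    show ?thesis
      unfolding group_hom.inj_on_one_iff[OF hom]
    proof (intro allI impI, rule ccontr)
      fix g assume g: "g \<in> carrier G" and e: "u g = \<one>\<^bsub>U_prod\<^esub>" and "g \<noteq> \<one>"
      have "u g (Suc n) = 1\<^sub>m (Suc n)" for n unfolding e by (simp add: U_prod_def unitary_group_def)
      moreover have "\<exists>N\<ge>2. \<exists>n p. cyclic_tower N (Suc n) (u g (Suc n)) p"
      proof (cases "ord g = 0")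
        case True
        obtain n p where "cyclic_tower 2 (Suc n) (u g (Suc n)) p" using inf[OF g True, of 2 0] by auto
        thus ?thesis using order.refl by blast
      next
        case False
        moreover have "ord g \<noteq> 1" using ord_eq_1[OF g] \<open>g \<noteq> \<one>\<close> by simp
        ultimately have "2 \<le> ord g" by simp
        thus ?thesis using fin[OF g False] by blast
      qed
      ultimately show False using cyclic_tower_nontrivial by (metis zero_less_Suc)
    qed
  qed
  hence "u \<in> mon G U_prod" using u by (simp add: mon_def)
  moreover have "tensor_Ad \<circ> u \<in> hom G cstar_aut_group" using u tensor_Ad_hom by (rule Group.hom_compose)
  moreover have "rokhlin_action G (tensor_Ad \<circ> u)"
    unfolding rokhlin_action_def
  proof (intro ballI)
    fix g assume g: "g \<in> carrier G"
    have ug: "u g \<in> carrier U_prod" using u g by (rule hom_in_carrier)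
    show "if ord g = 0 then rokhlin ((tensor_Ad \<circ> u) g) else order_rokhlin (ord g) ((tensor_Ad \<circ> u) g)"
    proof (cases "ord g = 0")
      case True
      have "\<exists>p. orthogonal_projections (Suc n) p \<and>
          (\<forall>i\<in>{1..Suc n}. \<forall>a\<in>F. norm (p i * a - a * p i) < \<epsilon>) \<and>
          (\<forall>i\<in>{1..<Suc n}. norm (tensor_Ad (u g) (p i) - p (i + 1)) < \<epsilon>) \<and> (\<Sum>i\<in>{1..Suc n}. p i) = 1"
        if e: "\<epsilon> > 0" and F: "finite F" for n \<epsilon> F
      proof -
        obtain p where p: "orthogonal_projections (Suc n) p" "(\<Sum>i\<in>{1..Suc n}. p i) = 1"
            "\<forall>i\<in>{1..Suc n}. \<forall>a\<in>F. norm (p i * a - a * p i) < \<epsilon>"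
          and shift: "\<forall>i\<in>{1..Suc n}. tensor_Ad (u g) (p i) = p (if i = Suc n then 1 else i + 1)"
          using cyclic_tower_rokhlin[OF ug inf[OF g True zero_less_Suc[of n]] e F] by blast
        have "norm (tensor_Ad (u g) (p i) - p (i + 1)) < \<epsilon>" if "i \<in> {1..<Suc n}" for i
          using bspec[OF shift, of i] that e by simp
        thus ?thesis using p by blast
      qed
      thus ?thesis using True unfolding rokhlin_def o_apply by (auto intro!: exI[of _ "Suc _"])
    next
      case False
      have "order_rokhlin (ord g) (tensor_Ad (u g))"
        unfolding order_rokhlin_def
      proof (intro allI impI)
        fix \<epsilon> :: real and F :: "univ_uhf set" assume e: "0 < \<epsilon>" and F: "finite F"
        obtain p where p: "orthogonal_projections (ord g) p" "(\<Sum>i\<in>{1..ord g}. p i) = 1"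
            "\<forall>i\<in>{1..ord g}. \<forall>a\<in>F. norm (p i * a - a * p i) < \<epsilon>"
          and shift: "\<forall>i\<in>{1..ord g}. tensor_Ad (u g) (p i) = p (if i = ord g then 1 else i + 1)"
          using cyclic_tower_rokhlin[OF ug fin[OF g False] e F] by blast
        have "norm (tensor_Ad (u g) (p i) - p (if i = ord g then 1 else i + 1)) < \<epsilon>" if "i \<in> {1..ord g}" for i
          unfolding bspec[OF shift that] using e by simp
        thus "\<exists>p. orthogonal_projections (ord g) p \<and>
          (\<forall>i\<in>{1..ord g}. \<forall>a\<in>F. norm (p i * a - a * p i) < \<epsilon>) \<and>
          (\<forall>i\<in>{1..ord g}. norm (tensor_Ad (u g) (p i) - p (if i = ord g then 1 else i + 1)) < \<epsilon>) \<and>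
          (\<Sum>i\<in>{1..ord g}. p i) = 1" using p by blast
      qed
      thus ?thesis using False by simp
    qed
  qed
  ultimately show ?thesis by blast
qed

theorem theorem5p5:
  fixes G :: "('g, 'm) monoid_scheme"
  assumes "group G" and "countable (carrier G)" and "almost_abelian G"
  shows "\<exists>u \<in> mon G U_prod.
           tensor_Ad \<circ> u \<in> hom G cstar_aut_group \<and> rokhlin_action G (tensor_Ad \<circ> u)"
  using group.almost_abelian_rokhlin[OF assms] .

end
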